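(* Let $\phi\neq 0$ be an element of $J^!_{k,m}(\varepsilon^h)$ (for some rational $k,h$ and $m\in\frac12\mathbb Z_{\ge0}$) with Fourier expansion $\phi(\tau,z)=\sum_{n,r}c_\phi(n,r)q^n\zeta^r$, and define for real $x$ $$\operatorname{ord}(\phi,x)=\min\{\,n+rx+mx^2:\ c_\phi(n,r)\neq 0\,\}.$$ Then: (1) $x\mapsto\operatorname{ord}(\phi,x)$ is continuous, piecewise quadratic, and periodic with period $1$. (2) If $m=0$ (so $\phi$ is a weakly holomorphic elliptic modular form independent of $z$), then $\operatorname{ord}(\phi,\cdot)$ is constant and equals the usual order of $\phi$ at the cusp $\infty$. (3) For any fixed real $u,x,y$ there is a constant $C=C(u,x,y)$ such that $$\phi(\tau,x\tau+y)\,e(mx^2\tau)=\bigl(C+o(1)\bigr)e^{-2\pi\operatorname{ord}(\phi,x)v}$$ as $\tau=u+iv$ with $v\to\infty$; the constant $C$ depends only on $u,x,y$ modulo $N\mathbb Z$ for a suitable integer $N\ge1$, and is different from zero for almost all $u,x,y$. (4) For any two (nonzero) weakly holomorphic Jacobi forms $\phi,\psi$ (of this type) one has $\operatorname{ord}(\phi\psi,\cdot)=\operatorname{ord}(\phi,\cdot)+\operatorname{ord}(\psi,\cdot)$. (5) $\phi\in J_{k,m}(\varepsilon^h)$ if and only if $\operatorname{ord}(\phi,x)\ge0$ for all $x$, and $\phi\in J^{\mathrm{cusp}}_{k,m}(\varepsilon^h)$ if and only if $\operatorname{ord}(\phi,x)>0$ for all $x$. (6) For any integer $l$, with $(U_l\phi)(\tau,z)=\phi(\tau,lz)$,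 one has $\operatorname{ord}(U_l\phi,x)=\operatorname{ord}(\phi,lx)$.
   Context: Notation: $\mathbb H$ is the upper half-plane, $e(x)=e^{2\pi i x}$, $q=e(\tau)$, $\zeta=e(z)$, $\eta(\tau)=q^{1/24}\prod_{n\ge1}(1-q^n)$, and $\vartheta(\tau,z)=\sum_{r\in\mathbb Z}\left(\frac{-4}{r}\right)q^{r^2/8}\zeta^{r/2}$ (Jacobi theta function). For integers $k$ and $m\ge0$, $J^!_{k,m}(1)$ denotes the space of holomorphic $\phi:\mathbb H\times\mathbb C\to\mathbb C$ with $\phi(\frac{a\tau+b}{c\tau+d},\frac{z}{c\tau+d})=(c\tau+d)^k e(\frac{mcz^2}{c\tau+d})\phi(\tau,z)$ for all $\begin{pmatrix}a&b\\c&d\end{pmatrix}\in SL_2(\mathbb Z)$, $\phi(\tau,z+\lambda\tau+\mu)=e(-m(\lambda^2\tau+2\lambda z))\phi(\tau,z)$ for all $\lambda,\mu\in\mathbb Z$, and with a Fourier expansion $\sum_{n\ge n_0}\sum_{r\in\mathbb Z}c(n,r)q^n\zeta^r$ for some $n_0\in\mathbb Z$. For rational $k,h$ with $2k\equiv h\pmod 2$ and $m\in\frac12\mathbb Z_{\ge0}$, $J^!_{k,m}(\varepsilon^h)$ ("weakly holomorphic Jacobi forms of weight $k$, index $m$, character $\varepsilon^h$", where $\varepsilon^h$ is the multiplier system of $\eta^h$) is: if $m\in\mathbb Z$, the space of $\phi$ with $\eta^{-h}\phi\in J^!_{k-h/2,m}(1)$; if $m\in\frac12+\mathbb Z$, the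 space of $\phi$ with $\eta^{-h-3}\vartheta\phi\in J^!_{k-1-h/2,m+1/2}(1)$. Such $\phi$ have Fourier expansions $\sum c(n,r)q^n\zeta^r$ with $n\in \frac{h}{24}+\mathbb Z$ bounded below and $r\in m+\mathbb Z$. The subspace $J_{k,m}(\varepsilon^h)$ (holomorphic Jacobi forms) consists of those $\phi$ with $c(n,r)=0$ unless $4nm-r^2\ge0$; the subspace $J^{\mathrm{cusp}}_{k,m}(\varepsilon^h)$ of those with $c(n,r)=0$ unless $4nm-r^2>0$.
   Formalization: (3): C depends on u,x,y mod N only up to an explicit factor of modulus 1; literally so if m=0, or for x,y in (1/D)Z with N depending on D. (5): for m=0, modular/cusp forms replace J and J^cusp. (6): l is nonzero. For half-integral m, φ itself is required holomorphic. *)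

theory Defs
  imports "HOL-Analysis.Analysis"
begin

text \<open>
  Functions on the upper half-plane, or on its product with the complex plane, are total
  functions; only their values at arguments \<open>\<tau> \<in> uhp\<close> play a role below.
\<close>

definition uhp :: "complex set" where
  "uhp = {\<tau>. Im \<tau> > 0}"

definition ee :: "complex \<Rightarrow> complex" where
  "ee x = exp (2 * of_real pi * \<i> * x)"

definition dedekind_eta :: "complex \<Rightarrow> complex" where
  "dedekind_eta \<tau> = ee (\<tau> / 24) * (\<Prod>n. 1 - ee \<tau> ^ Suc n)"

text \<open>
  The branch of \<open>\<eta>\<^sup>h\<close> on the upper half-plane that is given by the binomial series in \<open>q\<close>: since
  \<open>|q| < 1\<close>, every factor \<open>1 - q\<^sup>n\<close> has positive real part, so its principal power is holomorphic
  in \<open>\<tau>\<close>. Another branch would differ by a non-zero constant factor.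
\<close>

definition eta_pow :: "rat \<Rightarrow> complex \<Rightarrow> complex" where
  "eta_pow h \<tau> = ee (of_rat h * \<tau> / 24) * (\<Prod>n. (1 - ee \<tau> ^ Suc n) powr of_rat h)"

lemma eta_pow_1: "eta_pow 1 \<tau> = dedekind_eta \<tau>"
proof -
  have "w powr of_rat 1 = w" for w :: complex
    by (cases "w = 0") (simp_all add: powr_def)
  then show ?thesis
    by (simp add: eta_pow_def dedekind_eta_def)
qed

text \<open>The Kronecker symbol \<open>(-4/r)\<close>.\<close>

definition kron_m4 :: "int \<Rightarrow> complex" where
  "kron_m4 r = (if r mod 4 = 1 then 1 else if r mod 4 = 3 then -1 else 0)"

definition jtheta :: "complex \<Rightarrow> complex \<Rightarrow> complex" where
  "jtheta \<tau> z =
     (\<Sum>\<^sub>\<infinity>r\<in>UNIV. kron_m4 r * ee (of_int (r\<^sup>2) / 8 * \<tau>) * ee (of_int r / 2 * z))"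

text \<open>Holomorphy in two variables: complex differentiability at every point of \<open>uhp \<times> UNIV\<close>.\<close>

definition holomorphic2 :: "(complex \<Rightarrow> complex \<Rightarrow> complex) \<Rightarrow> bool" where
  "holomorphic2 \<phi> \<longleftrightarrow>
     (\<forall>\<tau>\<in>uhp. \<forall>z. \<exists>A B. ((\<lambda>p. \<phi> (fst p) (snd p)) has_derivative
                        (\<lambda>p. A * fst p + B * snd p)) (at (\<tau>, z)))"

definition nonzero :: "(complex \<Rightarrow> complex \<Rightarrow> complex) \<Rightarrow> bool" where
  "nonzero \<phi> \<longleftrightarrow> (\<exists>\<tau>\<in>uhp. \<exists>z. \<phi> \<tau> z \<noteq> 0)"

subsection \<open>Weakly holomorphic Jacobi forms\<close>

definition wh_jacobi1 :: "int \<Rightarrow> int \<Rightarrow> (complex \<Rightarrow> complex \<Rightarrow> complex) set" where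
  "wh_jacobi1 k m = {\<phi>.
     holomorphic2 \<phi> \<and>
     (\<forall>a b c d :: int. a * d - b * c = 1 \<longrightarrow>
        (\<forall>\<tau>\<in>uhp. \<forall>z.
           \<phi> ((of_int a * \<tau> + of_int b) / (of_int c * \<tau> + of_int d))
             (z / (of_int c * \<tau> + of_int d)) =
           (of_int c * \<tau> + of_int d) powi k
             * ee (of_int m * of_int c * z\<^sup>2 / (of_int c * \<tau> + of_int d)) * \<phi> \<tau> z)) \<and>
     (\<forall>l \<mu> :: int. \<forall>\<tau>\<in>uhp. \<forall>z.
        \<phi> \<tau> (z + of_int l * \<tau> + of_int \<mu>) =
        ee (- of_int m * ((of_int l)\<^sup>2 * \<tau> + 2 * of_int l * z)) * \<phi> \<tau> z) \<and>
     (\<exists>(n0 :: int) (c :: int \<Rightarrow> int \<Rightarrow> complex).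
        (\<forall>n<n0. \<forall>r. c n r = 0) \<and>
        (\<forall>\<tau>\<in>uhp. \<forall>z.
           ((\<lambda>(n, r). c n r * ee (of_int n * \<tau>) * ee (of_int r * z)) has_sum \<phi> \<tau> z) UNIV))}"

definition jacobi_params :: "rat \<Rightarrow> rat \<Rightarrow> rat \<Rightarrow> bool" where
  "jacobi_params k m h \<longleftrightarrow> (\<exists>j::int. 2 * k - h = 2 * of_int j) \<and> 2 * m \<in> \<int> \<and> m \<ge> 0"

text \<open>
  Under \<open>jacobi_params k m h\<close> all arguments of the floor function below are integers. Holomorphy of
  \<open>\<phi>\<close> has to be required separately if \<open>m\<close> is a half-integer, because the zeros of the theta
  function could cancel poles of \<open>\<phi>\<close>; for integral \<open>m\<close> it is automatic.
\<close>

definition wh_jacobi :: "rat \<Rightarrow> rat \<Rightarrow> rat \<Rightarrow> (complex \<Rightarrow> complex \<Rightarrow> complex) set" where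
  "wh_jacobi k m h = {\<phi>. holomorphic2 \<phi> \<and>
     (if m \<in> \<int>
      then (\<lambda>\<tau> z. eta_pow (- h) \<tau> * \<phi> \<tau> z) \<in> wh_jacobi1 \<lfloor>k - h / 2\<rfloor> \<lfloor>m\<rfloor>
      else (\<lambda>\<tau> z. eta_pow (- h - 3) \<tau> * jtheta \<tau> z * \<phi> \<tau> z)
             \<in> wh_jacobi1 \<lfloor>k - 1 - h / 2\<rfloor> \<lfloor>m + 1 / 2\<rfloor>)}"

definition fourier_expansion ::
    "rat \<Rightarrow> rat \<Rightarrow> (complex \<Rightarrow> complex \<Rightarrow> complex) \<Rightarrow> (rat \<Rightarrow> rat \<Rightarrow> complex) \<Rightarrow> bool" where
  "fourier_expansion m h \<phi> c \<longleftrightarrow>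
     (\<exists>n0. \<forall>n r. c n r \<noteq> 0 \<longrightarrow> n - h / 24 \<in> \<int> \<and> n \<ge> n0 \<and> r - m \<in> \<int>) \<and>
     (\<forall>\<tau>\<in>uhp. \<forall>z.
        ((\<lambda>(n, r). c n r * ee (of_rat n * \<tau>) * ee (of_rat r * z)) has_sum \<phi> \<tau> z) UNIV)"

definition fourier_coeff ::
    "rat \<Rightarrow> rat \<Rightarrow> (complex \<Rightarrow> complex \<Rightarrow> complex) \<Rightarrow> rat \<Rightarrow> rat \<Rightarrow> complex" where
  "fourier_coeff m h \<phi> = (THE c. fourier_expansion m h \<phi> c)"

definition jacobi_forms :: "rat \<Rightarrow> rat \<Rightarrow> rat \<Rightarrow> (complex \<Rightarrow> complex \<Rightarrow> complex) set" where
  "jacobi_forms k m h = {\<phi> \<in> wh_jacobi k m h.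
     \<forall>n r. \<not> 4 * n * m - r\<^sup>2 \<ge> 0 \<longrightarrow> fourier_coeff m h \<phi> n r = 0}"

definition jacobi_cusp_forms :: "rat \<Rightarrow> rat \<Rightarrow> rat \<Rightarrow> (complex \<Rightarrow> complex \<Rightarrow> complex) set" where
  "jacobi_cusp_forms k m h = {\<phi> \<in> wh_jacobi k m h.
     \<forall>n r. \<not> 4 * n * m - r\<^sup>2 > 0 \<longrightarrow> fourier_coeff m h \<phi> n r = 0}"

definition ord_values ::
    "rat \<Rightarrow> rat \<Rightarrow> (complex \<Rightarrow> complex \<Rightarrow> complex) \<Rightarrow> real \<Rightarrow> real set" where
  "ord_values m h \<phi> x =
     {of_rat n + of_rat r * x + of_rat m * x\<^sup>2 | n r. fourier_coeff m h \<phi> n r \<noteq> 0}"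

definition jord :: "rat \<Rightarrow> rat \<Rightarrow> (complex \<Rightarrow> complex \<Rightarrow> complex) \<Rightarrow> real \<Rightarrow> real" where
  "jord m h \<phi> x = (LEAST t. t \<in> ord_values m h \<phi> x)"

definition U_op :: "int \<Rightarrow> (complex \<Rightarrow> complex \<Rightarrow> complex) \<Rightarrow> complex \<Rightarrow> complex \<Rightarrow> complex" where
  "U_op l \<phi> \<tau> z = \<phi> \<tau> (of_int l * z)"

subsection \<open>Elliptic modular forms with the multiplier system of a power of eta\<close>

definition q_expansion :: "rat \<Rightarrow> (complex \<Rightarrow> complex) \<Rightarrow> (rat \<Rightarrow> complex) \<Rightarrow> bool" where
  "q_expansion h f a \<longleftrightarrow>
     (\<exists>n0. \<forall>n. a n \<noteq> 0 \<longrightarrow> n - h / 24 \<in> \<int> \<and> n \<ge> n0) \<and>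
     (\<forall>\<tau>\<in>uhp. ((\<lambda>n. a n * ee (of_rat n * \<tau>)) has_sum f \<tau>) UNIV)"

definition q_coeff :: "rat \<Rightarrow> (complex \<Rightarrow> complex) \<Rightarrow> rat \<Rightarrow> complex" where
  "q_coeff h f = (THE a. q_expansion h f a)"

definition cusp_order :: "rat \<Rightarrow> (complex \<Rightarrow> complex) \<Rightarrow> rat" where
  "cusp_order h f = (LEAST n. q_coeff h f n \<noteq> 0)"

definition wh_modular1 :: "int \<Rightarrow> (complex \<Rightarrow> complex) set" where
  "wh_modular1 k = {f.
     f holomorphic_on uhp \<and>
     (\<forall>a b c d :: int. a * d - b * c = 1 \<longrightarrow>
        (\<forall>\<tau>\<in>uhp. f ((of_int a * \<tau> + of_int b) / (of_int c * \<tau> + of_int d)) =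
           (of_int c * \<tau> + of_int d) powi k * f \<tau>)) \<and>
     (\<exists>a. q_expansion 0 f a)}"

definition wh_modular :: "rat \<Rightarrow> rat \<Rightarrow> (complex \<Rightarrow> complex) set" where
  "wh_modular k h = {f. (\<lambda>\<tau>. eta_pow (- h) \<tau> * f \<tau>) \<in> wh_modular1 \<lfloor>k - h / 2\<rfloor>}"

definition modular_forms :: "rat \<Rightarrow> rat \<Rightarrow> (complex \<Rightarrow> complex) set" where
  "modular_forms k h = {f \<in> wh_modular k h. \<forall>n<0. q_coeff h f n = 0}"

definition cusp_forms :: "rat \<Rightarrow> rat \<Rightarrow> (complex \<Rightarrow> complex) set" where
  "cusp_forms k h = {f \<in> wh_modular k h. \<forall>n\<le>0. q_coeff h f n = 0}"

subsection \<open>Piecewise quadratic functions\<close>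

text \<open>The set \<open>B\<close> of break points is locally finite; linear and constant pieces are allowed.\<close>

definition piecewise_quadratic :: "(real \<Rightarrow> real) \<Rightarrow> bool" where
  "piecewise_quadratic f \<longleftrightarrow>
     (\<exists>B. (\<forall>s t. finite (B \<inter> {s..t})) \<and>
          (\<forall>s t. s < t \<and> B \<inter> {s<..<t} = {} \<longrightarrow>
             (\<exists>a b c. \<forall>x\<in>{s<..<t}. f x = a * x\<^sup>2 + b * x + c)))"

end

theory Submission
  imports Defs "HOL-Complex_Analysis.Complex_Analysis"
begin

text \<open>
  The quotient \<open>\<vartheta>/\<eta>^3\<close> behaves like a Jacobi form of weight \<open>-1\<close> and index \<open>1/2\<close> without character
  under \<open>SL_2(\<int>)\<close>. Indeed, the quasi-periods of \<open>\<vartheta>\<close> determine it up to a factor depending on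
  \<open>\<tau>\<close>, and this factor is found from \<open>\<vartheta>'(\<tau>, 0) = 2 \<pi> \<i> \<eta>(\<tau>)^3\<close>. Hence \<open>\<phi>\<close> is a weakly
  holomorphic Jacobi form if and only if \<open>\<eta>^-h \<phi>\<close> satisfies transformation laws that are uniform in
  the index and multiplicative, together with a growth condition as \<open>Im \<tau>\<close> tends to infinity.

  Up to finitely many terms, \<open>\<phi>(\<tau>, x \<tau> + y) e(m x^2 \<tau>)\<close> is a sum of terms of strictly smaller
  growth than \<open>e^(-2 \<pi> ord(\<phi>, x) v)\<close>, and for irrational \<open>x\<close> exactly one term has this growth,
  since two of the affine functions \<open>n + r x\<close> agree at rational points only. So for irrational \<open>x\<close>
  the leading constant does not vanish and the asymptotics determine \<open>ord(\<phi>, x)\<close>. This gives the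
  periodicity, the additivity and the behaviour under \<open>U_l\<close> at irrational \<open>x\<close>, and then everywhere
  by continuity.
\<close>

text \<open>The value of \<vartheta>'(\<tau>, 0) is Jacobi's identity for the cube of the Euler
  product. It is obtained from the finite triple product: the derivative at \<open>w = 1\<close> is
  a finite identity, and dominated convergence gives the limit.

  Only finitely many terms matter because \<open>n\<close> is bounded below and
  \<open>4 m n - r^2\<close> is constant along the orbits of the elliptic shifts: for
  \<open>m > 0\<close> the discriminants on the support are bounded below, and for
  \<open>m = 0\<close> only \<open>r = 0\<close> survives.

  For \<open>m > 0\<close> the leading constant cannot be periodic without qualification: replacing
  \<open>u\<close> by \<open>u + N\<close> multiplies it by \<open>e(N ord(x))\<close>, where
  \<open>ord(x)\<close> is a nonconstant continuous function of \<open>x\<close>. Hence the exact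
  factor is stated for shifts by multiples of \<open>N\<close>, and genuine periodicity only where
  \<open>D\<close> clears the denominators of \<open>x\<close> and \<open>y\<close>, or where
  \<open>m = 0\<close>.\<close>

lemma ee_0 [simp]: "ee 0 = 1"
  by (simp add: ee_def)

lemma ee_nonzero [simp]: "ee x \<noteq> 0"
  by (simp add: ee_def)

lemma ee_add: "ee (x + y) = ee x * ee y"
  by (simp add: ee_def exp_add ring_distribs)

lemma ee_minus: "ee (- x) = inverse (ee x)"
  by (simp add: ee_def exp_minus)

lemma ee_diff: "ee (x - y) = ee x / ee y"
  by (simp add: ee_def exp_diff ring_distribs)

lemma ee_eq_iff: "ee x = ee y \<longleftrightarrow> (\<exists>n::int. x = y + of_int n)"
proof -
  have "ee x = ee y \<longleftrightarrow> (\<exists>n::int. 2 * of_real pi * \<i> * x = 2 * of_real pi * \<i> * (y + of_int n))"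
    unfolding ee_def exp_eq by (simp add: algebra_simps)
  also have "\<dots> \<longleftrightarrow> (\<exists>n::int. x = y + of_int n)"
    by simp
  finally show ?thesis .
qed

lemma ee_of_int [simp]: "ee (of_int n) = 1"
  using ee_eq_iff[of "of_int n" 0] by auto

lemma ee_1 [simp]: "ee 1 = 1"
  using ee_of_int[of 1] by simp

lemma ee_plus_of_int [simp]: "ee (x + of_int n) = ee x"
  by (simp add: ee_add)

lemma ee_half: "ee (1/2) = -1"
  by (simp add: ee_def)

lemma norm_ee: "norm (ee z) = exp (- 2 * pi * Im z)"
  by (simp add: ee_def)

lemma ee_power: "ee z ^ n = ee (of_nat n * z)"
  by (simp add: ee_def exp_of_nat_mult[symmetric] mult_ac)

lemma ee_powi: "ee z powi n = ee (of_int n * z)"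
  by (cases n rule: int_cases2) (simp_all add: power_int_minus ee_power ee_minus)

lemma ee_holomorphic [holomorphic_intros]: "f holomorphic_on S \<Longrightarrow> (\<lambda>z. ee (f z)) holomorphic_on S"
  unfolding ee_def by (intro holomorphic_intros)

lemma ee_continuous_on [continuous_intros]: "continuous_on S f \<Longrightarrow> continuous_on S (\<lambda>z. ee (f z))"
  unfolding ee_def by (intro continuous_intros)

lemma ee_surj: "w \<noteq> 0 \<Longrightarrow> ee (Ln w / (2 * of_real pi * \<i>)) = w"
  by (simp add: ee_def)

lemma uhp_shift [simp]: "\<tau> + of_int n \<in> uhp \<longleftrightarrow> \<tau> \<in> uhp"
  by (simp add: uhp_def)

lemma open_uhp: "open uhp"
  unfolding uhp_def by (rule open_halfspace_Im_gt)

lemma range_ee: "range ee = -{0}"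
  by (auto simp: image_iff) (metis ee_surj)

lemma ee_image_uhp: "ee ` uhp = ball 0 1 - {0}"
proof (intro equalityI subsetI)
  fix w assume "w \<in> ball (0::complex) 1 - {0}"
  then have w: "norm w < 1" "w \<noteq> 0" by auto
  define z where "z = Ln w / (2 * of_real pi * \<i>)"
  have z: "ee z = w"
    using w ee_surj by (simp add: z_def)
  with w norm_ee[of z] have "Im z > 0"
    by (simp add: zero_less_mult_iff)
  then show "w \<in> ee ` uhp"
    using z by (auto simp: uhp_def)
qed (auto simp: uhp_def norm_ee)

section \<open>Fourier expansions of periodic holomorphic functions\<close>

text \<open>\<open>ee\<close> has a holomorphic local inverse near every nonzero point, and two
  preimages of a point differ by an integer; so the value of \<open>g\<close> at any chosen preimage
  is a holomorphic function of the image.\<close>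

lemma periodic_holomorphic_descends:
  assumes "open S" "g holomorphic_on S"
    and S: "\<And>z n. z \<in> S \<Longrightarrow> z + of_int n \<in> S"
    and g: "\<And>z n. z \<in> S \<Longrightarrow> g (z + of_int n) = g z"
  obtains F where "F holomorphic_on ee ` S" "\<And>z. z \<in> S \<Longrightarrow> F (ee z) = g z"
proof -
  define F where "F = (\<lambda>w. g (SOME z. z \<in> S \<and> ee z = w))"
  have F: "F (ee z) = g z" if "z \<in> S" for z
  proof -
    define z' where "z' = (SOME z'. z' \<in> S \<and> ee z' = ee z)"
    have z': "z' \<in> S \<and> ee z' = ee z"
      unfolding z'_def by (rule someI[of _ z]) (use that in auto)
    then obtain n where "z' = z + of_int n"
      using ee_eq_iff by blast
    with g that have "g z' = g z" by simp
    then show ?thesis by (simp add: F_def z'_def)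
  qed
  have "F field_differentiable (at w)" if w: "w \<in> ee ` S" for w
  proof -
    obtain z where z: "z \<in> S" "w = ee z" using w by auto
    \<comment> \<open>The local inverse of \<open>ee\<close> with value \<open>z\<close> at
      \<open>w\<close>. The quotient \<open>u / w\<close> is close to 1, so the principal logarithm
      stays away from its cut wherever \<open>w\<close> lies.\<close>
    define L where "L = (\<lambda>u. z + Ln (u / w) / (2 * of_real pi * \<i>))"
    have w: "w \<noteq> 0" using z by simp
    have eeL: "ee (L u) = u" if "u \<noteq> 0" for u
      using that w ee_surj[of "u / w"] z by (simp add: L_def ee_add)
    have Lw: "L w = z" using w by (simp add: L_def)
    have Ld: "L field_differentiable (at w)"
    proof -
      have "w / w \<notin> \<real>\<^sub>\<le>\<^sub>0" using w by simp
      then show ?thesis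
        unfolding L_def field_differentiable_def by (intro exI) (rule derivative_eq_intros refl | simp add: w)+
    qed
    have ev: "\<forall>\<^sub>F u in nhds w. u \<noteq> 0 \<and> L u \<in> S"
    proof (rule eventually_conj)
      show "\<forall>\<^sub>F u in nhds w. u \<noteq> 0" using w by (rule t1_space_nhds)
      have "isCont L w" using Ld by (rule field_differentiable_imp_continuous_at)
      then have "\<forall>\<^sub>F u in at w. L u \<in> S"
        unfolding isCont_def using Lw \<open>open S\<close> z by (auto elim: topological_tendstoD)
      then show "\<forall>\<^sub>F u in nhds w. L u \<in> S"
        using Lw z by (auto simp: eventually_at_filter elim: eventually_mono)
    qed
    have "(g \<circ> L) field_differentiable (at w)"
      using assms(1,2) z Lw
      by (intro field_differentiable_compose Ld)
         (auto simp: holomorphic_on_open field_differentiable_def)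
    then obtain D where "((g \<circ> L) has_field_derivative D) (at w)"
      by (auto simp: field_differentiable_def)
    moreover have "\<forall>\<^sub>F u in nhds w. (g \<circ> L) u = F u"
      using ev by eventually_elim (metis F comp_apply eeL)
    ultimately have "(F has_field_derivative D) (at w)"
      using DERIV_cong_ev by blast
    then show ?thesis by (auto simp: field_differentiable_def)
  qed
  then have "F holomorphic_on ee ` S"
    by (auto simp: holomorphic_on_def intro: field_differentiable_at_within)
  from this F show ?thesis by (rule that)
qed

section \<open>Laurent series on the punctured plane\<close>

lemma contour_integral_circlepath_sums:
  fixes u :: "nat \<Rightarrow> complex \<Rightarrow> complex"
  assumes "R > 0" and cont: "\<And>n. continuous_on (sphere z R) (u n)"
    and bd: "\<And>n w. w \<in> sphere z R \<Longrightarrow> norm (u n w) \<le> M n" and "summable M"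
    and g: "\<And>w. w \<in> sphere z R \<Longrightarrow> (\<lambda>n. u n w) sums g w"
  shows "(\<lambda>n. contour_integral (circlepath z R) (u n)) sums contour_integral (circlepath z R) g"
    and "summable (\<lambda>n. norm (contour_integral (circlepath z R) (u n)))"
proof -
  have int: "u n contour_integrable_on circlepath z R" for n
    using cont \<open>R > 0\<close> by (intro contour_integrable_continuous_circlepath) auto
  have ul: "uniform_limit (sphere z R) (\<lambda>N w. \<Sum>n<N. u n w) g sequentially"
  proof -
    have "uniform_limit (sphere z R) (\<lambda>N w. \<Sum>n<N. u n w) (\<lambda>w. \<Sum>n. u n w) sequentially"
      using bd \<open>summable M\<close> by (rule Weierstrass_m_test)
    then show ?thesis
      by (rule uniform_limit_cong'[THEN iffD1, rotated -1]) (use g in \<open>auto simp: sums_iff\<close>)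
  qed
  have "((\<lambda>N. contour_integral (circlepath z R) (\<lambda>w. \<Sum>n<N. u n w)) \<longlongrightarrow>
          contour_integral (circlepath z R) g) sequentially"
    using ul \<open>R > 0\<close> int
    by (intro contour_integral_uniform_limit_circlepath)
       (auto intro!: always_eventually contour_integrable_sum)
  then show "(\<lambda>n. contour_integral (circlepath z R) (u n)) sums contour_integral (circlepath z R) g"
    unfolding sums_def by (subst (asm) contour_integral_sum) (use int in auto)
  \<comment> \<open>The length estimate supplies the absolute convergence that unordered sums over
    the integers require; uniform convergence alone gives only a convergent series of
    integrals.\<close>
  have "norm (contour_integral (circlepath z R) (u n)) \<le> M n * (2 * pi * R)" for n
  proof -
    have "M n \<ge> 0"
      using norm_ge_zero bd[of "z + of_real R" n] \<open>R > 0\<close>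
      by (metis (no_types, lifting) abs_of_pos add_diff_cancel_left' dist_norm dist_commute mem_sphere norm_of_real order_trans)
    then show ?thesis
      using bd \<open>R > 0\<close> has_contour_integral_integral[OF int]
      by (intro has_contour_integral_bound_circlepath) (auto simp: dist_norm norm_minus_commute)
  qed
  then have "\<exists>N. \<forall>n\<ge>N. norm (norm (contour_integral (circlepath z R) (u n))) \<le> M n * (2 * pi * R)"
    unfolding real_norm_def abs_norm_cancel by blast
  then show "summable (\<lambda>n. norm (contour_integral (circlepath z R) (u n)))"
    using summable_mult2[OF \<open>summable M\<close>] by (rule summable_comparison_test)
qed

text \<open>The difference quotient of \<open>F\<close> at \<open>z\<close> extends holomorphically
  over \<open>z\<close>, so its integrals over the two circles agree. Its part
  \<open>F z / (w - z)\<close> contributes the left-hand side on the outer circle and 0 on the inner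
  one.\<close>

lemma punctured_plane_Cauchy_integral_formula:
  assumes F: "F holomorphic_on -{0}" and "z \<noteq> 0" "0 < R1" "R1 < norm z" "norm z < R2"
  shows "2 * of_real pi * \<i> * F z =
    contour_integral (circlepath 0 R2) (\<lambda>w. F w / (w - z)) -
    contour_integral (circlepath 0 R1) (\<lambda>w. F w / (w - z))"
proof -
  define h where "h = (\<lambda>w. if w = z then deriv F z else (F w - F z) / (w - z))"
  have h: "h holomorphic_on UNIV - {0}"
    unfolding h_def using pole_lemma_open[OF F] by (simp add: Compl_eq_Diff_UNIV open_delete)
  have int: "(\<lambda>w. G w / (w - z)) contour_integrable_on circlepath 0 R"
    if "continuous_on (-{0}) G" "R > 0" "R \<noteq> norm z" for G R
    using that by (intro contour_integrable_continuous_circlepath continuous_intros)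
      (auto intro: continuous_on_subset)
  have split: "contour_integral (circlepath 0 R) h =
      contour_integral (circlepath 0 R) (\<lambda>w. F w / (w - z)) -
      contour_integral (circlepath 0 R) (\<lambda>w. F z / (w - z))"
    if "R > 0" "R \<noteq> norm z" for R
  proof -
    have "contour_integral (circlepath 0 R) h = contour_integral (circlepath 0 R) (\<lambda>w. F w / (w - z) - F z / (w - z))"
      using that by (intro contour_integral_cong) (auto simp: h_def diff_divide_distrib)
    also have "\<dots> = contour_integral (circlepath 0 R) (\<lambda>w. F w / (w - z)) -
      contour_integral (circlepath 0 R) (\<lambda>w. F z / (w - z))"
      using that F by (intro contour_integral_diff int holomorphic_on_imp_continuous_on) auto
    finally show ?thesis .
  qed
  have eq: "contour_integral (circlepath 0 R2) h = contour_integral (circlepath 0 R1) h"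
    using assms by (intro contour_integral_circlepath_eq(3)[OF open_UNIV h]) auto
  have 2: "contour_integral (circlepath 0 R2) (\<lambda>w. F z / (w - z)) = 2 * of_real pi * \<i> * F z"
    using assms by (intro contour_integral_unique Cauchy_integral_circlepath_simple[where f="\<lambda>_. F z"]) auto
  have 1: "contour_integral (circlepath 0 R1) (\<lambda>w. F z / (w - z)) = 0"
    using assms by (intro contour_integral_unique Cauchy_theorem_disc_simple[where a=0 and e="norm z"])
      (auto intro!: holomorphic_intros)
  show ?thesis
    using split[of R1] split[of R2] eq 1 2 assms by (auto simp: algebra_simps)
qed

text \<open>The negative half is enumerated by \<open>- int n - 1\<close>, so that it starts at -1
  and the index 0 is counted once.\<close>

lemma has_sum_int_split:
  fixes f :: "int \<Rightarrow> complex"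
  assumes "(\<lambda>n. f (int n)) sums A" "summable (\<lambda>n. norm (f (int n)))"
    and "(\<lambda>n. f (- int n - 1)) sums B" "summable (\<lambda>n. norm (f (- int n - 1)))"
  shows "(f has_sum (A + B)) UNIV"
proof -
  have "((\<lambda>n. f (int n)) has_sum A) UNIV" "((\<lambda>n. f (- int n - 1)) has_sum B) UNIV"
    using assms by (auto intro: norm_summable_imp_has_sum)
  moreover have "((\<lambda>n. f (int n)) has_sum A) UNIV \<longleftrightarrow> (f has_sum A) {0..}"
    by (rule has_sum_reindex_bij_witness[of _ nat int]) auto
  moreover have "((\<lambda>n. f (- int n - 1)) has_sum B) UNIV \<longleftrightarrow> (f has_sum B) {..<0}"
    by (rule has_sum_reindex_bij_witness[of _ "\<lambda>k. nat (- k - 1)" "\<lambda>n. - int n - 1"]) auto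
  ultimately have "(f has_sum (A + B)) ({0..} \<union> {..<0})"
    by (intro has_sum_Un_disjoint) auto
  moreover have "{0..} \<union> {..<0} = (UNIV :: int set)" by auto
  ultimately show ?thesis by simp
qed

lemma power_int_minus_Suc: "x powi (- int n - 1) = inverse (x ^ Suc n)" for x :: complex
proof -
  have "- int n - 1 = - int (Suc n)" by simp
  then show ?thesis by (simp only: power_int_minus power_int_of_nat)
qed

text \<open>In the integral formula for two circles the kernel \<open>1 / (w - z)\<close> is
  expanded in powers of \<open>z / w\<close> on the outer circle and of \<open>w / z\<close> on the
  inner one. The coefficient integrals do not depend on the radius, so radius 1 defines
  them.\<close>

theorem laurent_series_punctured_plane:
  assumes F: "F holomorphic_on -{0}"
  obtains a :: "int \<Rightarrow> complex" where "\<And>z. z \<noteq> 0 \<Longrightarrow> ((\<lambda>n. a n * z powi n) has_sum F z) UNIV"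
proof -
  define I where "I = (\<lambda>R n. contour_integral (circlepath 0 R) (\<lambda>w. F w * w powi (- n - 1)))"
  have I1: "I R n = I 1 n" if "R > 0" for R and n :: int
  proof -
    have "(\<lambda>w. F w * w powi (- n - 1)) holomorphic_on UNIV - {0}"
      using F by (intro holomorphic_intros) (auto simp: Compl_eq_Diff_UNIV)
    note eq = contour_integral_circlepath_eq(3)[OF open_UNIV this]
    show ?thesis
    proof (cases "R \<le> 1")
      case True
      show ?thesis unfolding I_def by (rule eq[OF that True, symmetric]) simp
    next
      case False
      then show ?thesis unfolding I_def by (intro eq) auto
    qed
  qed
  have cont: "continuous_on (sphere 0 R) F" if "R > 0" for R
    using that by (intro continuous_on_subset[OF holomorphic_on_imp_continuous_on[OF F]]) auto
  have bdd: "\<exists>B. \<forall>w\<in>sphere (0::complex) R. norm (F w) \<le> B" if "R > 0" for R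
    using compact_imp_bounded[OF compact_continuous_image[OF cont[OF that] compact_sphere]]
    by (auto simp: bounded_iff)
  define a where "a = (\<lambda>n. I 1 n / (2 * of_real pi * \<i>))"
  have "((\<lambda>n. a n * z powi n) has_sum F z) UNIV" if "z \<noteq> 0" for z
  proof -
    \<comment> \<open>The circles may vary with \<open>z\<close>; only the coefficients must not,
      and \<open>I1\<close> moves them to radius 1.\<close>
    define R1 R2 where "R1 = norm z / 2" and "R2 = 2 * norm z"
    have R: "0 < R1" "R1 < norm z" "0 < R2" "norm z < R2"
      using that by (auto simp: R1_def R2_def)
    obtain B1 where B1: "\<And>w. w \<in> sphere (0::complex) R1 \<Longrightarrow> norm (F w) \<le> B1" using bdd R by blast
    obtain B2 where B2: "\<And>w. w \<in> sphere (0::complex) R2 \<Longrightarrow> norm (F w) \<le> B2" using bdd R by blast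
    have outer: "(\<lambda>n. contour_integral (circlepath 0 R2) (\<lambda>w. F w * z ^ n / w ^ Suc n)) sums
        contour_integral (circlepath 0 R2) (\<lambda>w. F w / (w - z)) \<and>
        summable (\<lambda>n. norm (contour_integral (circlepath 0 R2) (\<lambda>w. F w * z ^ n / w ^ Suc n)))"
    proof -
      have sm: "summable (\<lambda>n. B2 / R2 * (norm z / R2) ^ n)"
        using R by (intro summable_mult summable_geometric) auto
      have bd: "norm (F w * z ^ n / w ^ Suc n) \<le> B2 / R2 * (norm z / R2) ^ n" if w: "w \<in> sphere (0::complex) R2" for n w
      proof -
        have w0: "norm w = R2" "w \<noteq> 0" "w \<noteq> z" using R w by auto
        have "norm (F w * z ^ n / w ^ Suc n) = norm (F w) * (norm z ^ n / R2 ^ Suc n)"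
          by (simp add: norm_mult norm_divide norm_power w0)
        also have "\<dots> \<le> B2 * (norm z ^ n / R2 ^ Suc n)"
          using B2[OF w] R by (intro mult_right_mono) auto
        also have "\<dots> = B2 / R2 * (norm z / R2) ^ n"
          by (simp add: power_divide)
        finally show ?thesis .
      qed
      have ss: "(\<lambda>n. F w * z ^ n / w ^ Suc n) sums (F w / (w - z))" if w: "w \<in> sphere (0::complex) R2" for w
      proof -
        have w0: "norm w = R2" "w \<noteq> 0" "w \<noteq> z" using R w by auto
        have "(\<lambda>n. (z / w) ^ n) sums (1 / (1 - z / w))"
          using w0 R by (intro geometric_sums) (auto simp: norm_divide)
        from sums_mult[OF this, of "F w / w"]
        show ?thesis
          using w0 by (simp add: power_divide field_simps)
      qed
      have cn: "continuous_on (sphere 0 R2) (\<lambda>w. F w * z ^ n / w ^ Suc n)" for n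
        using R that by (intro continuous_intros cont) auto
      show ?thesis
        using contour_integral_circlepath_sums[OF _ cn bd sm ss] R by blast
    qed
    have inner: "(\<lambda>n. contour_integral (circlepath 0 R1) (\<lambda>w. F w * w ^ n / z ^ Suc n)) sums
        contour_integral (circlepath 0 R1) (\<lambda>w. - (F w / (w - z))) \<and>
        summable (\<lambda>n. norm (contour_integral (circlepath 0 R1) (\<lambda>w. F w * w ^ n / z ^ Suc n)))"
    proof -
      have sm: "summable (\<lambda>n. B1 / norm z * (R1 / norm z) ^ n)"
        using R by (intro summable_mult summable_geometric) (auto simp: divide_less_eq)
      have bd: "norm (F w * w ^ n / z ^ Suc n) \<le> B1 / norm z * (R1 / norm z) ^ n" if w: "w \<in> sphere (0::complex) R1" for n w
      proof -
        have w0: "norm w = R1" "w \<noteq> 0" "w \<noteq> z" using R w by auto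
        have "norm (F w * w ^ n / z ^ Suc n) = norm (F w) * (R1 ^ n / norm z ^ Suc n)"
          by (simp add: norm_mult norm_divide norm_power w0)
        also have "\<dots> \<le> B1 * (R1 ^ n / norm z ^ Suc n)"
          using B1[OF w] R by (intro mult_right_mono) auto
        also have "\<dots> = B1 / norm z * (R1 / norm z) ^ n"
          by (simp add: power_divide)
        finally show ?thesis .
      qed
      have ss: "(\<lambda>n. F w * w ^ n / z ^ Suc n) sums (- (F w / (w - z)))" if w: "w \<in> sphere (0::complex) R1" for w
      proof -
        have w0: "norm w = R1" "w \<noteq> 0" "w \<noteq> z" using R w by auto
        have "(\<lambda>n. (w / z) ^ n) sums (1 / (1 - w / z))"
          using w0 R by (intro geometric_sums) (auto simp: norm_divide divide_less_eq)
        note sums_mult[OF this, of "F w / z"]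
        moreover have "F w / (z - w) = - (F w / (w - z))"
          by (metis minus_diff_eq minus_divide_right)
        ultimately show ?thesis
          using w0 \<open>z \<noteq> 0\<close> by (simp add: power_divide divide_simps)
      qed
      have cn: "continuous_on (sphere 0 R1) (\<lambda>w. F w * w ^ n / z ^ Suc n)" for n
        using R that by (intro continuous_intros cont) auto
      show ?thesis
        using contour_integral_circlepath_sums[OF _ cn bd sm ss] R by blast
    qed
    have int: "(\<lambda>w. F w * w powi (- n - 1)) contour_integrable_on circlepath 0 R" if "R > 0" for R n
      using that cont by (intro contour_integrable_continuous_circlepath continuous_intros) auto
    have c1: "contour_integral (circlepath 0 R2) (\<lambda>w. F w * z ^ n / w ^ Suc n) = I 1 (int n) * z powi int n" for n
    proof -
      have "contour_integral (circlepath 0 R2) (\<lambda>w. F w * z ^ n / w ^ Suc n) =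
          contour_integral (circlepath 0 R2) (\<lambda>w. F w * w powi (- int n - 1) * z ^ n)"
      proof (intro contour_integral_cong refl)
        fix w :: complex
        have "w powi (- int n - 1) = inverse (w ^ Suc n)"
          by (rule power_int_minus_Suc)
        then show "F w * z ^ n / w ^ Suc n = F w * w powi (- int n - 1) * z ^ n"
          by (simp add: divide_inverse mult_ac del: power_Suc)
      qed
      also have "\<dots> = I R2 (int n) * z ^ n"
        unfolding I_def by (intro contour_integral_rmul int R)
      finally show ?thesis using I1[OF R(3)] by simp
    qed
    have c2: "contour_integral (circlepath 0 R1) (\<lambda>w. F w * w ^ n / z ^ Suc n) =
        I 1 (- int n - 1) * z powi (- int n - 1)" for n
    proof -
      have "contour_integral (circlepath 0 R1) (\<lambda>w. F w * w ^ n / z ^ Suc n) =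
          contour_integral (circlepath 0 R1) (\<lambda>w. F w * w powi (- (- int n - 1) - 1) * z powi (- int n - 1))"
      proof (intro contour_integral_cong refl)
        have "z powi (- int n - 1) = inverse (z ^ Suc n)"
          by (rule power_int_minus_Suc)
        then show "F w * w ^ n / z ^ Suc n = F w * w powi (- (- int n - 1) - 1) * z powi (- int n - 1)" for w
          by (simp add: divide_inverse mult_ac del: power_Suc)
      qed
      also have "\<dots> = I R1 (- int n - 1) * z powi (- int n - 1)"
        unfolding I_def by (intro contour_integral_rmul int R)
      finally show ?thesis using I1[OF R(1)] by simp
    qed
    have "((\<lambda>n. I 1 n * z powi n) has_sum
        (contour_integral (circlepath 0 R2) (\<lambda>w. F w / (w - z)) +
         contour_integral (circlepath 0 R1) (\<lambda>w. - (F w / (w - z))))) UNIV"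
      using outer inner unfolding c1 c2 by (intro has_sum_int_split) auto
    also have "contour_integral (circlepath 0 R1) (\<lambda>w. - (F w / (w - z))) =
        - contour_integral (circlepath 0 R1) (\<lambda>w. F w / (w - z))"
      using R by (intro contour_integral_neg contour_integrable_continuous_circlepath continuous_intros)
    also have "contour_integral (circlepath 0 R2) (\<lambda>w. F w / (w - z)) + \<dots> = 2 * of_real pi * \<i> * F z"
      using punctured_plane_Cauchy_integral_formula[OF F that, of R1 R2] R by simp
    finally have "((\<lambda>n. I 1 n * z powi n / (2 * of_real pi * \<i>)) has_sum F z) UNIV"
      using has_sum_cmult_left[where c="inverse (2 * of_real pi * \<i>)"] by (fastforce simp: field_simps)
    then show ?thesis by (simp add: a_def)
  qed
  then show ?thesis by (rule that)
qed

lemma periodic_of_int: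
  assumes "\<And>z::complex. g (z + 1) = g z"
  shows "g (z + of_int n) = g z"
proof -
  have nat: "g (z + of_nat n) = g z" for z n
  proof (induction n)
    case (Suc n)
    then show ?case using assms[of "z + of_nat n"] by (simp add: add_ac)
  qed simp
  show ?thesis
  proof (cases n rule: int_cases2)
    case (nonpos k)
    then show ?thesis using nat[of "z + of_int n" k] by simp
  qed (simp add: nat)
qed

theorem fourier_series_entire:
  assumes "g holomorphic_on UNIV" "\<And>z. g (z + 1) = g z"
  obtains a :: "int \<Rightarrow> complex" where "\<And>z. ((\<lambda>n. a n * ee (of_int n * z)) has_sum g z) UNIV"
proof -
  have per: "g (z + of_int n) = g z" for z n
    using assms(2) by (rule periodic_of_int)
  obtain F where F: "F holomorphic_on ee ` UNIV" "\<And>z. F (ee z) = g z"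
    using periodic_holomorphic_descends[OF open_UNIV assms(1)] per by auto
  from F(1) obtain a :: "int \<Rightarrow> complex" where "\<And>z. z \<noteq> 0 \<Longrightarrow> ((\<lambda>n. a n * z powi n) has_sum F z) UNIV"
    unfolding range_ee by (rule laurent_series_punctured_plane) blast
  from this[OF ee_nonzero] F(2) show ?thesis
    by (intro that[of a]) (simp add: ee_powi)
qed

section \<open>Fourier coefficients from finite averages\<close>

lemma finite_sum_has_sum:
  fixes f :: "'i \<Rightarrow> 'a \<Rightarrow> 'b :: topological_comm_monoid_add"
  assumes "\<And>i. i \<in> I \<Longrightarrow> (f i has_sum S i) A"
  shows "((\<lambda>x. \<Sum>i\<in>I. f i x) has_sum (\<Sum>i\<in>I. S i)) A"
  using assms by (induction I rule: infinite_finite_induct) (auto intro: has_sum_add)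

lemma has_sum_diff:
  fixes f g :: "'a \<Rightarrow> 'b :: topological_ab_group_add"
  assumes "(f has_sum a) A" "(g has_sum b) A"
  shows "((\<lambda>x. f x - g x) has_sum (a - b)) A"
  using has_sum_add[OF assms(1), of "\<lambda>x. - g x" "- b"] assms(2) by (simp add: has_sum_uminus)

lemma sum_roots_of_unity:
  assumes "N > 0"
  shows "(\<Sum>j<N. ee (of_int k * of_real (real j / real N))) = (if int N dvd k then of_nat N else 0)"
proof -
  define w where "w = ee (of_int k / of_nat N)"
  have w: "ee (of_int k * of_real (real j / real N)) = w ^ j" for j
    unfolding w_def ee_power by (simp add: mult_ac)
  have w1: "w = 1 \<longleftrightarrow> int N dvd k"
  proof -
    have "w = 1 \<longleftrightarrow> (\<exists>n::int. of_int k / of_nat N = (of_int n :: complex))"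
      using ee_eq_iff[of _ 0] by (simp add: w_def)
    also have "\<dots> \<longleftrightarrow> (\<exists>n::int. (of_int k :: complex) = of_int (int N * n))"
      using assms by (simp add: divide_simps mult_ac)
    also have "\<dots> \<longleftrightarrow> int N dvd k"
      unfolding of_int_eq_iff dvd_def by simp
    finally show ?thesis .
  qed
  have "w ^ N = 1"
    unfolding w_def ee_power using assms by simp
  then have "(\<Sum>j<N. w ^ j) = (if w = 1 then of_nat N else 0)"
    using geometric_sum[of w N] by (auto)
  then show ?thesis unfolding w w1 .
qed

text \<open>
  Averages over roots of unity play the role of the integrals for the Fourier coefficients: they
  only involve finite sums, so they can be interchanged with absolutely convergent series.
\<close>

definition fourier_average :: "nat \<Rightarrow> int \<Rightarrow> (real \<Rightarrow> complex) \<Rightarrow> complex" where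
  "fourier_average N s f =
     (\<Sum>j<N. f (real j / real N) * ee (- (of_int s * of_real (real j / real N)))) / of_nat N"

text \<open>Orthogonality of the \<open>N\<close>-th roots of unity. The average does not isolate
  \<open>b s\<close> but adds up the coefficients of a residue class modulo \<open>N\<close>; the
  other members of the class have distance at least \<open>N\<close> from \<open>s\<close>, so the
  error is bounded by a tail of the series.\<close>

lemma fourier_average_has_sum:
  assumes "N > 0" and f: "\<And>x::real. ((\<lambda>r. b r * ee (of_int r * of_real x)) has_sum f x) UNIV"
  shows "(b has_sum fourier_average N s f) {r. int N dvd (r - s)}"
proof -
  define x where "x = (\<lambda>j. real j / real N)"
  have "((\<lambda>r. (\<Sum>j<N. b r * ee (of_int r * of_real (x j)) * ee (- (of_int s * of_real (x j)))) / of_nat N)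
      has_sum fourier_average N s f) UNIV"
    unfolding fourier_average_def divide_inverse[of "sum _ _"]
    unfolding x_def by (intro has_sum_cmult_left finite_sum_has_sum f)
  moreover have "(\<Sum>j<N. b r * ee (of_int r * of_real (x j)) * ee (- (of_int s * of_real (x j)))) / of_nat N
      = (if int N dvd (r - s) then b r else 0)" for r
  proof -
    have "(\<Sum>j<N. b r * ee (of_int r * of_real (x j)) * ee (- (of_int s * of_real (x j)))) =
        b r * (\<Sum>j<N. ee (of_int (r - s) * of_real (x j)))"
      unfolding sum_distrib_left
      by (intro sum.cong refl) (simp add: ee_add[symmetric] mult.assoc ring_distribs)
    then show ?thesis
      unfolding x_def sum_roots_of_unity[OF \<open>N > 0\<close>] using \<open>N > 0\<close> by auto
  qed
  ultimately have "((\<lambda>r. if int N dvd (r - s) then b r else 0) has_sum fourier_average N s f) UNIV"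
    by simp
  then show ?thesis
    by (rule has_sum_cong_neutral[THEN iffD1, rotated -1]) auto
qed

lemma fourier_average_close:
  assumes "N > 0" and f: "\<And>x::real. ((\<lambda>r. b r * ee (of_int r * of_real x)) has_sum f x) UNIV"
    and t: "\<And>r. norm (b r) \<le> t r" "t summable_on UNIV"
  shows "norm (fourier_average N s f - b s) \<le> infsum t {r. int N \<le> \<bar>r - s\<bar>}"
proof -
  let ?A = "{r. int N dvd (r - s)}"
  have t0: "t r \<ge> 0" for r using t(1) norm_ge_zero order_trans by blast
  have sub: "?A - {s} \<subseteq> {r. int N \<le> \<bar>r - s\<bar>}"
    using \<open>N > 0\<close> by (auto intro: zdvd_imp_le simp: dvd_imp_le_int)
  have sum: "t summable_on B" for B
    using t(2) by (rule summable_on_subset) auto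
  have "(b has_sum (fourier_average N s f - b s)) (?A - {s})"
    using has_sum_finite[of "{s}" b] by (intro has_sum_Diff fourier_average_has_sum[OF assms(1) f]) auto
  then have "norm (fourier_average N s f - b s) \<le> infsum t (?A - {s})"
    using has_sum_infsum[OF sum] t(1) by (rule norm_infsum_le)
  also have "\<dots> \<le> infsum t {r. int N \<le> \<bar>r - s\<bar>}"
    using sub t0 by (intro infsum_mono2 sum) auto
  finally show ?thesis .
qed

lemma infsum_tail_tendsto_0:
  fixes t :: "int \<Rightarrow> real"
  assumes "t summable_on UNIV" "\<And>r. t r \<ge> 0"
  shows "(\<lambda>N. infsum t {r. int N \<le> \<bar>r - s\<bar>}) \<longlonglongrightarrow> 0"
proof (rule LIMSEQ_I)
  fix e :: real assume "e > 0"
  have sum: "t summable_on B" for B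
    using assms(1) by (rule summable_on_subset) auto
  obtain F where F: "finite F" "dist (sum t F) (infsum t UNIV) \<le> e / 2"
    using infsum_finite_approximation[OF assms(1), of "e/2"] \<open>e > 0\<close> by auto
  from F(2) \<open>e > 0\<close> have Fe: "infsum t UNIV - sum t F < e"
    unfolding dist_real_def by arith
  have "bdd_above ((\<lambda>r. \<bar>r - s\<bar>) ` F)" using F by auto
  then obtain N0 where N0: "\<And>r. r \<in> F \<Longrightarrow> \<bar>r - s\<bar> \<le> N0"
    by (auto simp: bdd_above_def)
  have "norm (infsum t {r. int N \<le> \<bar>r - s\<bar>} - 0) < e" if "N \<ge> nat (N0 + 1)" for N
  proof -
    have "infsum t {r. int N \<le> \<bar>r - s\<bar>} \<le> infsum t (UNIV - F)"
      using that N0 assms by (intro infsum_mono2 sum) force+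
    also have "\<dots> = infsum t UNIV - sum t F"
      using has_sum_Diff[OF has_sum_infsum[OF assms(1)] has_sum_finite[OF F(1)]] by (auto dest: infsumI)
    also note Fe
    finally show ?thesis using assms(2) by (simp add: infsum_nonneg)
  qed
  then show "\<exists>no. \<forall>n\<ge>no. norm (infsum t {r. int n \<le> \<bar>r - s\<bar>} - 0) < e" by blast
qed

text \<open>Every average obeys the bound because \<open>ee\<close> has modulus 1 on the real line,
  and the averages tend to \<open>b s\<close>.\<close>

lemma fourier_coeff_bound:
  assumes f: "\<And>x::real. ((\<lambda>r. b r * ee (of_int r * of_real x)) has_sum f x) UNIV"
    and B: "\<And>x. norm (f x) \<le> B"
  shows "norm (b s) \<le> B"
proof -
  have "(\<lambda>r. b r * ee (of_int r * of_real 0)) summable_on UNIV"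
    using f by (rule has_sum_imp_summable)
  then have t: "(\<lambda>r. norm (b r)) summable_on UNIV"
    using summable_on_iff_abs_summable_on_complex[of b UNIV] by simp
  have le: "norm (b s) \<le> B + infsum (\<lambda>r. norm (b r)) {r. int N \<le> \<bar>r - s\<bar>}" if "N > 0" for N
  proof -
    have "norm (fourier_average N s f) \<le> B"
    proof -
      have "norm (\<Sum>j<N. f (real j / real N) * ee (- (of_int s * of_real (real j / real N)))) \<le> of_nat N * B"
        by (rule order_trans[OF sum_norm_bound[of _ _ B]]) (use B in \<open>auto simp: norm_mult norm_ee\<close>)
      then show ?thesis
        using that by (simp add: fourier_average_def norm_divide field_simps)
    qed
    with fourier_average_close[OF that f order_refl t, of s]
    show ?thesis using norm_triangle_sub[of "b s" "fourier_average N s f"]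
      by (simp add: norm_minus_commute)
  qed
  have "(\<lambda>N. B + infsum (\<lambda>r. norm (b r)) {r. int N \<le> \<bar>r - s\<bar>}) \<longlonglongrightarrow> B + 0"
    using t by (intro tendsto_intros infsum_tail_tendsto_0) auto
  then show ?thesis
    using le by (intro LIMSEQ_le_const[where X="\<lambda>N. B + infsum (\<lambda>r. norm (b r)) {r. int N \<le> \<bar>r - s\<bar>}"])
      (auto intro!: exI[of _ 1])
qed

lemma fourier_series_coeff_unique:
  assumes "\<And>x::real. ((\<lambda>r. b r * ee (of_int r * of_real x)) has_sum f x) UNIV"
    and "\<And>x::real. ((\<lambda>r. b' r * ee (of_int r * of_real x)) has_sum f x) UNIV"
  shows "b = b'"
proof
  fix s
  have "((\<lambda>r. (b r - b' r) * ee (of_int r * of_real x)) has_sum (f x - f x)) UNIV" for x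
    unfolding left_diff_distrib by (intro has_sum_diff assms)
  then have "norm (b s - b' s) \<le> 0"
    by (rule fourier_coeff_bound) auto
  then show "b s = b' s" by simp
qed

text \<open>One-variable uniqueness twice: for fixed \<open>y\<close> the inner sums over
  \<open>r\<close> are the coefficients of a series in \<open>x\<close> that vanishes, so they
  vanish for every \<open>y\<close>, and then so do their own coefficients.\<close>

lemma fourier2_coeff_eq_0:
  assumes "\<And>x y::real. ((\<lambda>(n, r). b n r * ee (of_int n * of_real x) * ee (of_int r * of_real y)) has_sum 0) UNIV"
  shows "b n r = 0"
proof -
  define B where "B = (\<lambda>y n. infsum (\<lambda>r. b n r * ee (of_int r * of_real y)) UNIV)"
  have inner: "((\<lambda>r. b n r * ee (of_int r * of_real y)) has_sum B y n) UNIV" for n and y :: real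
  proof -
    have "(\<lambda>(n, r). b n r * ee (of_int n * of_real 0) * ee (of_int r * of_real y)) summable_on UNIV \<times> UNIV"
      using has_sum_imp_summable[OF assms[of 0 y]] by simp
    then have "(\<lambda>r. b n r * ee (of_int n * of_real 0) * ee (of_int r * of_real y)) summable_on UNIV"
      by (rule summable_on_SigmaD1) auto
    then show ?thesis by (simp add: B_def has_sum_infsum)
  qed
  have "B y n = 0" for y n
  proof -
    have "((\<lambda>n. B y n * ee (of_int n * of_real x)) has_sum 0) UNIV" for x :: real
    proof (rule has_sum_SigmaD[where B="\<lambda>_. UNIV"])
      show "((\<lambda>(n, r). b n r * ee (of_int n * of_real x) * ee (of_int r * of_real y)) has_sum 0) (UNIV \<times> UNIV)"
        using assms by simp
      show "((\<lambda>r. case (n, r) of (n, r) \<Rightarrow> b n r * ee (of_int n * of_real x) * ee (of_int r * of_real y)) has_sum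
          B y n * ee (of_int n * of_real x)) UNIV" for n
        using has_sum_cmult_left[OF inner, of n y "ee (of_int n * of_real x)"] by (simp add: mult_ac)
    qed
    then have "norm (B y n) \<le> 0" by (rule fourier_coeff_bound) auto
    then show ?thesis by simp
  qed
  with inner have "((\<lambda>r. b n r * ee (of_int r * of_real y)) has_sum 0) UNIV" for y :: real by metis
  then have "norm (b n r) \<le> 0" by (rule fourier_coeff_bound) auto
  then show ?thesis by simp
qed

section \<open>Summability over the integers and q-expansions\<close>

lemma summable_exp_abs_int:
  fixes c :: real
  assumes "c > 0"
  shows "(\<lambda>n::int. exp (- c * real_of_int \<bar>n\<bar>)) summable_on UNIV"
proof -
  define g :: "int \<Rightarrow> complex" where "g = (\<lambda>n. of_real (exp (- c * real_of_int \<bar>n\<bar>)))"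
  have g: "norm (g n) = exp (- c * real_of_int \<bar>n\<bar>)" for n
    by (simp add: g_def)
  have e: "exp (- c * real k) = exp (- c) ^ k" for k
    by (simp add: exp_of_nat_mult[symmetric] mult_ac)
  have s1: "summable (\<lambda>k. exp (- c * real k))"
    unfolding e using assms by (intro summable_geometric) auto
  then have s2: "summable (\<lambda>k. exp (- c * real (Suc k)))"
    by (subst summable_Suc_iff)
  have n1: "summable (\<lambda>k. norm (g (int k)))"
    using s1 by (simp add: g)
  have n2: "summable (\<lambda>k. norm (g (- int k - 1)))"
    using s2 by (simp add: g abs_if)
  have "(g has_sum (suminf (\<lambda>k. g (int k)) + suminf (\<lambda>k. g (- int k - 1)))) UNIV"
    using n1 n2 by (intro has_sum_int_split summable_sums) (auto dest: summable_norm_cancel)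
  then have "(\<lambda>n. norm (g n)) summable_on UNIV"
    using has_sum_imp_summable summable_on_iff_abs_summable_on_complex by blast
  then show ?thesis by (simp add: g)
qed

lemma summable_exp_int_bounded_below:
  fixes c :: real
  assumes "c > 0"
  shows "(\<lambda>n::int. exp (- c * real_of_int n)) summable_on {n0..}"
proof (rule summable_on_comparison_test)
  show "(\<lambda>n::int. exp (2 * c * \<bar>real_of_int n0\<bar>) * exp (- c * real_of_int \<bar>n\<bar>)) summable_on {n0..}"
    using summable_on_subset[OF summable_exp_abs_int[OF assms]] by (intro summable_on_cmult_right) auto
  fix n assume "n \<in> {n0..}"
  then have "- real_of_int n \<le> 2 * \<bar>real_of_int n0\<bar> - \<bar>real_of_int n\<bar>" by auto
  then have "c * - real_of_int n \<le> c * (2 * \<bar>real_of_int n0\<bar> - \<bar>real_of_int n\<bar>)"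
    using assms by (intro mult_left_mono) auto
  then show "exp (- c * real_of_int n) \<le> exp (2 * c * \<bar>real_of_int n0\<bar>) * exp (- c * real_of_int \<bar>n\<bar>)"
    by (simp add: exp_add[symmetric] algebra_simps)
qed auto

lemma summable_on_product_nonneg:
  fixes f :: "'a \<Rightarrow> real" and g :: "'b \<Rightarrow> real"
  assumes "f summable_on A" "g summable_on B" "\<And>x. x \<in> A \<Longrightarrow> f x \<ge> 0" "\<And>y. y \<in> B \<Longrightarrow> g y \<ge> 0"
  shows "(\<lambda>(x, y). f x * g y) summable_on A \<times> B"
proof (rule summable_on_SigmaI)
  show "((\<lambda>y. case (x, y) of (x, y) \<Rightarrow> f x * g y) has_sum (f x * infsum g B)) B" for x
    using has_sum_cmult_right[OF has_sum_infsum[OF assms(2)]] by simp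
  show "(\<lambda>x. f x * infsum g B) summable_on A"
    using assms(1) by (rule summable_on_cmult_left)
qed (use assms in auto)

text \<open>After division by \<open>q^n0\<close> the function is bounded near \<open>q = 0\<close>,
  so the singularity there is removable. The Taylor coefficients of the extension, moved by
  \<open>n0\<close>, are the coefficients sought.\<close>

theorem q_expansion_exists:
  assumes "A holomorphic_on uhp" and per: "\<And>\<tau>. \<tau> \<in> uhp \<Longrightarrow> A (\<tau> + 1) = A \<tau>"
    and bd: "\<And>\<tau>. Im \<tau> \<ge> v0 \<Longrightarrow> norm (A \<tau>) \<le> C * exp (- 2 * pi * of_int n0 * Im \<tau>)" and "v0 > 0"
  obtains \<alpha> :: "int \<Rightarrow> complex" where "\<And>n. n < n0 \<Longrightarrow> \<alpha> n = 0"
    "\<And>\<tau>. \<tau> \<in> uhp \<Longrightarrow> ((\<lambda>n. \<alpha> n * ee (of_int n * \<tau>)) has_sum A \<tau>) UNIV"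
proof -
  define A2 where "A2 = (\<lambda>\<tau>. A \<tau> * ee (- (of_int n0 * \<tau>)))"
  have perA: "A (z + of_int n) = A z" if "z \<in> uhp" for z n
    using periodic_of_int[of "\<lambda>t. if t \<in> uhp then A t else 0" z n] per that by (auto simp: uhp_def)
  have per2: "A2 (z + of_int n) = A2 z" if "z \<in> uhp" for z n
  proof -
    have "ee (- (of_int n0 * (z + of_int n))) = ee (- (of_int n0 * z) + of_int (- (n0 * n)))"
      by (simp add: algebra_simps)
    then show ?thesis using perA[OF that] unfolding A2_def ee_plus_of_int by simp
  qed
  have "A2 holomorphic_on uhp"
    unfolding A2_def by (intro holomorphic_intros assms)
  from periodic_holomorphic_descends[OF open_uhp this uhp_shift[THEN iffD2] per2]
  obtain F where F: "F holomorphic_on ball 0 1 - {0}" "\<And>z. z \<in> uhp \<Longrightarrow> F (ee z) = A2 z"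
    unfolding ee_image_uhp by blast
  have "norm (F q) \<le> C" if q: "q \<noteq> 0" "norm q < exp (- 2 * pi * v0)" for q
  proof -
    obtain z where z: "ee z = q" using ee_surj[OF q(1)] by blast
    have "Im z > v0" using q z norm_ee[of z] by auto
    moreover have "z \<in> uhp" using \<open>Im z > v0\<close> \<open>v0 > 0\<close> by (simp add: uhp_def)
    ultimately have "norm (F q) = norm (A z) * exp (2 * pi * of_int n0 * Im z)"
      using F(2)[of z] z by (simp add: A2_def norm_mult norm_ee)
    also have "\<dots> \<le> (C * exp (- 2 * pi * of_int n0 * Im z)) * exp (2 * pi * of_int n0 * Im z)"
      using bd \<open>Im z > v0\<close> by (intro mult_right_mono) auto
    also have "\<dots> = C" by (simp add: mult.assoc exp_add[symmetric])
    finally show ?thesis .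
  qed
  then have "\<forall>\<^sub>F q in at 0. norm (F q) \<le> C"
    unfolding eventually_at by (intro exI[of _ "exp (- 2 * pi * v0)"]) auto
  then obtain G where G: "G holomorphic_on ball 0 1" "\<And>q. q \<in> ball 0 1 - {0} \<Longrightarrow> G q = F q"
    using holomorphic_on_extend_bounded[OF F(1)] by auto
  define a where "a = (\<lambda>n. (deriv ^^ n) G 0 / fact n)"
  have sums: "(\<lambda>n. a n * q ^ n) sums G q" if "norm q < 1" for q
    using holomorphic_power_series[OF G(1), of q] that by (simp add: a_def)
  have abs: "summable (\<lambda>n. norm (a n * q ^ n))" if "norm q < 1" for q
  proof -
    \<comment> \<open>Convergence of the power series at the larger radius gives absolute
      convergence at \<open>q\<close>.\<close>
    obtain \<rho> where "norm q < \<rho>" "\<rho> < 1" using dense[OF \<open>norm q < 1\<close>] by auto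
    moreover from this have "norm (complex_of_real \<rho>) = \<rho>" using norm_ge_zero[of q] unfolding norm_of_real by linarith
    ultimately show ?thesis
      using powser_insidea[OF sums_summable[OF sums[of "of_real \<rho>"]], of q] by simp
  qed
  define \<alpha> where "\<alpha> = (\<lambda>n. if n < n0 then 0 else a (nat (n - n0)))"
  have "((\<lambda>n. \<alpha> n * ee (of_int n * \<tau>)) has_sum A \<tau>) UNIV" if "\<tau> \<in> uhp" for \<tau>
  proof -
    define q where "q = ee \<tau>"
    have q: "norm q < 1" "q \<noteq> 0" using that by (auto simp: q_def norm_ee uhp_def)
    have "G q = A2 \<tau>" using F(2) G(2) that q by (simp add: q_def)
    then have "((\<lambda>n. a n * q ^ n) has_sum A2 \<tau>) UNIV"
      using norm_summable_imp_has_sum[OF abs sums, of q] q by simp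
    then have "((\<lambda>n. a n * q ^ n * ee (of_int n0 * \<tau>)) has_sum (A2 \<tau> * ee (of_int n0 * \<tau>))) UNIV"
      by (rule has_sum_cmult_left)
    also have "A2 \<tau> * ee (of_int n0 * \<tau>) = A \<tau>"
      by (simp add: A2_def ee_minus)
    also have "((\<lambda>n. a n * q ^ n * ee (of_int n0 * \<tau>)) has_sum A \<tau>) UNIV \<longleftrightarrow>
        ((\<lambda>n. \<alpha> n * ee (of_int n * \<tau>)) has_sum A \<tau>) {n0..}"
      by (rule has_sum_reindex_bij_witness[of _ "\<lambda>n. nat (n - n0)" "\<lambda>k. int k + n0"])
         (auto simp: \<alpha>_def q_def ee_power ee_add ring_distribs)
    also have "\<dots> \<longleftrightarrow> ((\<lambda>n. \<alpha> n * ee (of_int n * \<tau>)) has_sum A \<tau>) UNIV"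
      by (rule has_sum_cong_neutral) (auto simp: \<alpha>_def)
    finally show ?thesis .
  qed
  moreover have "\<alpha> n = 0" if "n < n0" for n using that by (simp add: \<alpha>_def)
  ultimately show ?thesis using that by blast
qed

section \<open>Holomorphic functions of two variables and their double Fourier series\<close>

lemma holomorphic2_fst:
  assumes "holomorphic2 f"
  shows "(\<lambda>\<tau>. f \<tau> z) holomorphic_on uhp"
proof -
  have "(\<lambda>\<tau>. f \<tau> z) field_differentiable (at \<tau>)" if \<tau>: "\<tau> \<in> uhp" for \<tau>
  proof -
    obtain A B where "((\<lambda>p. f (fst p) (snd p)) has_derivative (\<lambda>p. A * fst p + B * snd p)) (at (\<tau>, z))"
      using assms \<tau> unfolding holomorphic2_def by blast
    then have "((\<lambda>p. f (fst p) (snd p)) \<circ> (\<lambda>t. (t, z)) has_derivative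
        (\<lambda>p. A * fst p + B * snd p) \<circ> (\<lambda>h. (h, 0))) (at \<tau>)"
      by (intro diff_chain_at derivative_eq_intros) (auto intro!: derivative_eq_intros)
    then have "((\<lambda>t. f t z) has_derivative (\<lambda>h. A * h)) (at \<tau>)" by (simp add: o_def)
    then show ?thesis by (auto simp: field_differentiable_def has_field_derivative_def)
  qed
  then show ?thesis by (auto simp: holomorphic_on_def intro: field_differentiable_at_within)
qed

lemma holomorphic2_snd:
  assumes "holomorphic2 f" "\<tau> \<in> uhp"
  shows "f \<tau> holomorphic_on S"
proof -
  have "f \<tau> field_differentiable (at z)" for z
  proof -
    obtain A B where "((\<lambda>p. f (fst p) (snd p)) has_derivative (\<lambda>p. A * fst p + B * snd p)) (at (\<tau>, z))"
      using assms unfolding holomorphic2_def by blast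
    then have "((\<lambda>p. f (fst p) (snd p)) \<circ> (\<lambda>t. (\<tau>, t)) has_derivative
        (\<lambda>p. A * fst p + B * snd p) \<circ> (\<lambda>h. (0, h))) (at z)"
      by (intro diff_chain_at derivative_eq_intros) (auto intro!: derivative_eq_intros)
    then have "(f \<tau> has_derivative (\<lambda>h. B * h)) (at z)" by (simp add: o_def)
    then show ?thesis by (auto simp: field_differentiable_def has_field_derivative_def)
  qed
  then show ?thesis by (auto simp: holomorphic_on_def intro: field_differentiable_at_within)
qed

lemma holomorphic2_continuous_on:
  assumes "holomorphic2 f"
  shows "continuous_on (uhp \<times> UNIV) (\<lambda>p. f (fst p) (snd p))"
proof (rule continuous_at_imp_continuous_on, safe)
  fix \<tau> z :: complex assume "\<tau> \<in> uhp"
  then obtain A B where "((\<lambda>p. f (fst p) (snd p)) has_derivative (\<lambda>p. A * fst p + B * snd p)) (at (\<tau>, z))"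
    using assms unfolding holomorphic2_def by blast
  then show "isCont (\<lambda>p. f (fst p) (snd p)) (\<tau>, z)" by (rule has_derivative_continuous)
qed

lemma periodic_bounded_on_strip:
  assumes f: "holomorphic2 f" and K: "compact K" "K \<subseteq> uhp"
    and per: "\<And>\<tau> z. \<tau> \<in> uhp \<Longrightarrow> f \<tau> (z + 1) = f \<tau> z"
  obtains M where "\<And>\<tau> z. \<tau> \<in> K \<Longrightarrow> \<bar>Im z\<bar> \<le> Y \<Longrightarrow> norm (f \<tau> z) \<le> M"
proof -
  have "compact ((\<lambda>p. f (fst p) (snd p)) ` (K \<times> cball 0 (1 + \<bar>Y\<bar>)))"
    using K by (intro compact_continuous_image compact_Times compact_cball
        continuous_on_subset[OF holomorphic2_continuous_on[OF f]]) auto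
  then obtain M where M: "\<And>\<tau> z. \<tau> \<in> K \<Longrightarrow> z \<in> cball 0 (1 + \<bar>Y\<bar>) \<Longrightarrow> norm (f \<tau> z) \<le> M"
    by (fastforce dest!: compact_imp_bounded simp: bounded_iff)
  have "norm (f \<tau> z) \<le> M" if "\<tau> \<in> K" "\<bar>Im z\<bar> \<le> Y" for \<tau> z
  proof -
    define z' where "z' = z - of_int \<lfloor>Re z\<rfloor>"
    have "\<bar>Re z'\<bar> \<le> 1" "\<bar>Im z'\<bar> \<le> \<bar>Y\<bar>"
      using that(2) unfolding z'_def by (auto, linarith+)
    then have "norm z' \<le> 1 + \<bar>Y\<bar>" using cmod_le[of z'] by linarith
    moreover have "f \<tau> z = f \<tau> z'"
      using periodic_of_int[of "f \<tau>" z "- \<lfloor>Re z\<rfloor>"] per that(1) K(2) by (auto simp: z'_def)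
    ultimately show ?thesis using M that by auto
  qed
  then show ?thesis by (rule that)
qed

lemma Complex_split: "Complex x y = Complex 0 y + of_real x"
  by (simp add: complex_eq_iff)

text \<open>On the line \<open>Im z = y\<close> the series has the coefficients
  \<open>a r * ee (r * i y)\<close>, so a bound there gives a bound for \<open>a r\<close> with an
  exponential factor. The free choice of the line is what later produces decay in
  \<open>r\<close>.\<close>

lemma fourier_coeff_norm_le:
  assumes a: "\<And>z. ((\<lambda>r. a r * ee (of_int r * z)) has_sum g z) UNIV"
    and B: "\<And>x::real. norm (g (Complex x y)) \<le> B"
  shows "norm (a r) \<le> B * exp (2 * pi * of_int r * y)"
proof -
  have "norm (a r * ee (of_int r * Complex 0 y)) \<le> B"
  proof (rule fourier_coeff_bound)
    show "((\<lambda>r. a r * ee (of_int r * Complex 0 y) * ee (of_int r * of_real x)) has_sum g (Complex x y)) UNIV" for x :: real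
    proof -
      have "a r * ee (of_int r * Complex x y) = a r * ee (of_int r * Complex 0 y) * ee (of_int r * of_real x)" for r
        by (simp only: Complex_split[of x y] ring_distribs ee_add mult.assoc)
      then show ?thesis using a[of "Complex x y"] by (simp only:)
    qed
  qed (rule B)
  then show ?thesis
    by (simp add: norm_mult norm_ee exp_minus field_simps)
qed

text \<open>Estimates on the two lines at distance 1 from height \<open>y\<close> combine to
  exponential decay in the absolute value of \<open>r\<close>: the lower line is used for
  \<open>r \<ge> 0\<close>, the upper one for \<open>r < 0\<close>.\<close>

lemma min_exp_two_sided:
  fixes y c M :: real
  assumes "x \<le> M * exp (c * r * (y + 1))" "x \<le> M * exp (c * r * (y - 1))"
  shows "x \<le> M * exp (c * r * y) * exp (- c * \<bar>r\<bar>)"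
  using assms by (cases "r \<ge> 0") (auto simp: mult.assoc exp_add[symmetric] algebra_simps)

lemma q_fourier_coeff_norm_le:
  assumes \<alpha>: "\<And>\<tau>. \<tau> \<in> uhp \<Longrightarrow> ((\<lambda>n. \<alpha> n * ee (of_int n * \<tau>)) has_sum A \<tau>) UNIV"
    and v: "v > 0" and B: "\<And>u::real. norm (A (Complex u v)) \<le> B"
  shows "norm (\<alpha> n) \<le> B * exp (2 * pi * of_int n * v)"
proof -
  have "norm (\<alpha> n * ee (of_int n * Complex 0 v)) \<le> B"
  proof (rule fourier_coeff_bound)
    show "((\<lambda>n. \<alpha> n * ee (of_int n * Complex 0 v) * ee (of_int n * of_real x)) has_sum A (Complex x v)) UNIV" for x :: real
    proof -
      have "\<alpha> n * ee (of_int n * Complex x v) = \<alpha> n * ee (of_int n * Complex 0 v) * ee (of_int n * of_real x)" for n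
        by (simp only: Complex_split[of x v] ring_distribs ee_add mult.assoc)
      then show ?thesis using \<alpha>[of "Complex x v"] v by (simp only: uhp_def mem_Collect_eq complex.sel)
    qed
  qed (rule B)
  then show ?thesis
    by (simp add: norm_mult norm_ee exp_minus field_simps)
qed

text \<open>The function is expanded in \<open>z\<close> first, and then each coefficient in
  \<open>q\<close>. Growth on a single line \<open>Im z = y0\<close> is enough, because every
  coefficient in \<open>z\<close> can be estimated from that line, and the growth rate, hence
  \<open>n0\<close>, is the same for all \<open>r\<close>.\<close>

theorem fourier2_expansion_exists:
  assumes f: "holomorphic2 f"
    and per1: "\<And>\<tau> z. \<tau> \<in> uhp \<Longrightarrow> f (\<tau> + 1) z = f \<tau> z"
    and per2: "\<And>\<tau> z. \<tau> \<in> uhp \<Longrightarrow> f \<tau> (z + 1) = f \<tau> z"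
    and growth: "\<And>\<tau> z. Im \<tau> \<ge> v0 \<Longrightarrow> Im z = y0 \<Longrightarrow>
      norm (f \<tau> z) \<le> C * exp (- 2 * pi * of_int n0 * Im \<tau>)" and "v0 > 0"
  obtains c :: "int \<Rightarrow> int \<Rightarrow> complex" where "\<And>n r. n < n0 \<Longrightarrow> c n r = 0"
    "\<And>\<tau> z. \<tau> \<in> uhp \<Longrightarrow> ((\<lambda>(n, r). c n r * ee (of_int n * \<tau>) * ee (of_int r * z)) has_sum f \<tau> z) UNIV"
proof -
  have "\<forall>\<tau>\<in>uhp. \<exists>a. \<forall>z. ((\<lambda>r. a r * ee (of_int r * z)) has_sum f \<tau> z) UNIV"
    using fourier_series_entire[OF holomorphic2_snd[OF f]] per2 by metis
  then obtain a' where a': "\<And>\<tau> z. \<tau> \<in> uhp \<Longrightarrow> ((\<lambda>r. a' \<tau> r * ee (of_int r * z)) has_sum f \<tau> z) UNIV"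
    by metis
  define a where "a = (\<lambda>r \<tau>. a' \<tau> r)"
  have a: "((\<lambda>r. a r \<tau> * ee (of_int r * z)) has_sum f \<tau> z) UNIV" if "\<tau> \<in> uhp" for \<tau> z
    using a'[OF that] by (simp add: a_def)
  \<comment> \<open>The averages are finite sums of functions holomorphic in \<tau>. Near each point
    the bounds on the lines \<open>Im z = 1\<close> and \<open>Im z = -1\<close> give a summable
    majorant of the coefficients, so the averages converge locally uniformly.\<close>
  have hol: "a r holomorphic_on uhp" for r
  proof (rule holomorphic_uniform_sequence[OF open_uhp])
    show "(\<lambda>\<tau>. fourier_average n r (\<lambda>x. f \<tau> (of_real x))) holomorphic_on uhp" for n
      unfolding fourier_average_def divide_inverse by (intro holomorphic_intros holomorphic2_fst[OF f])
    fix \<tau>0 assume "\<tau>0 \<in> uhp"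
    then obtain d where d: "d > 0" "cball \<tau>0 d \<subseteq> uhp"
      using open_contains_cball open_uhp by blast
    obtain M where M: "\<And>\<tau> z. \<tau> \<in> cball \<tau>0 d \<Longrightarrow> \<bar>Im z\<bar> \<le> 1 \<Longrightarrow> norm (f \<tau> z) \<le> M"
      using periodic_bounded_on_strip[OF f compact_cball d(2) per2] by metis
    define t where "t = (\<lambda>s::int. M * exp (- (2 * pi) * real_of_int \<bar>s\<bar>))"
    have "0 \<le> norm (f \<tau>0 0)" by simp
    also have "\<dots> \<le> M" using M[of \<tau>0 0] d(1) by simp
    finally have "M \<ge> 0" .
    then have t: "t summable_on UNIV" "\<And>s. t s \<ge> 0"
      unfolding t_def using summable_exp_abs_int[of "2 * pi"] by (auto intro!: summable_on_cmult_right)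
    have bd: "norm (a s \<tau>) \<le> t s" if "\<tau> \<in> cball \<tau>0 d" for \<tau> s
    proof -
      have "norm (a s \<tau>) \<le> M * exp (2 * pi * of_int s * (0 + 1))"
        using that d M by (intro fourier_coeff_norm_le[OF a]) auto
      moreover have "norm (a s \<tau>) \<le> M * exp (2 * pi * of_int s * (0 - 1))"
        using that d M by (intro fourier_coeff_norm_le[OF a]) auto
      ultimately show ?thesis unfolding t_def using min_exp_two_sided[of _ M "2*pi" "of_int s" 0] by simp
    qed
    have close: "norm (fourier_average N r (\<lambda>x. f \<tau> (of_real x)) - a r \<tau>) \<le> infsum t {s. int N \<le> \<bar>s - r\<bar>}"
      if "N > 0" "\<tau> \<in> cball \<tau>0 d" for N \<tau>
      using that d bd t by (intro fourier_average_close a) auto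
    have "uniform_limit (cball \<tau>0 d) (\<lambda>n \<tau>. fourier_average n r (\<lambda>x. f \<tau> (of_real x))) (a r) sequentially"
      unfolding uniform_limit_iff
    proof safe
      fix e :: real assume "e > 0"
      have "\<forall>\<^sub>F N in sequentially. infsum t {s. int N \<le> \<bar>s - r\<bar>} < e"
        using infsum_tail_tendsto_0[OF t] \<open>e > 0\<close> by (auto dest!: order_tendstoD(2))
      then show "\<forall>\<^sub>F n in sequentially. \<forall>\<tau>\<in>cball \<tau>0 d.
          dist (fourier_average n r (\<lambda>x. f \<tau> (of_real x))) (a r \<tau>) < e"
        using eventually_gt_at_top[of "0::nat"]
      proof eventually_elim
        case (elim N)
        then show ?case unfolding dist_norm by (intro ballI le_less_trans[OF close]) auto
      qed
    qed
    then show "\<exists>d>0. cball \<tau>0 d \<subseteq> uhp \<and>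
        uniform_limit (cball \<tau>0 d) (\<lambda>n \<tau>. fourier_average n r (\<lambda>x. f \<tau> (of_real x))) (a r) sequentially"
      using d by blast
  qed
  have per: "a r (\<tau> + 1) = a r \<tau>" if "\<tau> \<in> uhp" for r \<tau>
  proof -
    have "\<tau> + 1 \<in> uhp" using that by (simp add: uhp_def)
    have "(\<lambda>r. a r (\<tau> + 1)) = (\<lambda>r. a r \<tau>)"
      by (rule fourier_series_coeff_unique[where f="\<lambda>x. f \<tau> (of_real x)"])
         (use a[OF that] a[OF \<open>\<tau> + 1 \<in> uhp\<close>] per1[OF that] in auto)
    then show ?thesis by metis
  qed
  have gr: "norm (a r \<tau>) \<le> (C * exp (2 * pi * of_int r * y0)) * exp (- 2 * pi * of_int n0 * Im \<tau>)"
    if "Im \<tau> \<ge> v0" for r \<tau>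
  proof -
    have "\<tau> \<in> uhp" using that \<open>v0 > 0\<close> by (simp add: uhp_def)
    from fourier_coeff_norm_le[OF a[OF this] growth[OF that]]
    show ?thesis by (simp add: mult_ac)
  qed
  have "\<forall>r. \<exists>\<alpha>. (\<forall>n<n0. \<alpha> n = 0) \<and>
      (\<forall>\<tau>\<in>uhp. ((\<lambda>n. \<alpha> n * ee (of_int n * \<tau>)) has_sum a r \<tau>) UNIV)"
    using q_expansion_exists[OF hol per gr \<open>v0 > 0\<close>] by metis
  then obtain \<alpha> where \<alpha>0: "\<And>r n. n < n0 \<Longrightarrow> \<alpha> r n = 0"
    and \<alpha>: "\<And>r \<tau>. \<tau> \<in> uhp \<Longrightarrow> ((\<lambda>n. \<alpha> r n * ee (of_int n * \<tau>)) has_sum a r \<tau>) UNIV"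
    by metis
  define c where "c = (\<lambda>n r. \<alpha> r n)"
  have "((\<lambda>(n, r). c n r * ee (of_int n * \<tau>) * ee (of_int r * z)) has_sum f \<tau> z) UNIV" if \<tau>: "\<tau> \<in> uhp" for \<tau> z
  proof -
    \<comment> \<open>The coefficients are estimated at half the height of \<tau>. At \<tau> itself
      a factor \<open>exp (- 2 pi v n)\<close> is then left over, which makes the sum over
      \<open>n \<ge> n0\<close> converge.\<close>
    define v where "v = Im \<tau> / 2"
    have v: "v > 0" "Im \<tau> = 2 * v" using \<tau> by (auto simp: v_def uhp_def)
    have "(\<lambda>u. Complex u v) = (\<lambda>u. of_real u + \<i> * of_real v)"
      by (auto simp: complex_eq_iff)
    then have "continuous_on {0..1} (\<lambda>u. Complex u v)"
      by (simp add: continuous_intros)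
    then have cpt: "compact ((\<lambda>u. Complex u v) ` {0..1})"
      by (intro compact_continuous_image) auto
    have "(\<lambda>u. Complex u v) ` {0..1} \<subseteq> uhp" using v by (auto simp: uhp_def)
    then obtain M where M0: "\<And>\<tau> w. \<tau> \<in> (\<lambda>u. Complex u v) ` {0..1} \<Longrightarrow> \<bar>Im w\<bar> \<le> \<bar>Im z\<bar> + 1 \<Longrightarrow> norm (f \<tau> w) \<le> M"
      using periodic_bounded_on_strip[OF f cpt _ per2, of "\<bar>Im z\<bar> + 1"] by metis
    have pern: "f (\<tau> + of_int n) w = f \<tau> w" if "\<tau> \<in> uhp" for \<tau> n w
      using periodic_of_int[of "\<lambda>t. if t \<in> uhp then f t w else 0" \<tau> n] per1 that by (auto simp: uhp_def)
    have M: "norm (f (Complex u v) w) \<le> M" if "\<bar>Im w\<bar> \<le> \<bar>Im z\<bar> + 1" for u w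
    proof -
      have "Complex u v = Complex (frac u) v + of_int \<lfloor>u\<rfloor>"
        by (simp add: frac_def complex_eq_iff)
      moreover have "Complex (frac u) v \<in> uhp" using v by (simp add: uhp_def)
      ultimately have "f (Complex u v) w = f (Complex (frac u) v) w" using pern by simp
      moreover have "Complex (frac u) v \<in> (\<lambda>u. Complex u v) ` {0..1}"
        using frac_ge_0[of u] frac_lt_1[of u] by (intro imageI) auto
      ultimately show ?thesis using M0 that by simp
    qed
    have a_le: "norm (a r (Complex u v)) \<le> M * exp (2 * pi * of_int r * Im z) * exp (- (2 * pi) * \<bar>of_int r\<bar>)" for r u
    proof (rule min_exp_two_sided)
      have "Complex u v \<in> uhp" using v by (simp add: uhp_def)
      note * = fourier_coeff_norm_le[OF a[OF this]]
      show "norm (a r (Complex u v)) \<le> M * exp (2 * pi * of_int r * (Im z + 1))"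
        by (intro * M) auto
      show "norm (a r (Complex u v)) \<le> M * exp (2 * pi * of_int r * (Im z - 1))"
        by (intro * M) auto
    qed
    have c0: "c n r = 0" if "n < n0" for n r
      using \<alpha>0 that by (simp add: c_def)
    define F where "F = (\<lambda>r n. c n r * ee (of_int n * \<tau>) * ee (of_int r * z))"
    have F_le: "norm (F r n) \<le> M * (exp (- (2 * pi) * \<bar>of_int r\<bar>) * exp (- (2 * pi * v) * of_int n))" for r n
    proof -
      have "norm (c n r) \<le> M * exp (2 * pi * of_int r * Im z) * exp (- (2 * pi) * \<bar>of_int r\<bar>) * exp (2 * pi * of_int n * v)"
        unfolding c_def by (rule q_fourier_coeff_norm_le[OF \<alpha> v(1) a_le])
      moreover have "norm (F r n) = norm (c n r) * exp (- 2 * pi * of_int n * (2 * v)) * exp (- 2 * pi * of_int r * Im z)"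
        by (simp add: F_def norm_mult norm_ee v)
      ultimately have "norm (F r n) \<le> M * exp (2 * pi * of_int r * Im z) * exp (- (2 * pi) * \<bar>of_int r\<bar>) * exp (2 * pi * of_int n * v)
          * exp (- 2 * pi * of_int n * (2 * v)) * exp (- 2 * pi * of_int r * Im z)"
        by (simp add: mult_right_mono)
      also have "\<dots> = M * (exp (- (2 * pi) * \<bar>of_int r\<bar>) * exp (- (2 * pi * v) * of_int n))"
        by (simp add: mult.assoc exp_add[symmetric])
      finally show ?thesis .
    qed
    have "(\<lambda>(r, n). exp (- (2 * pi) * real_of_int \<bar>r\<bar>) * exp (- (2 * pi * v) * real_of_int n)) summable_on UNIV \<times> {n0..}"
      using v by (intro summable_on_product_nonneg summable_exp_abs_int summable_exp_int_bounded_below) auto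
    then have "(\<lambda>p. M * (case p of (r, n) \<Rightarrow> exp (- (2 * pi) * real_of_int \<bar>r\<bar>) * exp (- (2 * pi * v) * real_of_int n)))
        summable_on UNIV \<times> {n0..}"
      by (rule summable_on_cmult_right)
    then have "(\<lambda>p. norm (case p of (r, n) \<Rightarrow> F r n)) summable_on UNIV \<times> {n0..}"
      by (rule summable_on_comparison_test) (use F_le in auto)
    then have "(\<lambda>(r, n). F r n) summable_on UNIV \<times> {n0..}"
      by (rule abs_summable_summable)
    then have "(\<lambda>(r, n). F r n) summable_on UNIV \<times> UNIV"
      by (rule summable_on_cong_neutral[THEN iffD1, rotated -1]) (use c0 leI in \<open>fastforce simp: F_def\<close>)+
    then have "((\<lambda>(r, n). F r n) has_sum f \<tau> z) (UNIV \<times> UNIV)"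
    proof (rule has_sum_SigmaI[rotated 2])
      show "((\<lambda>n. case (r, n) of (r, n) \<Rightarrow> F r n) has_sum a r \<tau> * ee (of_int r * z)) UNIV" for r
        using has_sum_cmult_left[OF \<alpha>[OF \<tau>], of r "ee (of_int r * z)"] by (simp add: F_def c_def)
    qed (rule a[OF \<tau>])
    then show ?thesis
      by (subst (asm) has_sum_swap) (simp add: F_def case_prod_unfold)
  qed
  moreover have "c n r = 0" if "n < n0" for n r using \<alpha>0 that by (simp add: c_def)
  ultimately show ?thesis using that by blast
qed

lemma of_rat_complex: "of_rat h = (of_real (of_rat h) :: complex)"
proof (cases h)
  case (Fract a b)
  then show ?thesis by (simp add: of_rat_rat)
qed

section \<open>Powers of the eta function\<close>

text \<open>A holomorphic logarithm of the Euler product on the unit disc. All rational powers of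
  \<eta> are expressed through it, which makes their dependence on the exponent
  multiplicative.\<close>

definition euler_log :: "complex \<Rightarrow> complex" where
  "euler_log q = (\<Sum>n. Ln (1 - q ^ Suc n))"

lemma norm_power_Suc_less_1: "norm q < 1 \<Longrightarrow> norm (q ^ Suc n) < 1" for q :: complex
  by (cases "q = 0") (auto simp: norm_power norm_mult simp del: power_Suc intro: power_Suc_less_one)

lemma norm_Ln_one_minus_le:
  assumes "norm w \<le> \<rho>" "\<rho> < 1"
  shows "norm (Ln (1 - w)) \<le> norm w / (1 - \<rho>)"
proof -
  have "0 \<le> \<rho>" using assms norm_ge_zero[of w] by linarith
  have "norm (Ln (1 - w) - Ln (1 - 0)) \<le> 1 / (1 - \<rho>) * norm (w - 0)"
  proof (rule field_differentiable_bound[where S="cball 0 \<rho>" and f'="\<lambda>z. - 1 / (1 - z)"])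
    fix z :: complex assume "z \<in> cball 0 \<rho>"
    then have z: "norm z \<le> \<rho>" "norm z < 1" using assms by auto
    then have "Re z < 1" using complex_Re_le_cmod[of z] by linarith
    then have "1 - z \<notin> \<real>\<^sub>\<le>\<^sub>0" by (auto simp: complex_nonpos_Reals_iff)
    then show "((\<lambda>z. Ln (1 - z)) has_field_derivative - 1 / (1 - z)) (at z within cball 0 \<rho>)"
      by (auto intro!: derivative_eq_intros simp: divide_inverse)
    have "1 - \<rho> \<le> norm (1 - z)" using norm_triangle_ineq2[of 1 z] z by simp
    then show "norm (- 1 / (1 - z)) \<le> 1 / (1 - \<rho>)"
      using assms by (simp add: norm_divide frac_le)
  qed (use assms \<open>0 \<le> \<rho>\<close> in auto)
  then show ?thesis by simp
qed

lemma euler_log_bounds: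
  assumes "norm q \<le> \<rho>" "\<rho> < 1"
  shows "norm (Ln (1 - q ^ Suc n)) \<le> \<rho> ^ Suc n / (1 - \<rho>)"
proof -
  have "norm (q ^ Suc n) \<le> \<rho> ^ Suc n"
    using assms unfolding norm_power by (intro power_mono) auto
  moreover have "\<rho> ^ Suc n \<le> \<rho>"
    using power_decreasing[of 1 "Suc n" \<rho>] order_trans[OF norm_ge_zero assms(1)] assms(2) by simp
  ultimately have "norm (Ln (1 - q ^ Suc n)) \<le> norm (q ^ Suc n) / (1 - \<rho>)"
    using assms by (intro norm_Ln_one_minus_le) auto
  also have "\<dots> \<le> \<rho> ^ Suc n / (1 - \<rho>)"
    using \<open>norm (q ^ Suc n) \<le> \<rho> ^ Suc n\<close> assms by (intro divide_right_mono) auto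
  finally show ?thesis .
qed

lemma euler_log_summable_bound: "0 \<le> \<rho> \<Longrightarrow> \<rho> < 1 \<Longrightarrow> summable (\<lambda>n. \<rho> ^ Suc n / (1 - \<rho>))" for \<rho> :: real
  by (intro summable_divide summable_Suc_iff[THEN iffD2] summable_geometric) auto

lemma euler_log_sums:
  assumes "norm q < 1"
  shows "(\<lambda>n. Ln (1 - q ^ Suc n)) sums euler_log q"
  unfolding euler_log_def
proof (rule summable_sums, rule summable_norm_cancel, rule summable_comparison_test)
  show "\<exists>N. \<forall>n\<ge>N. norm (norm (Ln (1 - q ^ Suc n))) \<le> norm q ^ Suc n / (1 - norm q)"
    using euler_log_bounds[OF order_refl assms] unfolding real_norm_def abs_norm_cancel by blast
qed (rule euler_log_summable_bound; use assms in auto)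

lemma euler_log_holomorphic: "euler_log holomorphic_on ball 0 1"
proof (rule holomorphic_uniform_sequence[OF open_ball])
  show "(\<lambda>q. \<Sum>i<n. Ln (1 - q ^ Suc i)) holomorphic_on ball 0 1" for n
  proof (intro holomorphic_intros)
    fix q :: complex and i assume "q \<in> ball 0 1"
    then have "norm (q ^ Suc i) < 1" by (intro norm_power_Suc_less_1) auto
    then have "Re (q ^ Suc i) < 1" using complex_Re_le_cmod[of "q ^ Suc i"] by linarith
    then show "1 - q ^ Suc i \<notin> \<real>\<^sub>\<le>\<^sub>0" by (auto simp: complex_nonpos_Reals_iff)
  qed
  fix q0 :: complex assume "q0 \<in> ball 0 1"
  then obtain \<rho> where \<rho>: "norm q0 < \<rho>" "\<rho> < 1" using dense[of "norm q0" 1] by auto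
  define d where "d = \<rho> - norm q0"
  have in_ball: "norm q \<le> \<rho>" if "q \<in> cball q0 d" for q
    using that norm_triangle_sub[of q q0] by (auto simp: d_def dist_norm norm_minus_commute)
  have "\<rho> \<ge> 0" using \<rho> norm_ge_zero[of q0] by linarith
  have "uniform_limit (cball q0 d) (\<lambda>n q. \<Sum>i<n. Ln (1 - q ^ Suc i)) (\<lambda>q. \<Sum>i. Ln (1 - q ^ Suc i)) sequentially"
    using euler_log_bounds in_ball \<rho> \<open>\<rho> \<ge> 0\<close>
    by (intro Weierstrass_m_test[where M="\<lambda>n. \<rho> ^ Suc n / (1 - \<rho>)"] euler_log_summable_bound) blast+
  moreover have "cball q0 d \<subseteq> ball 0 1" using in_ball \<rho> by force
  ultimately show "\<exists>d>0. cball q0 d \<subseteq> ball 0 1 \<and>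
      uniform_limit (cball q0 d) (\<lambda>n q. \<Sum>i<n. Ln (1 - q ^ Suc i)) euler_log sequentially"
    using \<rho> unfolding euler_log_def by (intro exI[of _ d]) (auto simp: d_def)
qed

lemma norm_ee_less_1: "\<tau> \<in> uhp \<Longrightarrow> norm (ee \<tau>) < 1"
  by (simp add: norm_ee uhp_def)

lemma one_minus_ee_power_nonzero: "\<tau> \<in> uhp \<Longrightarrow> 1 - ee \<tau> ^ Suc n \<noteq> 0"
proof
  assume "\<tau> \<in> uhp" "1 - ee \<tau> ^ Suc n = 0"
  then have "norm (ee \<tau> ^ Suc n) = 1" by (metis eq_iff_diff_eq_0 norm_one)
  then show False
    using norm_power_Suc_less_1[OF norm_ee_less_1[OF \<open>\<tau> \<in> uhp\<close>], of n] by simp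
qed

lemma eta_pow_eq:
  assumes "\<tau> \<in> uhp"
  shows "eta_pow h \<tau> = ee (of_rat h * \<tau> / 24) * exp (of_rat h * euler_log (ee \<tau>))"
proof -
  have "(\<Prod>n. (1 - ee \<tau> ^ Suc n) powr of_rat h) = (\<Prod>n. exp (of_rat h * Ln (1 - ee \<tau> ^ Suc n)))"
    unfolding powr_def using one_minus_ee_power_nonzero[OF assms] by presburger
  also have "\<dots> = exp (\<Sum>n. of_rat h * Ln (1 - ee \<tau> ^ Suc n))"
    using euler_log_sums[OF norm_ee_less_1[OF assms]]
    by (intro prodinf_exp summable_mult) (rule sums_summable)
  also have "(\<Sum>n. of_rat h * Ln (1 - ee \<tau> ^ Suc n)) = of_rat h * euler_log (ee \<tau>)"
    using sums_mult[OF euler_log_sums[OF norm_ee_less_1[OF assms]], of "of_rat h"] by (rule sums_unique[symmetric])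
  finally show ?thesis by (simp add: eta_pow_def)
qed

lemma eta_pow_nonzero: "\<tau> \<in> uhp \<Longrightarrow> eta_pow h \<tau> \<noteq> 0"
  by (simp add: eta_pow_eq)

lemma eta_pow_0: "\<tau> \<in> uhp \<Longrightarrow> eta_pow 0 \<tau> = 1"
  by (simp add: eta_pow_eq)

lemma eta_pow_add: "\<tau> \<in> uhp \<Longrightarrow> eta_pow (a + b) \<tau> = eta_pow a \<tau> * eta_pow b \<tau>"
  by (simp add: eta_pow_eq of_rat_add ring_distribs add_divide_distrib ee_add exp_add)

lemma eta_pow_minus: "\<tau> \<in> uhp \<Longrightarrow> eta_pow (- a) \<tau> * eta_pow a \<tau> = 1"
  using eta_pow_add[of \<tau> "- a" a] by (simp add: eta_pow_0)

lemma eta_pow_holomorphic: "eta_pow h holomorphic_on uhp"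
proof -
  have "(\<lambda>\<tau>. ee (of_rat h * \<tau> / 24) * exp (of_rat h * (euler_log \<circ> ee) \<tau>)) holomorphic_on uhp"
    using norm_ee_less_1
    by (intro holomorphic_intros holomorphic_on_compose_gen[OF _ euler_log_holomorphic]) auto
  then show ?thesis
    by (rule holomorphic_cong[THEN iffD1, rotated -1]) (auto simp: eta_pow_eq)
qed

lemma eta_pow_shift:
  assumes "\<tau> \<in> uhp"
  shows "eta_pow h (\<tau> + 1) = ee (of_rat h / 24) * eta_pow h \<tau>"
proof -
  have "\<tau> + 1 \<in> uhp" using assms by (simp add: uhp_def)
  then show ?thesis
    using assms by (simp add: eta_pow_eq ee_add ring_distribs add_divide_distrib)
qed

text \<open>For \<open>Im \<tau> \<ge> 1\<close> the point \<open>ee \<tau>\<close> stays in a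
  compact disc inside the unit disc, where \<open>euler_log\<close> is bounded. The exponent is
  crude: the true rate is \<open>- pi h / 12\<close>, and \<open>pi / 12 < 1\<close>.\<close>

lemma eta_pow_bound:
  obtains C where "C \<ge> 0"
    "\<And>\<tau>. Im \<tau> \<ge> 1 \<Longrightarrow> norm (eta_pow h \<tau>) \<le> C * exp (\<bar>of_rat h\<bar> * Im \<tau>)"
proof -
  have "compact (euler_log ` cball 0 (exp (- 2 * pi)))"
    by (intro compact_continuous_image continuous_on_subset[OF holomorphic_on_imp_continuous_on[OF euler_log_holomorphic]])
       (auto elim!: le_less_trans)
  then obtain B where B: "\<And>q. norm q \<le> exp (- 2 * pi) \<Longrightarrow> norm (euler_log q) \<le> B"
    by (fastforce dest!: compact_imp_bounded simp: bounded_iff)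
  have "norm (eta_pow h \<tau>) \<le> exp (\<bar>of_rat h\<bar> * B) * exp (\<bar>of_rat h\<bar> * Im \<tau>)" if "Im \<tau> \<ge> 1" for \<tau>
  proof -
    have "norm (euler_log (ee \<tau>)) \<le> B" using that by (intro B) (simp add: norm_ee)
    have "\<tau> \<in> uhp" using that by (simp add: uhp_def)
    then have "norm (eta_pow h \<tau>) = exp (- 2 * pi * Im (of_rat h * \<tau> / 24)) * exp (Re (of_rat h * euler_log (ee \<tau>)))"
      by (simp add: eta_pow_eq norm_mult norm_ee)
    also have "\<dots> \<le> exp (\<bar>of_rat h\<bar> * Im \<tau>) * exp (\<bar>of_rat h\<bar> * B)"
    proof -
      have h: "of_rat h = (of_real (of_rat h) :: complex)" by (rule of_rat_complex)
      have "Re (of_rat h * euler_log (ee \<tau>)) \<le> norm (of_rat h * euler_log (ee \<tau>))"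
        by (rule complex_Re_le_cmod)
      also have "\<dots> = \<bar>of_rat h\<bar> * norm (euler_log (ee \<tau>))"
        by (simp add: norm_mult h)
      also have "\<dots> \<le> \<bar>of_rat h\<bar> * B" by (intro mult_left_mono) (use \<open>norm (euler_log (ee \<tau>)) \<le> B\<close> in auto)
      finally have 1: "Re (of_rat h * euler_log (ee \<tau>)) \<le> \<bar>of_rat h\<bar> * B" .
      have "Im (of_rat h * \<tau> / 24) = of_rat h * Im \<tau> / 24"
        by (simp add: h)
      then have "- 2 * pi * Im (of_rat h * \<tau> / 24) = (pi / 12) * (- of_rat h * Im \<tau>)" by simp
      also have "\<dots> \<le> 1 * (\<bar>of_rat h\<bar> * Im \<tau>)"
      proof (rule order_trans)
        show "(pi / 12) * (- of_rat h * Im \<tau>) \<le> (pi / 12) * (\<bar>of_rat h\<bar> * Im \<tau>)"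
          using that abs_ge_minus_self[of "of_rat h :: real"] by (intro mult_left_mono mult_right_mono) auto
        show "(pi / 12) * (\<bar>of_rat h\<bar> * Im \<tau>) \<le> 1 * (\<bar>of_rat h\<bar> * Im \<tau>)"
          using that pi_less_4 by (intro mult_right_mono) auto
      qed
      finally have 2: "- 2 * pi * Im (of_rat h * \<tau> / 24) \<le> \<bar>of_rat h\<bar> * Im \<tau>" by simp
      show ?thesis
        by (rule mult_mono) (use 1 2 in \<open>simp_all only: exp_le_cancel_iff exp_ge_zero\<close>)
    qed
    finally show ?thesis by (simp add: mult.commute)
  qed
  then show ?thesis by (intro that[of "exp (\<bar>of_rat h\<bar> * B)"]) auto
qed

section \<open>The cube of the eta function\<close>

definition euler_part :: "complex \<Rightarrow> nat \<Rightarrow> complex" where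
  "euler_part q n = (\<Prod>i<n. 1 - q ^ Suc i)"

lemma euler_part_tendsto:
  assumes "\<tau> \<in> uhp"
  shows "(\<lambda>n. euler_part (ee \<tau>) n) \<longlonglongrightarrow> exp (euler_log (ee \<tau>))"
proof -
  have "(\<lambda>n. exp (\<Sum>i<n. Ln (1 - ee \<tau> ^ Suc i))) \<longlonglongrightarrow> exp (euler_log (ee \<tau>))"
    using euler_log_sums[OF norm_ee_less_1[OF assms]] unfolding sums_def by (rule tendsto_exp)
  moreover have "exp (\<Sum>i<n. Ln (1 - ee \<tau> ^ Suc i)) = euler_part (ee \<tau>) n" for n
    unfolding euler_part_def exp_sum[OF finite_lessThan]
    using one_minus_ee_power_nonzero[OF assms] by (intro prod.cong refl exp_Ln)
  ultimately show ?thesis by simp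
qed

definition euler_part_inv :: "complex \<Rightarrow> int \<Rightarrow> complex" where
  "euler_part_inv q i = (if i < 0 then 0 else inverse (euler_part q (nat i)))"

text \<open>At \<open>i = -1\<close> the factor \<open>1 - q * q powi i\<close> vanishes, and so the
  value 0 on negative arguments fits the recursion without an exception at the boundary.\<close>

lemma euler_part_inv_rec:
  assumes "\<And>n. 1 - q ^ Suc n \<noteq> 0" "q \<noteq> 0"
  shows "euler_part_inv q i = (1 - q * q powi i) * euler_part_inv q (i + 1)"
proof (cases "i \<ge> 0")
  case True
  then obtain n where "i = int n" by (metis nonneg_int_cases)
  then show ?thesis
    using assms(1)[of n] by (simp add: euler_part_inv_def nat_add_distrib euler_part_def)
next
  case False
  then show ?thesis
  proof (cases "i = -1")
    case True
    then show ?thesis using \<open>q \<noteq> 0\<close> by (simp add: euler_part_inv_def power_int_minus)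
  qed (auto simp: euler_part_inv_def)
qed

text \<open>
  The coefficient of \<open>w^s\<close> in \<open>(1 - 1/w) (1 - w q) (1 - q/w) \<dots> (1 - w q^n) (1 - q^n/w)\<close>, a signed
  Gaussian binomial coefficient. With \<open>euler_part_inv q i = 0\<close> for \<open>i < 0\<close> its recursion in \<open>n\<close>
  needs no case distinctions at the ends of the range of \<open>s\<close>.
\<close>

definition triple_coeff :: "complex \<Rightarrow> nat \<Rightarrow> int \<Rightarrow> complex" where
  "triple_coeff q n s = (if even s then 1 else -1) * q powi (s * (s + 1) div 2) *
     (euler_part q (2 * n + 1) * euler_part_inv q (int n - s) * euler_part_inv q (int n + 1 + s))"

lemma triple_coeff_outside: "s < - int n - 1 \<or> s > int n \<Longrightarrow> triple_coeff q n s = 0"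
  by (auto simp: triple_coeff_def euler_part_inv_def)

lemma triangular_succ: "(s + 1) * (s + 2) div 2 = s * (s + 1) div 2 + (s + 1 :: int)"
proof -
  have "(s + 1) * (s + 2) = s * (s + 1) + (s + 1) * 2" by (simp add: algebra_simps)
  then show ?thesis by simp
qed

text \<open>Compares coefficients after one more pair of factors, whose product is
  \<open>1 + q^(2n+2) - q^(n+1) (w + 1/w)\<close>. Once the common factors are taken out, a
  polynomial identity in \<open>q\<close>, \<open>X\<close> and \<open>Y\<close> remains.\<close>

lemma triple_coeff_Suc:
  assumes q: "\<And>n. 1 - q ^ Suc n \<noteq> 0" and "q \<noteq> 0"
  shows "triple_coeff q (Suc n) s = (1 + q ^ (2 * n + 2)) * triple_coeff q n s
     - q ^ Suc n * (triple_coeff q n (s - 1) + triple_coeff q n (s + 1))"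
proof -
  define X Y G H E where "X = q powi (int n - s)" and "Y = q powi (int n + 1 + s)"
    and "G = euler_part_inv q (int n - s + 1)" and "H = euler_part_inv q (int n + 1 + s + 1)"
    and "E = euler_part q (2 * n + 1)"
  have rec: "euler_part_inv q i = (1 - q * q powi i) * euler_part_inv q (i + 1)" for i
    using q \<open>q \<noteq> 0\<close> by (rule euler_part_inv_rec)
  have g0: "euler_part_inv q (int n - s) = (1 - q * X) * G"
    unfolding X_def G_def by (rule rec)
  have h0: "euler_part_inv q (int n + 1 + s) = (1 - q * Y) * H"
    unfolding Y_def H_def by (rule rec)
  have gm: "euler_part_inv q (int n - s - 1) = (1 - X) * ((1 - q * X) * G)"
    using rec[of "int n - s - 1"] g0 \<open>q \<noteq> 0\<close> by (simp add: X_def power_int_diff)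
  have hm: "euler_part_inv q (int n + s) = (1 - Y) * ((1 - q * Y) * H)"
  proof -
    have "q * q powi (int n + s) = Y"
      using \<open>q \<noteq> 0\<close> by (simp add: Y_def power_int_add)
    then show ?thesis using rec[of "int n + s"] h0 by (simp add: add_ac)
  qed
  \<comment> \<open>The exponents \<open>n - s\<close> and \<open>n + 1 + s\<close> add up to
    \<open>2 n + 1\<close>, so the powers of \<open>q\<close> that do not involve \<open>s\<close>
    can be written in \<open>X\<close> and \<open>Y\<close> as well.\<close>
  have XY: "q ^ (2 * n + 1) = X * Y"
    using \<open>q \<noteq> 0\<close> unfolding X_def Y_def
    by (subst power_int_add[symmetric]) (auto simp: power_int_def nat_add_distrib nat_mult_distrib)
  have E: "euler_part q (2 * Suc n + 1) = E * (1 - q * (X * Y)) * (1 - q * (q * (X * Y)))"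
    unfolding E_def euler_part_def XY[symmetric] by simp
  define Q where "Q = (if even s then 1 else -1) * q powi (s * (s + 1) div 2)"
  have t0: "triple_coeff q n s = Q * (E * ((1 - q * X) * G) * ((1 - q * Y) * H))"
    unfolding triple_coeff_def g0 h0 Q_def E_def by simp
  have tS: "triple_coeff q (Suc n) s = Q * (E * (1 - q * (X * Y)) * (1 - q * (q * (X * Y))) * G * H)"
  proof -
    have "int (Suc n) - s = int n - s + 1" "int (Suc n) + 1 + s = int n + 1 + s + 1" by auto
    then show ?thesis
      unfolding triple_coeff_def E unfolding Q_def G_def H_def by (simp only: mult.assoc)
  qed
  have tp: "q ^ Suc n * triple_coeff q n (s + 1) = - (q * Y * Q * (E * ((1 - X) * ((1 - q * X) * G)) * H))"
  proof -
    have "q powi ((s + 1) * (s + 1 + 1) div 2) = q powi (s * (s + 1) div 2) * q powi (s + 1)"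
      using triangular_succ[of s] \<open>q \<noteq> 0\<close> by (simp add: power_int_add add.assoc)
    moreover have "q ^ Suc n * q powi (s + 1) = q * Y"
      using \<open>q \<noteq> 0\<close> by (simp add: Y_def power_int_add)
    ultimately have "q ^ Suc n * ((if even (s + 1) then 1 else -1) * q powi ((s + 1) * (s + 1 + 1) div 2)) = - (q * Y * Q)"
      using \<open>q \<noteq> 0\<close> by (simp add: Q_def mult_ac)
    moreover have "int n - (s + 1) = int n - s - 1" "int n + 1 + (s + 1) = int n + 1 + s + 1" by auto
    ultimately show ?thesis
      unfolding triple_coeff_def E_def H_def gm[symmetric] by (simp only: mult.assoc[symmetric]) simp
  qed
  have tm: "q ^ Suc n * triple_coeff q n (s - 1) = - (q * X * Q * (E * G * ((1 - Y) * ((1 - q * Y) * H))))"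
  proof -
    have "q powi (s * (s + 1) div 2) = q powi ((s - 1) * s div 2) * q powi s"
      using triangular_succ[of "s - 1"] \<open>q \<noteq> 0\<close> by (simp add: power_int_add add.commute[of 1])
    then have "q powi ((s - 1) * (s - 1 + 1) div 2) = q powi (s * (s + 1) div 2) * q powi (- s)"
      using \<open>q \<noteq> 0\<close> by (simp add: power_int_minus)
    moreover have "q ^ Suc n * q powi (- s) = q * X"
      using \<open>q \<noteq> 0\<close> by (simp add: X_def power_int_diff power_int_minus field_simps)
    ultimately have "q ^ Suc n * ((if even (s - 1) then 1 else -1) * q powi ((s - 1) * (s - 1 + 1) div 2)) = - (q * X * Q)"
      using \<open>q \<noteq> 0\<close> by (simp add: Q_def mult_ac)
    moreover have "int n - (s - 1) = int n - s + 1" "int n + 1 + (s - 1) = int n + s" by auto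
    ultimately show ?thesis
      unfolding triple_coeff_def E_def G_def hm[symmetric] by (simp only: mult.assoc[symmetric]) simp
  qed
  have q2: "q ^ (2 * n + 2) = q * (X * Y)"
    unfolding XY[symmetric] by simp
  show ?thesis
    unfolding ring_distribs(1)[of "q ^ Suc n"] tp tm t0 tS q2 by (simp add: algebra_simps)
qed

text \<open>A finite identity in the form of a sum over all integers, so that multiplication by
  \<open>w\<close> and by \<open>1 / w\<close> is a shift of the index with no boundary
  terms.\<close>

lemma finite_triple_product:
  assumes q: "\<And>n. 1 - q ^ Suc n \<noteq> 0" and "q \<noteq> 0" "w \<noteq> 0"
  shows "((\<lambda>s. triple_coeff q n s * w powi s) has_sum
     ((1 - inverse w) * (\<Prod>k<n. (1 - w * q ^ Suc k) * (1 - q ^ Suc k * inverse w)))) UNIV"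
proof (induction n)
  case 0
  have "((\<lambda>s. triple_coeff q 0 s * w powi s) has_sum (\<Sum>s\<in>{-1, 0}. triple_coeff q 0 s * w powi s)) {-1, 0}"
    by (rule has_sum_finite) auto
  also have "(\<Sum>s\<in>{-1, 0}. triple_coeff q 0 s * w powi s) = 1 - inverse w"
    using q[of 0] \<open>w \<noteq> 0\<close> by (simp add: triple_coeff_def euler_part_inv_def euler_part_def power_int_minus)
  also have "((\<lambda>s. triple_coeff q 0 s * w powi s) has_sum (1 - inverse w)) {-1, 0} \<longleftrightarrow>
      ((\<lambda>s. triple_coeff q 0 s * w powi s) has_sum (1 - inverse w)) UNIV"
    by (rule has_sum_cong_neutral) (auto intro!: triple_coeff_outside)
  finally show ?case by simp
next
  case (Suc n)
  define P where "P = (1 - inverse w) * (\<Prod>k<n. (1 - w * q ^ Suc k) * (1 - q ^ Suc k * inverse w))"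
  note IH = Suc.IH[folded P_def]
  have m: "((\<lambda>s. triple_coeff q n (s - 1) * w powi s) has_sum (w * P)) UNIV"
  proof -
    have "((\<lambda>s. w * (triple_coeff q n s * w powi s)) has_sum (w * P)) UNIV"
      by (rule has_sum_cmult_right[OF IH])
    then show ?thesis
      by (rule has_sum_reindex_bij_witness[of _ "\<lambda>s. s - 1" "\<lambda>s. s + 1", THEN iffD1, rotated -1])
         (use \<open>w \<noteq> 0\<close> in \<open>auto simp: power_int_add\<close>)
  qed
  have p: "((\<lambda>s. triple_coeff q n (s + 1) * w powi s) has_sum (inverse w * P)) UNIV"
  proof -
    have "((\<lambda>s. inverse w * (triple_coeff q n s * w powi s)) has_sum (inverse w * P)) UNIV"
      by (rule has_sum_cmult_right[OF IH])
    then show ?thesis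
      by (rule has_sum_reindex_bij_witness[of _ "\<lambda>s. s + 1" "\<lambda>s. s - 1", THEN iffD1, rotated -1])
         (use \<open>w \<noteq> 0\<close> in \<open>auto simp: power_int_diff field_simps\<close>)
  qed
  have "((\<lambda>s. (1 + q ^ (2 * n + 2)) * (triple_coeff q n s * w powi s) -
        q ^ Suc n * (triple_coeff q n (s - 1) * w powi s + triple_coeff q n (s + 1) * w powi s)) has_sum
      ((1 + q ^ (2 * n + 2)) * P - q ^ Suc n * (w * P + inverse w * P))) UNIV"
    by (intro has_sum_diff has_sum_cmult_right has_sum_add IH m p)
  moreover have "(1 + q ^ (2 * n + 2)) * P - q ^ Suc n * (w * P + inverse w * P) =
      (1 - inverse w) * (\<Prod>k<Suc n. (1 - w * q ^ Suc k) * (1 - q ^ Suc k * inverse w))"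
  proof -
    have "q ^ (2 * n + 2) = q ^ Suc n * q ^ Suc n"
      by (simp add: power_add[symmetric] mult_2)
    moreover have "(1 - w * q ^ Suc n) * (1 - q ^ Suc n * inverse w) =
        1 + q ^ Suc n * q ^ Suc n - q ^ Suc n * (w + inverse w)"
      using \<open>w \<noteq> 0\<close> by (simp add: algebra_simps del: power_Suc)
    moreover define R where "R = (\<Prod>k<n. (1 - w * q ^ Suc k) * (1 - q ^ Suc k * inverse w))"
    ultimately show ?thesis
      unfolding prod.lessThan_Suc P_def R_def[symmetric] by (simp only:) (simp add: algebra_simps del: power_Suc)
  qed
  moreover have "(1 + q ^ (2 * n + 2)) * (triple_coeff q n s * w powi s) -
        q ^ Suc n * (triple_coeff q n (s - 1) * w powi s + triple_coeff q n (s + 1) * w powi s) =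
      triple_coeff q (Suc n) s * w powi s" for s
    unfolding triple_coeff_Suc[OF q \<open>q \<noteq> 0\<close>] by (simp only: ring_distribs mult_ac)
  ultimately show ?case by simp
qed

definition altsign :: "int \<Rightarrow> complex" where
  "altsign s = (if even s then 1 else -1)"

lemma altsign_add: "altsign (s + t) = altsign s * altsign t"
  by (auto simp: altsign_def)

lemma altsign_simps [simp]: "altsign 0 = 1" "altsign 1 = -1" "altsign (- s) = altsign s"
    "altsign s * altsign s = 1" "altsign s \<noteq> 0" "norm (altsign s) = 1"
  by (auto simp: altsign_def)

lemma altsign_even: "even s \<Longrightarrow> altsign s = 1"
  by (simp add: altsign_def)

lemma ee_half_int: "ee (of_int n / 2) = altsign n"
proof (cases "even n")
  case True
  then obtain k where "n = 2 * k" by blast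
  then show ?thesis by (simp add: altsign_def)
next
  case False
  then obtain k where "n = 2 * k + 1" by (blast elim: oddE)
  then have "of_int n / 2 = 1 / 2 + (of_int k :: complex)" by simp
  then show ?thesis using False by (simp only: ee_plus_of_int ee_half) (simp add: altsign_def)
qed

text \<open>The indices \<open>k\<close> and \<open>- k - 1\<close> give opposite odd numbers
  \<open>2 s + 1\<close>; this pairing is the symmetry of both the triple product and the theta
  series.\<close>

lemma has_sum_int_imp_sums:
  fixes f :: "int \<Rightarrow> complex"
  assumes "(f has_sum S) UNIV"
  shows "(\<lambda>k. f (int k) + f (- int k - 1)) sums S"
proof -
  have sm: "f summable_on A" for A
    using has_sum_imp_summable[OF assms] by (rule summable_on_subset) auto
  have "((\<lambda>n. f (int n)) has_sum infsum f {0..}) UNIV \<longleftrightarrow> (f has_sum infsum f {0..}) {0..}"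
    by (rule has_sum_reindex_bij_witness[of _ nat int]) auto
  then have 1: "(\<lambda>n. f (int n)) sums infsum f {0..}"
    using has_sum_infsum[OF sm] by (intro has_sum_imp_sums) blast
  have "((\<lambda>n. f (- int n - 1)) has_sum infsum f {..<0}) UNIV \<longleftrightarrow> (f has_sum infsum f {..<0}) {..<0}"
    by (rule has_sum_reindex_bij_witness[of _ "\<lambda>k. nat (- k - 1)" "\<lambda>n. - int n - 1"]) auto
  then have 2: "(\<lambda>n. f (- int n - 1)) sums infsum f {..<0}"
    using has_sum_infsum[OF sm] by (intro has_sum_imp_sums) blast
  have "(f has_sum (infsum f {0..} + infsum f {..<0})) ({0..} \<union> {..<0})"
    by (intro has_sum_Un_disjoint has_sum_infsum sm) auto
  moreover have "{0..} \<union> {..<0} = (UNIV :: int set)" by auto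
  ultimately have "S = infsum f {0..} + infsum f {..<0}"
    using assms has_sum_unique by metis
  then show ?thesis using sums_add[OF 1 2] by simp
qed

text \<open>Derivative of the finite triple product at \<open>w = 1\<close>. As
  \<open>1 - 1/w\<close> has a simple zero there, the derivative of the product is the value of its
  remaining factors at 1, which is a square.\<close>

lemma euler_part_square:
  assumes q: "\<And>n. 1 - q ^ Suc n \<noteq> 0" and "q \<noteq> 0"
  shows "((\<lambda>s. of_int s * triple_coeff q n s) has_sum (euler_part q n)\<^sup>2) UNIV"
proof -
  define S where "S = {- int n - 1..int n}"
  define R where "R = (\<lambda>w. \<Prod>k<n. (1 - w * q ^ Suc k) * (1 - q ^ Suc k * inverse w))"
  have eq: "(\<Sum>s\<in>S. triple_coeff q n s * w powi s) = (1 - inverse w) * R w" if "w \<noteq> 0" for w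
  proof -
    have "((\<lambda>s. triple_coeff q n s * w powi s) has_sum (\<Sum>s\<in>S. triple_coeff q n s * w powi s)) S"
      by (rule has_sum_finite) (auto simp: S_def)
    also have "?this \<longleftrightarrow> ((\<lambda>s. triple_coeff q n s * w powi s) has_sum (\<Sum>s\<in>S. triple_coeff q n s * w powi s)) UNIV"
      by (rule has_sum_cong_neutral) (auto simp: S_def not_le intro!: triple_coeff_outside)
    finally show ?thesis
      using finite_triple_product[OF q \<open>q \<noteq> 0\<close> that] unfolding R_def by (rule has_sum_unique)
  qed
  have "R field_differentiable (at 1)"
  proof -
    have "R holomorphic_on -{0}"
      unfolding R_def by (intro holomorphic_intros) auto
    then show ?thesis by (rule holomorphic_on_imp_differentiable_at) auto
  qed
  then obtain D where D: "(R has_field_derivative D) (at 1)"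
    by (auto simp: field_differentiable_def)
  have d1: "((\<lambda>w. (1 - inverse w) * R w) has_field_derivative R 1) (at 1)"
    by (rule derivative_eq_intros D refl | simp)+
  have d2: "((\<lambda>w. \<Sum>s\<in>S. triple_coeff q n s * w powi s) has_field_derivative (\<Sum>s\<in>S. triple_coeff q n s * of_int s)) (at 1)"
    by (rule derivative_eq_intros refl | simp add: mult.commute)+
  have "\<forall>\<^sub>F w in nhds (1::complex). w \<noteq> 0" by (rule t1_space_nhds) simp
  then have "\<forall>\<^sub>F w in nhds 1. (\<Sum>s\<in>S. triple_coeff q n s * w powi s) = (1 - inverse w) * R w"
    by eventually_elim (rule eq)
  then have "((\<lambda>w. \<Sum>s\<in>S. triple_coeff q n s * w powi s) has_field_derivative R 1) (at 1)"
    using d1 by (subst DERIV_cong_ev[OF refl _ refl])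
  with d2 have "(\<Sum>s\<in>S. triple_coeff q n s * of_int s) = R 1" by (rule DERIV_unique)
  also have "R 1 = (euler_part q n)\<^sup>2"
    by (simp add: R_def euler_part_def power2_eq_square prod.distrib)
  finally have "(\<Sum>s\<in>S. of_int s * triple_coeff q n s) = (euler_part q n)\<^sup>2"
    by (simp add: mult.commute)
  moreover have "((\<lambda>s. of_int s * triple_coeff q n s) has_sum (\<Sum>s\<in>S. of_int s * triple_coeff q n s)) S"
    by (rule has_sum_finite) (auto simp: S_def)
  moreover have "?this \<longleftrightarrow> ((\<lambda>s. of_int s * triple_coeff q n s) has_sum (\<Sum>s\<in>S. of_int s * triple_coeff q n s)) UNIV"
    by (rule has_sum_cong_neutral) (auto simp: S_def not_le triple_coeff_outside)
  ultimately show ?thesis by simp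
qed

lemma triple_coeff_nonneg:
  "triple_coeff q n (int k) = altsign (int k) * q ^ (k * (k + 1) div 2) *
     (euler_part q (2 * n + 1) * euler_part_inv q (int n - int k) * euler_part_inv q (int n + 1 + int k))"
proof -
  have "int k * (int k + 1) div 2 = int (k * (k + 1) div 2)" by (simp add: zdiv_int algebra_simps)
  then show ?thesis unfolding triple_coeff_def altsign_def by (simp only: power_int_of_nat)
qed

text \<open>Because of this sign, the terms of \<open>s * triple_coeff q n s\<close> at
  \<open>k\<close> and \<open>- k - 1\<close> add up with the factor
  \<open>k + (k + 1) = 2 k + 1\<close>, the odd number in Jacobi's identity.\<close>

lemma triple_coeff_neg: "triple_coeff q n (- int k - 1) = - triple_coeff q n (int k)"
proof -
  have "(- int k - 1) * (- int k - 1 + 1) = int k * (int k + 1)" by (simp add: algebra_simps)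
  moreover have "int n - (- int k - 1) = int n + 1 + int k" "int n + 1 + (- int k - 1) = int n - int k" by auto
  moreover have "even (- int k - 1) \<longleftrightarrow> odd (int k)" by auto
  ultimately show ?thesis unfolding triple_coeff_def by (simp only: mult.commute mult.left_commute) auto
qed

text \<open>Jacobi's identity. As \<open>n\<close> grows, the ratio of partial Euler products in the
  \<open>k\<close>-th coefficient tends to \<open>1 / E\<close>, where \<open>E\<close> is the full
  product, while the left-hand side of the finite identity tends to \<open>E^2\<close>.
  Multiplication by \<open>E\<close> gives the cube.\<close>

theorem euler_product_cube:
  assumes "\<tau> \<in> uhp"
  shows "(\<lambda>k. of_nat (2 * k + 1) * altsign (int k) * ee \<tau> ^ (k * (k + 1) div 2)) sums
    exp (euler_log (ee \<tau>)) ^ 3"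
proof -
  define q E where "q = ee \<tau>" and "E = exp (euler_log q)"
  have q: "1 - q ^ Suc n \<noteq> 0" for n
    using one_minus_ee_power_nonzero[OF assms] by (simp add: q_def)
  have "q \<noteq> 0" "norm q < 1" using norm_ee_less_1[OF assms] by (auto simp: q_def)
  have E: "euler_part q \<longlonglongrightarrow> E" "E \<noteq> 0"
    using euler_part_tendsto[OF assms] by (auto simp: q_def E_def)
  have Ei: "(\<lambda>n. inverse (euler_part q n)) \<longlonglongrightarrow> inverse E"
    using E by (intro tendsto_inverse)
  obtain B1 where B1: "\<And>n. norm (euler_part q n) \<le> B1"
    using convergent_imp_Bseq[OF convergentI[OF E(1)]] unfolding Bseq_def by blast
  obtain B2 where B2: "B2 > 0" "\<And>n. norm (inverse (euler_part q n)) \<le> B2"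
    using convergent_imp_Bseq[OF convergentI[OF Ei]] unfolding Bseq_def by blast
  have B2': "norm (euler_part_inv q i) \<le> B2" for i
    using B2 by (auto simp: euler_part_inv_def)
  define b where "b = (\<lambda>n k. euler_part q (2 * n + 1) * euler_part_inv q (int n - int k) * euler_part_inv q (int n + 1 + int k))"
  define u where "u = (\<lambda>k. of_nat (2 * k + 1) * altsign (int k) * q ^ (k * (k + 1) div 2))"
  have "B1 \<ge> 0" using B1[of 0] norm_ge_zero order_trans by blast
  have b: "(\<lambda>n. b n k) \<longlonglongrightarrow> inverse E" for k
  proof -
    have inv: "(\<lambda>n. euler_part_inv q (int n - int k)) \<longlonglongrightarrow> inverse E"
    proof (rule LIMSEQ_offset[where k=k])
      show "(\<lambda>n. euler_part_inv q (int (n + k) - int k)) \<longlonglongrightarrow> inverse E"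
        using Ei by (simp add: euler_part_inv_def)
    qed
    have inv': "(\<lambda>n. euler_part_inv q (int n + 1 + int k)) \<longlonglongrightarrow> inverse E"
    proof -
      have "euler_part_inv q (int n + 1 + int k) = inverse (euler_part q (n + (k + 1)))" for n
        by (simp add: euler_part_inv_def nat_add_distrib add_ac)
      then show ?thesis using LIMSEQ_ignore_initial_segment[OF Ei, of "k + 1"] by simp
    qed
    have "(\<lambda>n. euler_part q (2 * n + 1)) \<longlonglongrightarrow> E"
      using LIMSEQ_subseq_LIMSEQ[OF E(1), of "\<lambda>n. 2 * n + 1"] by (simp add: o_def strict_mono_def)
    then have "(\<lambda>n. b n k) \<longlonglongrightarrow> E * inverse E * inverse E"
      unfolding b_def by (intro tendsto_mult inv inv')
    then show ?thesis using E by simp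
  qed
  have bb: "norm (b n k) \<le> B1 * B2 * B2" for n k
    unfolding b_def norm_mult using B1 B2' B2 \<open>B1 \<ge> 0\<close> by (intro mult_mono) auto
  have sums: "(\<lambda>k. u k * b n k) sums (euler_part q n)\<^sup>2" for n
  proof -
    have "of_int (int k) * triple_coeff q n (int k) + of_int (- int k - 1) * triple_coeff q n (- int k - 1) = u k * b n k" for k
      unfolding triple_coeff_neg unfolding triple_coeff_nonneg u_def b_def by (simp add: algebra_simps)
    then show ?thesis
      using has_sum_int_imp_sums[OF euler_part_square[OF q \<open>q \<noteq> 0\<close>, of n]] by simp
  qed
  \<comment> \<open>A majorant independent of \<open>n\<close>: the partial products and their
    inverses are bounded, and since \<open>k \<le> k (k + 1) div 2\<close>, a differentiated
    geometric series dominates.\<close>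
  define M where "M = (\<lambda>k. real (2 * k + 1) * norm q ^ k * (B1 * B2 * B2))"
  have uM: "norm (u k) \<le> real (2 * k + 1) * norm q ^ k" for k
  proof -
    have "k * 2 \<le> k * (k + 1)" by (cases "k = 0") (auto intro!: mult_le_mono2)
    then have "k \<le> k * (k + 1) div 2" by linarith
    then have "norm q ^ (k * (k + 1) div 2) \<le> norm q ^ k"
      using \<open>norm q < 1\<close> by (intro power_decreasing) auto
    moreover have "norm (u k) = real (2 * k + 1) * norm q ^ (k * (k + 1) div 2)"
      unfolding u_def norm_mult norm_power norm_of_nat by simp
    ultimately show ?thesis by (simp only: mult_left_mono of_nat_0_le_iff)
  qed
  have sM0: "summable (\<lambda>k. real (2 * k + 1) * norm q ^ k)"
  proof -
    have "summable (\<lambda>n. 2 * (of_nat (Suc n) * norm q ^ n) - norm q ^ n)"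
      using geometric_deriv_sums[of "norm q"] \<open>norm q < 1\<close>
      by (intro summable_diff summable_mult summable_geometric) (auto dest: sums_summable)
    then show ?thesis by (simp add: algebra_simps)
  qed
  have sM: "summable M" unfolding M_def by (rule summable_mult2[OF sM0])
  have "norm (u k * b n k) \<le> M k" for n k
    unfolding norm_mult M_def using uM bb by (intro mult_mono) auto
  then have "(\<lambda>n. suminf (\<lambda>k. u k * b n k)) \<longlonglongrightarrow> suminf (\<lambda>k. u k * inverse E)"
    using tannerys_theorem[of "\<lambda>k n. u k * b n k" "\<lambda>k. u k * inverse E" sequentially M, OF tendsto_mult_left[OF b] _ sM]
    by (auto intro!: always_eventually)
  moreover have "suminf (\<lambda>k. u k * b n k) = (euler_part q n)\<^sup>2" for n
    using sums by (rule sums_unique[symmetric])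
  ultimately have "E\<^sup>2 = suminf (\<lambda>k. u k * inverse E)"
    using tendsto_power[OF E(1), of 2] LIMSEQ_unique by fastforce
  moreover have su: "summable u"
    using uM by (intro summable_comparison_test[OF _ sM0]) blast
  ultimately have "E\<^sup>2 = suminf u * inverse E" by (simp add: suminf_mult2)
  then have "suminf u = E ^ 3" using E(2) by (simp add: field_simps power2_eq_square power3_eq_cube)
  then have "u sums (E ^ 3)" using su by (simp add: sums_iff)
  then show ?thesis by (simp add: u_def E_def q_def)
qed

text \<open>Here \<open>(2k+1)^2 / 8 = 1/8 + k(k+1)/2\<close>, and \<open>1/8 = 3/24\<close> is the
  exponent of \<open>q\<close> in front of the Euler product of the cube of \<eta>.\<close>

corollary eta_cube_series:
  assumes "\<tau> \<in> uhp"
  shows "(\<lambda>k. of_nat (2 * k + 1) * altsign (int k) * ee (of_nat ((2 * k + 1)\<^sup>2) / 8 * \<tau>)) sums eta_pow 3 \<tau>"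
proof -
  have "of_nat (2 * k + 1) * altsign (int k) * ee (of_nat ((2 * k + 1)\<^sup>2) / 8 * \<tau>) =
      ee (\<tau> / 8) * (of_nat (2 * k + 1) * altsign (int k) * ee \<tau> ^ (k * (k + 1) div 2))" for k
  proof -
    obtain j where j: "k * (k + 1) = 2 * j" by (metis dvdE even_mult_iff odd_add odd_one)
    have "(2 * k + 1)\<^sup>2 = 8 * j + 1" using j by (simp add: power2_eq_square algebra_simps)
    then have "of_nat ((2 * k + 1)\<^sup>2) / 8 * \<tau> = \<tau> / 8 + of_nat j * \<tau>" by (simp add: field_simps)
    then have "ee (of_nat ((2 * k + 1)\<^sup>2) / 8 * \<tau>) = ee (\<tau> / 8) * ee \<tau> ^ j"
      by (simp only: ee_add ee_power)
    then show ?thesis using j by simp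
  qed
  moreover have "eta_pow 3 \<tau> = ee (\<tau> / 8) * exp (euler_log (ee \<tau>)) ^ 3"
  proof -
    have "of_rat 3 = (3 :: complex)" using of_rat_numeral_eq[of "num.Bit1 num.One"] by simp
    then show ?thesis using assms by (simp add: eta_pow_eq exp_of_nat_mult[of 3, symmetric])
  qed
  ultimately show ?thesis
    using sums_mult[OF euler_product_cube[OF assms], of "ee (\<tau> / 8)"] by (simp only:)
qed

section \<open>The Jacobi theta function\<close>

text \<open>The term with \<open>r = 2 s + 1\<close>: the Kronecker symbol is 0 at even
  \<open>r\<close> and \<open>(-1)^s\<close> at \<open>2 s + 1\<close>.\<close>

definition theta_term :: "complex \<Rightarrow> complex \<Rightarrow> int \<Rightarrow> complex" where
  "theta_term \<tau> z s =
     altsign s * ee (of_int ((2 * s + 1)\<^sup>2) / 8 * \<tau>) * ee (of_int (2 * s + 1) / 2 * z)"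

text \<open>In \<open>b + 2\<close>, one unit comes from \<open>t^2 \<le> 2 exp t\<close> and one
  from the decay \<open>exp (- t)\<close> that is split off. The constant is the maximum of the
  remaining quadratic exponent, found by completing the square.\<close>

lemma power2_exp_quadratic_le:
  fixes a b t :: real
  assumes "a > 0" "t \<ge> 0"
  shows "t\<^sup>2 * exp (- a * t\<^sup>2 + b * t) \<le> 2 * exp ((b + 2)\<^sup>2 / (4 * a)) * exp (- t)"
proof -
  have "t\<^sup>2 \<le> 2 * exp t"
    using exp_lower_Taylor_quadratic[OF assms(2)] assms(2) by simp
  then have "t\<^sup>2 * exp (- a * t\<^sup>2 + b * t) \<le> 2 * exp t * exp (- a * t\<^sup>2 + b * t)"
    by (intro mult_right_mono) auto
  also have "\<dots> = 2 * (exp (- a * t\<^sup>2 + (b + 2) * t) * exp (- t))"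
    by (simp add: exp_add[symmetric] algebra_simps)
  also have "- a * t\<^sup>2 + (b + 2) * t \<le> (b + 2)\<^sup>2 / (4 * a)"
  proof -
    have "0 \<le> (2 * a * t - (b + 2))\<^sup>2" by simp
    also have "\<dots> = (b + 2)\<^sup>2 - 4 * a * (- a * t\<^sup>2 + (b + 2) * t)"
      by (simp add: power2_eq_square algebra_simps)
    finally have "4 * a * (- a * t\<^sup>2 + (b + 2) * t) \<le> (b + 2)\<^sup>2" by simp
    then show ?thesis using assms(1) by (simp add: pos_le_divide_eq mult_ac)
  qed
  finally show ?thesis by simp
qed

text \<open>With the weight \<open>(2 s + 1)^2\<close> one estimate serves the theta series and also
  its termwise partial derivatives, which bring in factors \<open>(2 s + 1)^2 / 8\<close> and
  \<open>(2 s + 1) / 2\<close>.\<close>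

lemma theta_term_bound:
  fixes \<delta> Y :: real
  assumes "\<delta> > 0"
  obtains C where "C > 0" "\<And>\<tau> z s. Im \<tau> \<ge> \<delta> \<Longrightarrow> \<bar>Im z\<bar> \<le> Y \<Longrightarrow>
    norm (theta_term \<tau> z s) * of_int ((2 * s + 1)\<^sup>2) \<le> C * exp (- \<bar>of_int s\<bar>)"
proof -
  define a C where "a = pi * \<delta> / 4" and "C = 2 * exp ((pi * Y + 2)\<^sup>2 / (4 * a))"
  have "norm (theta_term \<tau> z s) * of_int ((2 * s + 1)\<^sup>2) \<le> C * exp (- \<bar>of_int s\<bar>)"
    if \<tau>: "Im \<tau> \<ge> \<delta>" and z: "\<bar>Im z\<bar> \<le> Y" for \<tau> z s
  proof -
    define t where "t = \<bar>real_of_int (2 * s + 1)\<bar>"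
    have t2: "t\<^sup>2 = of_int ((2 * s + 1)\<^sup>2)" by (simp add: t_def)
    have "norm (theta_term \<tau> z s) = exp (- (pi * Im \<tau> / 4) * t\<^sup>2 + - pi * (of_int (2 * s + 1) * Im z))"
      unfolding theta_term_def norm_mult norm_ee t2
      by (simp add: exp_add[symmetric] add_divide_distrib algebra_simps)
    also have "\<dots> \<le> exp (- a * t\<^sup>2 + pi * Y * t)"
    proof -
      have "- (pi * Im \<tau> / 4) \<le> - a" using \<tau> by (simp add: a_def)
      then have "- (pi * Im \<tau> / 4) * t\<^sup>2 \<le> - a * t\<^sup>2" by (rule mult_right_mono) simp
      moreover have "- (of_int (2 * s + 1) * Im z) \<le> Y * t"
      proof -
        have "- (of_int (2 * s + 1) * Im z) \<le> \<bar>of_int (2 * s + 1) * Im z\<bar>" by simp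
        also have "\<dots> = \<bar>Im z\<bar> * t" by (simp only: abs_mult t_def mult.commute)
        also have "\<dots> \<le> Y * t" using z by (intro mult_right_mono) (auto simp: t_def)
        finally show ?thesis .
      qed
      then have "pi * (- (of_int (2 * s + 1) * Im z)) \<le> pi * (Y * t)" by (intro mult_left_mono) auto
      then have "- pi * (of_int (2 * s + 1) * Im z) \<le> pi * Y * t"
        by (simp only: mult_minus_left mult_minus_right mult.assoc)
      ultimately show ?thesis unfolding exp_le_cancel_iff by (rule add_mono)
    qed
    finally have "norm (theta_term \<tau> z s) * t\<^sup>2 \<le> t\<^sup>2 * exp (- a * t\<^sup>2 + pi * Y * t)"
      by (subst mult.commute) (intro mult_left_mono, auto)
    also have "\<dots> \<le> C * exp (- t)"
      unfolding C_def using assms by (intro power2_exp_quadratic_le) (auto simp: a_def t_def)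
    also have "\<dots> \<le> C * exp (- \<bar>of_int s\<bar>)"
    proof -
      have "\<bar>s\<bar> \<le> \<bar>2 * s + 1\<bar>" by arith
      then have "\<bar>real_of_int s\<bar> \<le> t" unfolding t_def by linarith
      then show ?thesis by (simp add: C_def)
    qed
    finally show ?thesis unfolding t2 .
  qed
  then show ?thesis by (intro that[of C]) (auto simp: C_def)
qed

lemma one_le_odd_square: "1 \<le> real_of_int ((2 * s + 1)\<^sup>2)"
proof -
  have "2 * s + 1 \<noteq> 0" by presburger
  then have "0 < (2 * s + 1)\<^sup>2" by (metis zero_less_power2)
  then show ?thesis by linarith
qed

lemma theta_has_sum:
  assumes "\<tau> \<in> uhp"
  shows "(theta_term \<tau> z has_sum jtheta \<tau> z) UNIV"
proof -
  define f where "f = (\<lambda>r. kron_m4 r * ee (of_int (r\<^sup>2) / 8 * \<tau>) * ee (of_int r / 2 * z))"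
  obtain C where C: "C > 0" "\<And>s. norm (theta_term \<tau> z s) * of_int ((2 * s + 1)\<^sup>2) \<le> C * exp (- \<bar>of_int s\<bar>)"
    using theta_term_bound[of "Im \<tau>" "\<bar>Im z\<bar>"] assms unfolding uhp_def mem_Collect_eq by (metis order_refl)
  have "norm (theta_term \<tau> z s) \<le> C * exp (- 1 * real_of_int \<bar>s\<bar>)" for s
  proof -
    have "norm (theta_term \<tau> z s) * 1 \<le> norm (theta_term \<tau> z s) * of_int ((2 * s + 1)\<^sup>2)"
      by (intro mult_left_mono one_le_odd_square norm_ge_zero)
    also note C(2)[of s]
    finally show ?thesis by simp
  qed
  then have "(\<lambda>s. norm (theta_term \<tau> z s)) summable_on UNIV"
    by (intro summable_on_comparison_test[OF summable_on_cmult_right[OF summable_exp_abs_int[of 1]]]) auto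
  then have "theta_term \<tau> z summable_on UNIV" by (rule abs_summable_summable)
  then have "(theta_term \<tau> z has_sum infsum (theta_term \<tau> z) UNIV) UNIV" by (rule has_sum_infsum)
  also have "?this \<longleftrightarrow> (f has_sum infsum (theta_term \<tau> z) UNIV) {r. odd r}"
  proof (rule has_sum_reindex_bij_witness[of _ "\<lambda>r. r div 2" "\<lambda>s. 2 * s + 1"])
    fix s
    have "kron_m4 (2 * s + 1) = altsign s"
    proof (cases "even s")
      case True
      then obtain j where "s = 2 * j" by blast
      then have "(2 * s + 1) mod 4 = 1" by presburger
      then show ?thesis using True by (simp add: kron_m4_def altsign_def)
    next
      case False
      then obtain j where "s = 2 * j + 1" by (blast elim: oddE)
      then have "(2 * s + 1) mod 4 = 3" by presburger
      then show ?thesis using False by (simp add: kron_m4_def altsign_def)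
    qed
    then show "f (2 * s + 1) = theta_term \<tau> z s" by (simp add: f_def theta_term_def)
  qed auto
  also have "\<dots> \<longleftrightarrow> (f has_sum infsum (theta_term \<tau> z) UNIV) UNIV"
    by (rule has_sum_cong_neutral) (auto simp: f_def kron_m4_def, presburger+)
  finally have "jtheta \<tau> z = infsum (theta_term \<tau> z) UNIV"
    unfolding jtheta_def f_def by (rule infsumI)
  then show ?thesis
    using \<open>(theta_term \<tau> z has_sum infsum (theta_term \<tau> z) UNIV) UNIV\<close> by simp
qed

text \<open>Moving the summation index by \<open>l\<close> completes the square. What is left in the
  exponent does not depend on \<open>s\<close>, apart from the integer \<open>s * \<mu>\<close>,
  which \<open>ee\<close> does not see.\<close>

lemma jtheta_shift:
  assumes "\<tau> \<in> uhp"
  shows "jtheta \<tau> (z + of_int l * \<tau> + of_int \<mu>) =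
    altsign (l + \<mu>) * ee (- ((of_int l)\<^sup>2 * \<tau> + 2 * of_int l * z) / 2) * jtheta \<tau> z"
proof -
  let ?c = "altsign (l + \<mu>) * ee (- ((of_int l)\<^sup>2 * \<tau> + 2 * of_int l * z) / 2)"
  have eq: "theta_term \<tau> (z + of_int l * \<tau> + of_int \<mu>) s = ?c * theta_term \<tau> z (s + l)" for s
  proof -
    have "of_int ((2 * s + 1)\<^sup>2) / 8 * \<tau> + of_int (2 * s + 1) / 2 * (z + of_int l * \<tau> + of_int \<mu>) =
        (of_int ((2 * (s + l) + 1)\<^sup>2) / 8 * \<tau> + of_int (2 * (s + l) + 1) / 2 * z
        + - ((of_int l)\<^sup>2 * \<tau> + 2 * of_int l * z) / 2 + of_int \<mu> / 2) + of_int (s * \<mu>)"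
      by (simp add: field_simps power2_eq_square)
    then have "ee (of_int ((2 * s + 1)\<^sup>2) / 8 * \<tau>) * ee (of_int (2 * s + 1) / 2 * (z + of_int l * \<tau> + of_int \<mu>)) =
        ee (of_int ((2 * (s + l) + 1)\<^sup>2) / 8 * \<tau>) * ee (of_int (2 * (s + l) + 1) / 2 * z)
        * ee (- ((of_int l)\<^sup>2 * \<tau> + 2 * of_int l * z) / 2) * altsign \<mu>"
      by (simp only: ee_add[symmetric] ee_half_int[symmetric] ee_plus_of_int)
    moreover have "altsign s = altsign (l + \<mu>) * altsign (s + l) * altsign \<mu>"
      by (auto simp: altsign_def)
    ultimately show ?thesis
      unfolding theta_term_def mult.assoc by (simp add: mult_ac altsign_add)
  qed
  have "((\<lambda>s. ?c * theta_term \<tau> z s) has_sum (?c * jtheta \<tau> z)) UNIV"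
    by (intro has_sum_cmult_right theta_has_sum assms)
  also have "?this \<longleftrightarrow> (theta_term \<tau> (z + of_int l * \<tau> + of_int \<mu>) has_sum (?c * jtheta \<tau> z)) UNIV"
    by (rule has_sum_reindex_bij_witness[of _ "\<lambda>s. s + l" "\<lambda>s. s - l"]) (auto simp: eq)
  finally show ?thesis
    using theta_has_sum[OF assms] has_sum_unique by blast
qed

text \<open>The factor \<open>ee (- z / 2)\<close> turns the sign under \<open>z + 1\<close> into a
  true period. The law for \<open>z + \<tau>\<close> then is a recursion of first order for the
  Fourier coefficients, so a single coefficient determines the function.\<close>

lemma jtheta_1dim:
  assumes "\<tau> \<in> uhp" "f holomorphic_on UNIV"
    and f1: "\<And>z. f (z + 1) = - f z"
    and f\<tau>: "\<And>z. f (z + \<tau>) = - ee (- \<tau> / 2 - z) * f z"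
  obtains \<kappa> where "\<And>z. f z = \<kappa> * jtheta \<tau> z"
proof -
  define g where "g = (\<lambda>z. f z * ee (- z / 2))"
  have g1: "g (z + 1) = g z" for z
  proof -
    have "- (z + 1) / 2 = - z / 2 - 1 / 2" by (simp add: field_simps)
    then have "ee (- (z + 1) / 2) = - ee (- z / 2)" by (simp only: ee_diff ee_half) simp
    then show ?thesis unfolding g_def f1 by (simp only: mult_minus_left mult_minus_right minus_minus)
  qed
  have g\<tau>: "g (z + \<tau>) = - ee (- \<tau> - z) * g z" for z
  proof -
    have "- \<tau> / 2 - z + - (z + \<tau>) / 2 = - \<tau> - z + - z / 2" by (simp add: field_simps)
    then have "ee (- \<tau> / 2 - z) * ee (- (z + \<tau>) / 2) = ee (- \<tau> - z) * ee (- z / 2)"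
      by (simp only: ee_add[symmetric])
    then show ?thesis unfolding g_def f\<tau> by (simp only: mult_minus_left mult_minus_right mult.assoc mult.left_commute[of _ "f z"])
  qed
  have "g holomorphic_on UNIV" unfolding g_def by (intro holomorphic_intros assms) auto
  from fourier_series_entire[OF this g1]
  obtain a where a: "\<And>z. ((\<lambda>n. a n * ee (of_int n * z)) has_sum g z) UNIV" by blast
  have "(\<lambda>n. a n * ee (of_int n * \<tau>)) = (\<lambda>n. - ee (- \<tau>) * a (n + 1))"
  proof (rule fourier_series_coeff_unique)
    fix x :: real
    show "((\<lambda>r. a r * ee (of_int r * \<tau>) * ee (of_int r * of_real x)) has_sum g (of_real x + \<tau>)) UNIV"
      using a[of "of_real x + \<tau>"] by (simp add: ring_distribs ee_add mult_ac)
    have "((\<lambda>n. - ee (- \<tau> - of_real x) * (a n * ee (of_int n * of_real x))) has_sum (- ee (- \<tau> - of_real x) * g (of_real x))) UNIV"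
      by (intro has_sum_cmult_right a)
    also have "?this \<longleftrightarrow> ((\<lambda>r. - ee (- \<tau>) * a (r + 1) * ee (of_int r * of_real x)) has_sum g (of_real x + \<tau>)) UNIV"
    proof (rule has_sum_reindex_bij_witness[of _ "\<lambda>s. s + 1" "\<lambda>s. s - 1"])
      fix n
      have "- \<tau> - of_real x + of_int n * of_real x = - \<tau> + of_int (n - 1) * of_real x"
        by (simp add: algebra_simps)
      then have "ee (- \<tau> - of_real x) * ee (of_int n * of_real x) = ee (- \<tau>) * ee (of_int (n - 1) * of_real x)"
        by (simp only: ee_add[symmetric])
      then show "- ee (- \<tau>) * a (n - 1 + 1) * ee (of_int (n - 1) * of_real x) =
          - ee (- \<tau> - of_real x) * (a n * ee (of_int n * of_real x))"
        by (simp add: mult_ac)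
    qed (auto simp: g\<tau>)
    finally show "((\<lambda>r. - ee (- \<tau>) * a (r + 1) * ee (of_int r * of_real x)) has_sum g (of_real x + \<tau>)) UNIV" .
  qed
  then have "a n * ee (of_int n * \<tau>) = - ee (- \<tau>) * a (n + 1)" for n by metis
  then have rec: "a (n + 1) = - ee (of_int (n + 1) * \<tau>) * a n" for n
    by (simp add: ee_minus ring_distribs ee_add field_simps)
  \<comment> \<open>The solution of the recursion with value 1 at 0. It has no zeros, so
    \<open>a n / T n\<close> is constant in both directions.\<close>
  define T where "T = (\<lambda>n::int. altsign n * ee (of_int (n * (n + 1) div 2) * \<tau>))"
  have T: "T (n + 1) = - ee (of_int (n + 1) * \<tau>) * T n" "T n \<noteq> 0" for n
  proof -
    have "(n + 1) * (n + 1 + 1) div 2 = (n + 1) + n * (n + 1) div 2"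
      using triangular_succ[of n] by (simp add: add.assoc)
    then show "T (n + 1) = - ee (of_int (n + 1) * \<tau>) * T n"
      unfolding T_def altsign_add by (simp only: of_int_add ring_distribs ee_add) simp
    show "T n \<noteq> 0" by (simp add: T_def)
  qed
  define d where "d = (\<lambda>n. a n / T n)"
  have d: "d (n + 1) = d n" for n
    using T[of n] by (simp add: d_def rec)
  have dn: "d n = d 0" for n
  proof (induction n rule: int_induct[where k=0])
    case (step1 i) then show ?case using d[of i] by simp
  next
    case (step2 i) then show ?case using d[of "i - 1"] by simp
  qed simp
  have an: "a n = a 0 * T n" for n
    using dn[of n] T(2)[of n] by (simp add: d_def T_def field_simps)
  have "f z = a 0 * ee (- \<tau> / 8) * jtheta \<tau> z" for z
  proof -
    have "((\<lambda>n. ee (z / 2) * (a n * ee (of_int n * z))) has_sum (ee (z / 2) * g z)) UNIV"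
      by (intro has_sum_cmult_right a)
    moreover have "ee (z / 2) * (a n * ee (of_int n * z)) = a 0 * ee (- \<tau> / 8) * theta_term \<tau> z n" for n
    proof -
      obtain j where j: "n * (n + 1) = 2 * j" by (metis dvdE even_mult_iff odd_add odd_one)
      have "(2 * n + 1)\<^sup>2 = 8 * j + 1" using j by (simp add: power2_eq_square algebra_simps)
      then have "z / 2 + of_int (n * (n + 1) div 2) * \<tau> + of_int n * z =
          - \<tau> / 8 + of_int ((2 * n + 1)\<^sup>2) / 8 * \<tau> + of_int (2 * n + 1) / 2 * z"
        using j by (simp add: field_simps)
      then have "ee (z / 2) * ee (of_int (n * (n + 1) div 2) * \<tau>) * ee (of_int n * z) =
          ee (- \<tau> / 8) * ee (of_int ((2 * n + 1)\<^sup>2) / 8 * \<tau>) * ee (of_int (2 * n + 1) / 2 * z)"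
        by (simp only: ee_add[symmetric])
      then show ?thesis unfolding an[of n] T_def theta_term_def by (simp only: mult_ac)
    qed
    moreover have "((\<lambda>n. a 0 * ee (- \<tau> / 8) * theta_term \<tau> z n) has_sum (a 0 * ee (- \<tau> / 8) * jtheta \<tau> z)) UNIV"
      by (intro has_sum_cmult_right theta_has_sum assms)
    ultimately have "ee (z / 2) * g z = a 0 * ee (- \<tau> / 8) * jtheta \<tau> z"
      using has_sum_unique by (metis (no_types, lifting) ext)
    moreover have "ee (z / 2) * g z = f z" by (simp add: g_def ee_minus mult_ac)
    ultimately show ?thesis by simp
  qed
  then show ?thesis by (rule that)
qed

section \<open>Differentiability of the theta function in both variables\<close>

lemma theta_term_has_derivative:
  "((\<lambda>p. theta_term (fst p) (snd p) s) has_derivative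
     (\<lambda>h. theta_term (fst p) (snd p) s * (2 * of_real pi * \<i>) *
          (of_int ((2 * s + 1)\<^sup>2) / 8 * fst h + of_int (2 * s + 1) / 2 * snd h))) (at p within S)"
proof -
  define L :: "complex \<times> complex \<Rightarrow> complex" where
    "L = (\<lambda>h. 2 * of_real pi * \<i> * (of_int ((2 * s + 1)\<^sup>2) / 8 * fst h + of_int (2 * s + 1) / 2 * snd h))"
  have th: "theta_term (fst p) (snd p) s = altsign s * exp (L p)" for p
    unfolding theta_term_def ee_def L_def by (simp only: ring_distribs exp_add mult.assoc)
  have "(L has_derivative L) (at p within S)"
    unfolding L_def by (intro derivative_intros)
  from has_derivative_compose[OF this, of exp "\<lambda>h. exp (L p) * h"] DERIV_exp[of "L p"]
  have "((\<lambda>p. exp (L p)) has_derivative (\<lambda>h. exp (L p) * L h)) (at p within S)"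
    by (simp add: has_field_derivative_def)
  then have "((\<lambda>p. altsign s * exp (L p)) has_derivative (\<lambda>h. altsign s * (exp (L p) * L h))) (at p within S)"
    by (rule has_derivative_mult_right)
  then show ?thesis
    unfolding th by (rule has_derivative_eq_rhs) (simp add: fun_eq_iff L_def mult_ac)
qed

text \<open>Belongs to the terms \<open>k\<close> and \<open>- k - 1\<close> jointly. They share the
  square \<open>(2 k + 1)^2\<close> but have opposite odd numbers, hence a sum here and a difference
  in \<open>theta_dz\<close>.\<close>

definition theta_dtau :: "nat \<Rightarrow> complex \<Rightarrow> complex \<Rightarrow> complex" where
  "theta_dtau k \<tau> z = (theta_term \<tau> z (int k) + theta_term \<tau> z (- int k - 1)) * (2 * of_real pi * \<i>) *
     (of_int ((2 * int k + 1)\<^sup>2) / 8)"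

definition theta_dz :: "nat \<Rightarrow> complex \<Rightarrow> complex \<Rightarrow> complex" where
  "theta_dz k \<tau> z = (theta_term \<tau> z (int k) - theta_term \<tau> z (- int k - 1)) * (2 * of_real pi * \<i>) *
     (of_int (2 * int k + 1) / 2)"

lemma theta_pair_has_derivative:
  "((\<lambda>p. theta_term (fst p) (snd p) (int k) + theta_term (fst p) (snd p) (- int k - 1)) has_derivative
     (\<lambda>h. theta_dtau k (fst p) (snd p) * fst h + theta_dz k (fst p) (snd p) * snd h)) (at p within S)"
proof -
  have n: "2 * (- int k - 1) + 1 = - (2 * int k + 1)" by simp
  show ?thesis
    by (rule has_derivative_eq_rhs[OF has_derivative_add[OF theta_term_has_derivative theta_term_has_derivative]])
       (simp only: n power2_minus of_int_minus, simp add: fun_eq_iff theta_dtau_def theta_dz_def algebra_simps add_divide_distrib diff_divide_distrib)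
qed

lemma theta_partials_bound:
  fixes \<delta> Y :: real
  assumes "\<delta> > 0"
  obtains C where "\<And>\<tau> z k. Im \<tau> \<ge> \<delta> \<Longrightarrow> \<bar>Im z\<bar> \<le> Y \<Longrightarrow>
    norm (theta_dtau k \<tau> z) \<le> C * exp (-1) ^ k \<and> norm (theta_dz k \<tau> z) \<le> C * exp (-1) ^ k"
proof -
  obtain C where C: "C > 0" "\<And>\<tau> z s. Im \<tau> \<ge> \<delta> \<Longrightarrow> \<bar>Im z\<bar> \<le> Y \<Longrightarrow>
    norm (theta_term \<tau> z s) * of_int ((2 * s + 1)\<^sup>2) \<le> C * exp (- \<bar>of_int s\<bar>)"
    using theta_term_bound[OF assms] by metis
  have "norm (theta_dtau k \<tau> z) \<le> 4 * pi * C * exp (-1) ^ k \<and> norm (theta_dz k \<tau> z) \<le> 4 * pi * C * exp (-1) ^ k"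
    if "Im \<tau> \<ge> \<delta>" "\<bar>Im z\<bar> \<le> Y" for \<tau> z k
  proof -
    define a b t where "a = norm (theta_term \<tau> z (int k))" and "b = norm (theta_term \<tau> z (- int k - 1))"
      and "t = real_of_int (2 * int k + 1)"
    have e: "exp (-1) ^ k = exp (- real k)" by (simp add: exp_of_nat_mult[symmetric])
    have n: "2 * (- int k - 1) + 1 = - (2 * int k + 1)" by simp
    have 1: "a * t\<^sup>2 \<le> C * exp (- real k)"
      using C(2)[OF that, of "int k"] by (simp add: a_def t_def)
    have "b * t\<^sup>2 \<le> C * exp (- \<bar>of_int (- int k - 1)\<bar>)"
      using C(2)[OF that, of "- int k - 1"] unfolding n b_def t_def power2_minus by simp
    also have "\<dots> \<le> C * exp (- real k)" using C(1) by (intro mult_left_mono) auto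
    finally have 2: "b * t\<^sup>2 \<le> C * exp (- real k)" .
    have t1: "t \<ge> 1" by (simp add: t_def)
    then have tt: "t \<le> t\<^sup>2" by (simp add: power2_eq_square)
    have ab: "a \<ge> 0" "b \<ge> 0" by (auto simp: a_def b_def)
    have s: "(a + b) * t\<^sup>2 \<le> 2 * C * exp (- real k)" using 1 2 by (simp add: algebra_simps)
    have "norm (theta_dtau k \<tau> z) = norm (theta_term \<tau> z (int k) + theta_term \<tau> z (- int k - 1)) * (2 * pi) * (t\<^sup>2 / 8)"
      unfolding theta_dtau_def t_def norm_mult norm_divide norm_of_int by (simp add: norm_power)
    also have "\<dots> \<le> (a + b) * (2 * pi) * t\<^sup>2"
      unfolding a_def b_def by (intro mult_mono norm_triangle_ineq) auto
    also have "\<dots> = 2 * pi * ((a + b) * t\<^sup>2)" by simp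
    also have "\<dots> \<le> 2 * pi * (2 * C * exp (- real k))" using s by (intro mult_left_mono) auto
    finally have A: "norm (theta_dtau k \<tau> z) \<le> 4 * pi * C * exp (-1) ^ k" by (simp add: e)
    have "norm (theta_dz k \<tau> z) = norm (theta_term \<tau> z (int k) - theta_term \<tau> z (- int k - 1)) * (2 * pi) * (t / 2)"
      unfolding theta_dz_def t_def norm_mult norm_divide norm_of_int by simp
    also have "\<dots> \<le> (a + b) * (2 * pi) * t\<^sup>2"
      unfolding a_def b_def using t1 tt by (intro mult_mono norm_triangle_ineq4) auto
    also have "\<dots> = 2 * pi * ((a + b) * t\<^sup>2)" by simp
    also have "\<dots> \<le> 2 * pi * (2 * C * exp (- real k))" using s by (intro mult_left_mono) auto
    finally show ?thesis using A by (simp add: e)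
  qed
  then show ?thesis by (rule that)
qed

lemma uniform_limit_suminf_norm:
  fixes f :: "nat \<Rightarrow> 'a \<Rightarrow> complex"
  assumes "\<And>k x. x \<in> S \<Longrightarrow> norm (f k x) \<le> M k" "summable M" "e > 0"
  shows "\<forall>\<^sub>F n in sequentially. \<forall>x\<in>S. norm ((\<Sum>k<n. f k x) - (\<Sum>k. f k x)) \<le> e"
proof -
  have "uniform_limit S (\<lambda>n x. \<Sum>k<n. f k x) (\<lambda>x. \<Sum>k. f k x) sequentially"
    using assms(1,2) by (rule Weierstrass_m_test)
  from uniform_limitD[OF this assms(3)] show ?thesis
    by eventually_elim (auto simp: dist_norm less_imp_le)
qed

text \<open>Termwise differentiation needs a convex domain and uniform convergence of the
  derivatives. The half-plane and the strip that form \<open>S\<close> keep \<open>Im \<tau>\<close>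
  away from 0 and \<open>Im z\<close> bounded, where \<open>theta_partials_bound\<close> is
  uniform.\<close>

theorem jtheta_has_derivative:
  assumes "\<tau> \<in> uhp"
  shows "((\<lambda>p. jtheta (fst p) (snd p)) has_derivative
     (\<lambda>h. (\<Sum>k. theta_dtau k \<tau> z) * fst h + (\<Sum>k. theta_dz k \<tau> z) * snd h)) (at (\<tau>, z))"
proof -
  define S where "S = {t. Im t > Im \<tau> / 2} \<times> ({w. Im w > - (\<bar>Im z\<bar> + 1)} \<inter> {w. Im w < \<bar>Im z\<bar> + 1})"
  have "open S" unfolding S_def
    by (intro open_Times open_Int open_halfspace_Im_gt open_halfspace_Im_lt)
  have "convex S" unfolding S_def
    by (intro convex_Times convex_Int convex_halfspace_Im_gt convex_halfspace_Im_lt)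
  have "(\<tau>, z) \<in> S" using assms by (auto simp: S_def uhp_def)
  have Suhp: "fst p \<in> uhp" if "p \<in> S" for p
    using that assms by (auto simp: S_def uhp_def)
  obtain C where C: "\<And>\<tau>' z' k. Im \<tau>' \<ge> Im \<tau> / 2 \<Longrightarrow> \<bar>Im z'\<bar> \<le> \<bar>Im z\<bar> + 1 \<Longrightarrow>
    norm (theta_dtau k \<tau>' z') \<le> C * exp (-1) ^ k \<and> norm (theta_dz k \<tau>' z') \<le> C * exp (-1) ^ k"
    using theta_partials_bound[of "Im \<tau> / 2" "\<bar>Im z\<bar> + 1"] assms by (auto simp: uhp_def)
  have CS: "norm (theta_dtau k (fst p) (snd p)) \<le> C * exp (-1) ^ k" "norm (theta_dz k (fst p) (snd p)) \<le> C * exp (-1) ^ k"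
    if "p \<in> S" for p k
    using C[of "fst p" "snd p" k] that by (auto simp: S_def)
  have sM: "summable (\<lambda>k. C * exp (-1 :: real) ^ k)"
    by (intro summable_mult summable_geometric) auto
  have sums: "(\<lambda>k. theta_term (fst p) (snd p) (int k) + theta_term (fst p) (snd p) (- int k - 1)) sums jtheta (fst p) (snd p)"
    if "p \<in> S" for p
    by (intro has_sum_int_imp_sums theta_has_sum Suhp that)
  have "\<exists>g. \<forall>p\<in>S. (\<lambda>k. theta_term (fst p) (snd p) (int k) + theta_term (fst p) (snd p) (- int k - 1)) sums g p \<and>
      (g has_derivative (\<lambda>h. (\<Sum>k. theta_dtau k (fst p) (snd p)) * fst h + (\<Sum>k. theta_dz k (fst p) (snd p)) * snd h)) (at p within S)"
  proof (rule has_derivative_series[OF \<open>convex S\<close> theta_pair_has_derivative])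
    fix e :: real assume "e > 0"
    then have "e / 2 > 0" by simp
    have U1: "\<forall>\<^sub>F n in sequentially. \<forall>p\<in>S. norm ((\<Sum>k<n. theta_dtau k (fst p) (snd p)) - (\<Sum>k. theta_dtau k (fst p) (snd p))) \<le> e / 2"
      by (rule uniform_limit_suminf_norm[OF _ sM \<open>e / 2 > 0\<close>]) (rule CS(1))
    have U2: "\<forall>\<^sub>F n in sequentially. \<forall>p\<in>S. norm ((\<Sum>k<n. theta_dz k (fst p) (snd p)) - (\<Sum>k. theta_dz k (fst p) (snd p))) \<le> e / 2"
      by (rule uniform_limit_suminf_norm[OF _ sM \<open>e / 2 > 0\<close>]) (rule CS(2))
    show "\<forall>\<^sub>F n in sequentially. \<forall>p\<in>S. \<forall>h. norm ((\<Sum>k<n. theta_dtau k (fst p) (snd p) * fst h + theta_dz k (fst p) (snd p) * snd h) -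
        ((\<Sum>k. theta_dtau k (fst p) (snd p)) * fst h + (\<Sum>k. theta_dz k (fst p) (snd p)) * snd h)) \<le> e * norm h"
      using U1 U2
    proof eventually_elim
      case (elim n)
      show ?case
      proof (intro ballI allI)
        fix p and h :: "complex \<times> complex" assume "p \<in> S"
        define a b where "a = (\<Sum>k<n. theta_dtau k (fst p) (snd p)) - (\<Sum>k. theta_dtau k (fst p) (snd p))"
          and "b = (\<Sum>k<n. theta_dz k (fst p) (snd p)) - (\<Sum>k. theta_dz k (fst p) (snd p))"
        have ab: "norm a \<le> e / 2" "norm b \<le> e / 2" using elim \<open>p \<in> S\<close> by (auto simp: a_def b_def)
        have "norm (a * fst h + b * snd h) \<le> norm a * norm (fst h) + norm b * norm (snd h)"
          by (metis norm_mult norm_triangle_ineq)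
        also have "\<dots> \<le> e / 2 * norm h + e / 2 * norm h"
          using ab \<open>e > 0\<close> by (intro add_mono mult_mono norm_fst_le norm_snd_le) (auto simp: norm_fst_le norm_snd_le prod.collapse intro: norm_fst_le[of "fst h" "snd h", simplified] norm_snd_le[of "snd h" "fst h", simplified])
        finally have "norm (a * fst h + b * snd h) \<le> e * norm h" by simp
        then show "norm ((\<Sum>k<n. theta_dtau k (fst p) (snd p) * fst h + theta_dz k (fst p) (snd p) * snd h) -
            ((\<Sum>k. theta_dtau k (fst p) (snd p)) * fst h + (\<Sum>k. theta_dz k (fst p) (snd p)) * snd h)) \<le> e * norm h"
          unfolding sum.distrib sum_distrib_right[symmetric]
          by (simp only: a_def b_def ring_distribs) (simp only: add_diff_eq diff_add_eq diff_diff_eq2 diff_diff_eq add_ac)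
      qed
    qed
  qed (rule \<open>(\<tau>, z) \<in> S\<close>, rule sums, rule \<open>(\<tau>, z) \<in> S\<close>)
  then obtain g where g: "\<And>p. p \<in> S \<Longrightarrow> (\<lambda>k. theta_term (fst p) (snd p) (int k) + theta_term (fst p) (snd p) (- int k - 1)) sums g p"
    "\<And>p. p \<in> S \<Longrightarrow> (g has_derivative (\<lambda>h. (\<Sum>k. theta_dtau k (fst p) (snd p)) * fst h + (\<Sum>k. theta_dz k (fst p) (snd p)) * snd h)) (at p within S)"
    by blast
  have gj: "g p = jtheta (fst p) (snd p)" if "p \<in> S" for p
    using sums_unique2[OF g(1) sums] that by blast
  have "(g has_derivative (\<lambda>h. (\<Sum>k. theta_dtau k \<tau> z) * fst h + (\<Sum>k. theta_dz k \<tau> z) * snd h)) (at (\<tau>, z))"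
    using g(2)[OF \<open>(\<tau>, z) \<in> S\<close>] at_within_open[OF \<open>(\<tau>, z) \<in> S\<close> \<open>open S\<close>] by simp
  then show ?thesis
    by (rule has_derivative_transform_within_open[OF _ \<open>open S\<close> \<open>(\<tau>, z) \<in> S\<close> gj])
qed

corollary holomorphic2_jtheta: "holomorphic2 jtheta"
  unfolding holomorphic2_def using jtheta_has_derivative by blast

lemma jtheta_0: "\<tau> \<in> uhp \<Longrightarrow> jtheta \<tau> 0 = 0"
proof -
  assume \<tau>: "\<tau> \<in> uhp"
  have "theta_term \<tau> 0 (int k) + theta_term \<tau> 0 (- int k - 1) = 0" for k
  proof -
    have n: "2 * (- int k - 1) + 1 = - (2 * int k + 1)" by simp
    have "altsign (- int k - 1) = - altsign (int k)" by (auto simp: altsign_def)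
    then show ?thesis unfolding theta_term_def n power2_minus by simp
  qed
  then show ?thesis
    using has_sum_int_imp_sums[OF theta_has_sum[OF \<tau>, of 0]] sums_unique2[OF sums_zero] by simp
qed

text \<open>At \<open>z = 0\<close> both terms of a pair contribute equally, which gives
  \<open>2 pi i\<close> times the series of \<open>eta_cube_series\<close>. The derivative is what
  fixes the free factor in \<open>jtheta_modular\<close>.\<close>

lemma jtheta_deriv_0:
  assumes "\<tau> \<in> uhp"
  shows "(jtheta \<tau> has_field_derivative 2 * of_real pi * \<i> * eta_pow 3 \<tau>) (at 0)"
proof -
  have "theta_dz k \<tau> 0 = 2 * of_real pi * \<i> *
      (of_nat (2 * k + 1) * altsign (int k) * ee (of_nat ((2 * k + 1)\<^sup>2) / 8 * \<tau>))" for k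
  proof -
    have n: "2 * (- int k - 1) + 1 = - (2 * int k + 1)" by simp
    have "altsign (- int k - 1) = - altsign (int k)" by (auto simp: altsign_def)
    then show ?thesis unfolding theta_dz_def theta_term_def n power2_minus by (simp add: algebra_simps)
  qed
  then have "(\<lambda>k. theta_dz k \<tau> 0) sums (2 * of_real pi * \<i> * eta_pow 3 \<tau>)"
    using sums_mult[OF eta_cube_series[OF assms]] by simp
  then have s: "(\<Sum>k. theta_dz k \<tau> 0) = 2 * of_real pi * \<i> * eta_pow 3 \<tau>" by (rule sums_unique[symmetric])
  have "((\<lambda>p. jtheta (fst p) (snd p)) \<circ> (\<lambda>t. (\<tau>, t)) has_derivative
     (\<lambda>h. (\<Sum>k. theta_dtau k \<tau> 0) * fst h + (\<Sum>k. theta_dz k \<tau> 0) * snd h) \<circ> (\<lambda>h. (0, h))) (at 0)"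
    by (intro diff_chain_at derivative_eq_intros jtheta_has_derivative assms) (auto intro!: derivative_eq_intros)
  then show ?thesis by (simp add: o_def s has_field_derivative_def)
qed

section \<open>Modular transformation of the theta function\<close>

lemma moebius_uhp:
  assumes "\<tau> \<in> uhp" "a * d - b * c = (1 :: int)"
  shows "of_int c * \<tau> + of_int d \<noteq> 0"
    and "(of_int a * \<tau> + of_int b) / (of_int c * \<tau> + of_int d) \<in> uhp"
    and "1 / (of_int c * \<tau> + of_int d) =
      of_int a - of_int c * ((of_int a * \<tau> + of_int b) / (of_int c * \<tau> + of_int d))"
    and "\<tau> / (of_int c * \<tau> + of_int d) =
      of_int d * ((of_int a * \<tau> + of_int b) / (of_int c * \<tau> + of_int d)) - of_int b"
proof -
  have y: "Im \<tau> > 0" using assms by (simp add: uhp_def)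
  show nz: "of_int c * \<tau> + of_int d \<noteq> 0"
  proof
    assume *: "of_int c * \<tau> + of_int d = 0"
    then have "Im (of_int c * \<tau> + of_int d) = 0" by simp
    with y have "c = 0" by simp
    with * have "d = 0" by simp
    with \<open>c = 0\<close> assms show False by simp
  qed
  have det: "of_int a * of_int d - of_int b * of_int c = (1 :: complex)"
    using assms(2) by (metis of_int_1 of_int_diff of_int_mult)
  have 1: "of_int a * (of_int c * \<tau> + of_int d) - of_int c * (of_int a * \<tau> + of_int b) = 1"
    using det by (simp add: algebra_simps)
  have 2: "of_int d * (of_int a * \<tau> + of_int b) - of_int b * (of_int c * \<tau> + of_int d) = \<tau>"
  proof -
    have "of_int d * (of_int a * \<tau> + of_int b) - of_int b * (of_int c * \<tau> + of_int d) =
        (of_int a * of_int d - of_int b * of_int c) * \<tau>" by (simp add: algebra_simps)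
    then show ?thesis using det by simp
  qed
  \<comment> \<open>Division by the automorphy factor turns translations of \<open>z\<close> by 1
    and by \<tau> into lattice translations for the transformed point, so that
    \<open>jtheta_shift\<close> applies there.\<close>
  show "1 / (of_int c * \<tau> + of_int d) =
      of_int a - of_int c * ((of_int a * \<tau> + of_int b) / (of_int c * \<tau> + of_int d))"
    using nz 1 by (simp add: diff_divide_distrib[symmetric] eq_divide_eq divide_eq_eq diff_frac_eq field_simps)
  show "\<tau> / (of_int c * \<tau> + of_int d) =
      of_int d * ((of_int a * \<tau> + of_int b) / (of_int c * \<tau> + of_int d)) - of_int b"
    using nz 2 by (simp add: field_simps)
  have "Im ((of_int a * \<tau> + of_int b) * cnj (of_int c * \<tau> + of_int d)) = Im \<tau> * of_int (a * d - b * c)"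
    by (simp add: algebra_simps)
  then have im: "Im ((of_int a * \<tau> + of_int b) / (of_int c * \<tau> + of_int d)) = Im \<tau> / (norm (of_int c * \<tau> + of_int d))\<^sup>2"
    using assms(2) by (subst complex_div_cnj) (simp add: Im_divide_of_real del: complex_cnj_add)
  show "(of_int a * \<tau> + of_int b) / (of_int c * \<tau> + of_int d) \<in> uhp"
    unfolding uhp_def mem_Collect_eq im using y nz by simp
qed

text \<open>As a function of \<open>z\<close>, the transformed theta function times a Gaussian
  factor has the quasi-periods of \<open>jtheta \<tau>\<close>, so it is a multiple of it. The
  Gaussian factor has value 1 and derivative 0 at the origin, so the derivatives there give the
  multiple as a quotient of cubes of \<eta>.\<close>

theorem jtheta_modular:
  assumes \<tau>: "\<tau> \<in> uhp" and det: "a * d - b * c = (1 :: int)"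
  defines "j \<equiv> of_int c * \<tau> + of_int d" and "\<tau>' \<equiv> (of_int a * \<tau> + of_int b) / (of_int c * \<tau> + of_int d)"
  shows "jtheta \<tau>' (z / j) * eta_pow 3 \<tau> * j =
    eta_pow 3 \<tau>' * ee (of_int c * z\<^sup>2 / (2 * j)) * jtheta \<tau> z"
proof -
  have j: "j \<noteq> 0" and \<tau>': "\<tau>' \<in> uhp" and inv: "1 / j = of_int a - of_int c * \<tau>'" "\<tau> / j = of_int d * \<tau>' - of_int b"
    using moebius_uhp[OF \<tau> det] by (auto simp: j_def \<tau>'_def)
  define f where "f = (\<lambda>z. jtheta \<tau>' (z / j) * ee (- (of_int c * z\<^sup>2 / (2 * j))))"
  \<comment> \<open>Determinant 1 excludes a column with two even entries. In the remaining cases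
    \<open>a + c + a c\<close> and \<open>b + d + b d\<close> are odd, so the collected signs are
    exactly -1.\<close>
  have odd: "odd a \<or> odd c" "odd b \<or> odd d"
  proof -
    have "odd (a * d - b * c)" using det by simp
    then show "odd a \<or> odd c" "odd b \<or> odd d" by auto
  qed
  have f1: "f (z + 1) = - f z" for z
  proof -
    have "(z + 1) / j = z / j + of_int (- c) * \<tau>' + of_int a"
      using inv by (simp add: add_divide_distrib)
    then have "f (z + 1) = altsign (- c + a) * ee (- ((of_int (- c))\<^sup>2 * \<tau>' + 2 * of_int (- c) * (z / j)) / 2)
        * jtheta \<tau>' (z / j) * ee (- (of_int c * (z + 1)\<^sup>2 / (2 * j)))"
      unfolding f_def using jtheta_shift[OF \<tau>', of "z / j" "- c" a] by simp
    also have "\<dots> = altsign (- c + a) * (ee (- ((of_int (- c))\<^sup>2 * \<tau>' + 2 * of_int (- c) * (z / j)) / 2) *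
        ee (- (of_int c * (z + 1)\<^sup>2 / (2 * j)))) * jtheta \<tau>' (z / j)"
      by (simp only: mult_ac)
    also have "ee (- ((of_int (- c))\<^sup>2 * \<tau>' + 2 * of_int (- c) * (z / j)) / 2) * ee (- (of_int c * (z + 1)\<^sup>2 / (2 * j))) =
        ee (- (of_int c * z\<^sup>2 / (2 * j))) * altsign (- (a * c))"
    proof -
      have "- ((of_int (- c))\<^sup>2 * \<tau>' + 2 * of_int (- c) * (z / j)) / 2 + - (of_int c * (z + 1)\<^sup>2 / (2 * j)) =
          - (of_int c * z\<^sup>2 / (2 * j)) - of_int c / 2 * (of_int c * \<tau>' + 1 / j)"
        using j by (simp add: field_simps power2_eq_square)
      also have "of_int c * \<tau>' + 1 / j = of_int a" using inv(1) by simp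
      finally have "- ((of_int (- c))\<^sup>2 * \<tau>' + 2 * of_int (- c) * (z / j)) / 2 + - (of_int c * (z + 1)\<^sup>2 / (2 * j)) =
          - (of_int c * z\<^sup>2 / (2 * j)) + of_int (- (a * c)) / 2" by simp
      then show ?thesis by (simp only: ee_add[symmetric] ee_half_int[symmetric])
    qed
    also have "altsign (- c + a) * (ee (- (of_int c * z\<^sup>2 / (2 * j))) * altsign (- (a * c))) * jtheta \<tau>' (z / j) = - f z"
    proof -
      have "altsign (- c + a) * altsign (- (a * c)) = -1" using odd(1) by (auto simp: altsign_def)
      moreover have "A * (E * B) * J = A * B * (J * E)" for A B E J :: complex by simp
      ultimately show ?thesis unfolding f_def by (simp only: mult_minus_left mult_1_left)
    qed
    finally show ?thesis .
  qed
  have f\<tau>: "f (z + \<tau>) = - ee (- \<tau> / 2 - z) * f z" for z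
  proof -
    have "(z + \<tau>) / j = z / j + of_int d * \<tau>' + of_int (- b)"
      using inv by (simp add: add_divide_distrib)
    then have "f (z + \<tau>) = altsign (d + - b) * ee (- ((of_int d)\<^sup>2 * \<tau>' + 2 * of_int d * (z / j)) / 2)
        * jtheta \<tau>' (z / j) * ee (- (of_int c * (z + \<tau>)\<^sup>2 / (2 * j)))"
      unfolding f_def using jtheta_shift[OF \<tau>', of "z / j" d "- b"] by simp
    also have "\<dots> = altsign (d + - b) * (ee (- ((of_int d)\<^sup>2 * \<tau>' + 2 * of_int d * (z / j)) / 2) *
        ee (- (of_int c * (z + \<tau>)\<^sup>2 / (2 * j)))) * jtheta \<tau>' (z / j)"
      by (simp only: mult_ac)
    also have "ee (- ((of_int d)\<^sup>2 * \<tau>' + 2 * of_int d * (z / j)) / 2) * ee (- (of_int c * (z + \<tau>)\<^sup>2 / (2 * j))) =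
        ee (- (of_int c * z\<^sup>2 / (2 * j))) * ee (- \<tau> / 2 - z) * altsign (- (b * d))"
    proof -
      have cd: "(of_int d + of_int c * \<tau>) / j = 1" using j by (simp add: j_def add.commute)
      have "- ((of_int d)\<^sup>2 * \<tau>' + 2 * of_int d * (z / j)) / 2 + - (of_int c * (z + \<tau>)\<^sup>2 / (2 * j)) =
          - (of_int c * z\<^sup>2 / (2 * j)) - z * ((of_int d + of_int c * \<tau>) / j)
           - (of_int d * (of_int d * \<tau>') + \<tau> * ((of_int d + of_int c * \<tau>) / j) - of_int d * (\<tau> / j)) / 2"
        using j by (simp add: field_simps power2_eq_square)
      also have "\<dots> = - (of_int c * z\<^sup>2 / (2 * j)) + (- \<tau> / 2 - z) + of_int (- (b * d)) / 2"
        unfolding cd inv(2) by (simp add: field_simps)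
      finally show ?thesis by (simp only: ee_add[symmetric] ee_half_int[symmetric])
    qed
    also have "altsign (d + - b) * (ee (- (of_int c * z\<^sup>2 / (2 * j))) * ee (- \<tau> / 2 - z) * altsign (- (b * d))) * jtheta \<tau>' (z / j)
        = - ee (- \<tau> / 2 - z) * f z"
    proof -
      have "altsign (d + - b) * altsign (- (b * d)) = -1" using odd(2) by (auto simp: altsign_def)
      moreover have "A * (E * F * B) * J = A * B * (F * (J * E))" for A B E F J :: complex by simp
      ultimately show ?thesis unfolding f_def by (simp only: mult_minus_left mult_1_left)
    qed
    finally show ?thesis .
  qed
  have hol: "jtheta \<tau>' holomorphic_on UNIV" by (rule holomorphic2_snd[OF holomorphic2_jtheta \<tau>'])
  have "f holomorphic_on UNIV"
    unfolding f_def using j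
    by (intro holomorphic_intros holomorphic_on_compose_gen[OF _ hol, unfolded o_def]) auto
  then obtain \<kappa> where \<kappa>: "\<And>z. f z = \<kappa> * jtheta \<tau> z"
    using jtheta_1dim[OF \<tau> _ f1 f\<tau>] by blast
  have dj: "((\<lambda>z. jtheta \<tau>' (z / j)) has_field_derivative 2 * of_real pi * \<i> * eta_pow 3 \<tau>' * (1 / j)) (at 0)"
  proof (rule DERIV_chain2[where g="\<lambda>z. z / j"])
    show "(jtheta \<tau>' has_field_derivative 2 * of_real pi * \<i> * eta_pow 3 \<tau>') (at (0 / j))"
      using jtheta_deriv_0[OF \<tau>'] by simp
    show "((\<lambda>z. z / j) has_field_derivative 1 / j) (at 0)"
      using j by (auto intro!: derivative_eq_intros)
  qed
  have de: "((\<lambda>z. ee (- (of_int c * z\<^sup>2 / (2 * j)))) has_field_derivative 0) (at 0)"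
    unfolding ee_def using j by (auto intro!: derivative_eq_intros)
  have "(f has_field_derivative 2 * of_real pi * \<i> * eta_pow 3 \<tau>' * (1 / j)) (at 0)"
    unfolding f_def using DERIV_mult[OF dj de] by simp
  moreover have "(f has_field_derivative \<kappa> * (2 * of_real pi * \<i> * eta_pow 3 \<tau>)) (at 0)"
  proof -
    have "f = (\<lambda>z. \<kappa> * jtheta \<tau> z)" using \<kappa> by (rule ext)
    then show ?thesis using DERIV_cmult[OF jtheta_deriv_0[OF \<tau>], of \<kappa>] by simp
  qed
  ultimately have "2 * of_real pi * \<i> * eta_pow 3 \<tau>' * (1 / j) = \<kappa> * (2 * of_real pi * \<i> * eta_pow 3 \<tau>)"
    by (rule DERIV_unique)
  then have "eta_pow 3 \<tau>' = \<kappa> * eta_pow 3 \<tau> * j"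
    using j by (simp add: field_simps)
  moreover have "jtheta \<tau>' (z / j) = \<kappa> * jtheta \<tau> z * ee (of_int c * z\<^sup>2 / (2 * j))"
    using \<kappa>[of z] by (simp add: f_def ee_minus field_simps)
  ultimately show ?thesis by simp
qed

section \<open>A uniform description of weakly holomorphic Jacobi forms\<close>

lemma holomorphic2_cong:
  assumes "\<And>\<tau> z. \<tau> \<in> uhp \<Longrightarrow> f \<tau> z = g \<tau> z"
  shows "holomorphic2 f \<longleftrightarrow> holomorphic2 g"
proof -
  have *: "holomorphic2 g" if f: "holomorphic2 f" and fg: "\<And>\<tau> z. \<tau> \<in> uhp \<Longrightarrow> f \<tau> z = g \<tau> z" for f g
    unfolding holomorphic2_def
  proof (intro ballI allI)
    fix \<tau> z assume \<tau>: "\<tau> \<in> uhp"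
    then obtain A B where "((\<lambda>p. f (fst p) (snd p)) has_derivative (\<lambda>p. A * fst p + B * snd p)) (at (\<tau>, z))"
      using f unfolding holomorphic2_def by blast
    then have "((\<lambda>p. g (fst p) (snd p)) has_derivative (\<lambda>p. A * fst p + B * snd p)) (at (\<tau>, z))"
      by (rule has_derivative_transform_within_open[where s="uhp \<times> UNIV"])
         (use \<tau> fg in \<open>auto intro!: open_Times open_uhp\<close>)
    then show "\<exists>A B. ((\<lambda>p. g (fst p) (snd p)) has_derivative (\<lambda>p. A * fst p + B * snd p)) (at (\<tau>, z))"
      by blast
  qed
  show ?thesis using *[of f g] *[of g f] assms by metis
qed

lemma holomorphic2_mult:
  assumes "holomorphic2 f" "holomorphic2 g"
  shows "holomorphic2 (\<lambda>\<tau> z. f \<tau> z * g \<tau> z)"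
  unfolding holomorphic2_def
proof (intro ballI allI)
  fix \<tau> z assume \<tau>: "\<tau> \<in> uhp"
  obtain A B where 1: "((\<lambda>p. f (fst p) (snd p)) has_derivative (\<lambda>p. A * fst p + B * snd p)) (at (\<tau>, z))"
    using assms(1) \<tau> unfolding holomorphic2_def by blast
  obtain A' B' where 2: "((\<lambda>p. g (fst p) (snd p)) has_derivative (\<lambda>p. A' * fst p + B' * snd p)) (at (\<tau>, z))"
    using assms(2) \<tau> unfolding holomorphic2_def by blast
  have "((\<lambda>p. f (fst p) (snd p) * g (fst p) (snd p)) has_derivative
      (\<lambda>p. (f \<tau> z * A' + A * g \<tau> z) * fst p + (f \<tau> z * B' + B * g \<tau> z) * snd p)) (at (\<tau>, z))"
    by (rule has_derivative_eq_rhs[OF has_derivative_mult[OF 1 2]]) (simp add: fun_eq_iff algebra_simps)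
  then show "\<exists>A B. ((\<lambda>p. f (fst p) (snd p) * g (fst p) (snd p)) has_derivative (\<lambda>p. A * fst p + B * snd p)) (at (\<tau>, z))"
    by blast
qed

lemma holomorphic2_compose:
  assumes "F holomorphic_on S" "open S" "holomorphic2 L" "\<And>\<tau> z. \<tau> \<in> uhp \<Longrightarrow> L \<tau> z \<in> S"
  shows "holomorphic2 (\<lambda>\<tau> z. F (L \<tau> z))"
  unfolding holomorphic2_def
proof (intro ballI allI)
  fix \<tau> z assume \<tau>: "\<tau> \<in> uhp"
  obtain A B where L: "((\<lambda>p. L (fst p) (snd p)) has_derivative (\<lambda>p. A * fst p + B * snd p)) (at (\<tau>, z))"
    using assms(3) \<tau> unfolding holomorphic2_def by blast
  obtain D where "(F has_field_derivative D) (at (L \<tau> z))"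
    using assms \<tau> by (meson holomorphic_on_open)
  then have "((\<lambda>p. F (L (fst p) (snd p))) has_derivative (\<lambda>p. D * (A * fst p + B * snd p))) (at (\<tau>, z))"
    using has_derivative_compose[OF L, of F "\<lambda>h. D * h"] by (simp add: has_field_derivative_def)
  then show "\<exists>A B. ((\<lambda>p. F (L (fst p) (snd p))) has_derivative (\<lambda>p. A * fst p + B * snd p)) (at (\<tau>, z))"
    by (intro exI[of _ "D * A"] exI[of _ "D * B"]) (simp add: algebra_simps)
qed

lemma holomorphic2_linear: "holomorphic2 (\<lambda>\<tau> z. a * \<tau> + b * z)"
  unfolding holomorphic2_def by (intro ballI allI exI) (auto intro!: derivative_eq_intros)

lemma holomorphic2_of_fst: "F holomorphic_on uhp \<Longrightarrow> holomorphic2 (\<lambda>\<tau> z. F \<tau>)"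
  using holomorphic2_compose[OF _ open_uhp holomorphic2_linear[of 1 0]] by simp

lemma holomorphic2_ee: "holomorphic2 L \<Longrightarrow> holomorphic2 (\<lambda>\<tau> z. ee (L \<tau> z))"
  by (rule holomorphic2_compose[where S=UNIV and F=ee]) (auto intro!: holomorphic_intros)

lemma holomorphic2_scale:
  assumes "holomorphic2 f"
  shows "holomorphic2 (\<lambda>\<tau> z. f \<tau> (c * z))"
  unfolding holomorphic2_def
proof (intro ballI allI)
  fix \<tau> z assume \<tau>: "\<tau> \<in> uhp"
  obtain A B where 1: "((\<lambda>p. f (fst p) (snd p)) has_derivative (\<lambda>p. A * fst p + B * snd p)) (at (\<tau>, c * z))"
    using assms(1) \<tau> unfolding holomorphic2_def by blast
  have "((\<lambda>p. (fst p, c * snd p)) has_derivative (\<lambda>p. (fst p, c * snd p))) (at (\<tau>, z))"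
    by (intro derivative_intros)
  from has_derivative_compose[OF this, of "\<lambda>p. f (fst p) (snd p)" "\<lambda>p. A * fst p + B * snd p"] 1
  have "((\<lambda>p. f (fst p) (c * snd p)) has_derivative (\<lambda>p. A * fst p + B * (c * snd p))) (at (\<tau>, z))"
    by simp
  then show "\<exists>A B. ((\<lambda>p. f (fst p) (c * snd p)) has_derivative (\<lambda>p. A * fst p + B * snd p)) (at (\<tau>, z))"
    by (intro exI[of _ A] exI[of _ "B * c"]) (simp add: mult_ac)
qed

text \<open>
  Growth on the single line \<open>Im z = 1\<close> already forces a Fourier expansion that is bounded below
  in \<open>n\<close>. Unlike the expansion itself, this condition is visibly stable under division by the theta
  function, which has no zeros on this line for large \<open>Im \<tau>\<close>.
\<close>

definition moderate_growth :: "real \<Rightarrow> (complex \<Rightarrow> complex \<Rightarrow> complex) \<Rightarrow> bool" where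
  "moderate_growth y f \<longleftrightarrow> (\<exists>C K v0. C \<ge> 0 \<and> v0 > 0 \<and>
     (\<forall>\<tau> z. Im \<tau> \<ge> v0 \<longrightarrow> Im z = y \<longrightarrow> norm (f \<tau> z) \<le> C * exp (K * Im \<tau>)))"

lemma moderate_growthI:
  assumes "\<And>\<tau> z. Im \<tau> \<ge> v0 \<Longrightarrow> Im z = y \<Longrightarrow> norm (f \<tau> z) \<le> C * exp (K * Im \<tau>)"
  shows "moderate_growth y f"
  unfolding moderate_growth_def
proof (intro exI conjI allI impI)
  fix \<tau> z assume "Im \<tau> \<ge> max v0 1" "Im z = y"
  then have "norm (f \<tau> z) \<le> C * exp (K * Im \<tau>)" using assms by auto
  also have "\<dots> \<le> \<bar>C\<bar> * exp (K * Im \<tau>)" by (intro mult_right_mono) auto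
  finally show "norm (f \<tau> z) \<le> \<bar>C\<bar> * exp (K * Im \<tau>)" .
qed auto

lemma moderate_growth_mult:
  assumes "moderate_growth y f" "moderate_growth y g"
  shows "moderate_growth y (\<lambda>\<tau> z. f \<tau> z * g \<tau> z)"
proof -
  obtain C K v0 where f: "C \<ge> 0" "\<And>\<tau> z. Im \<tau> \<ge> v0 \<Longrightarrow> Im z = y \<Longrightarrow> norm (f \<tau> z) \<le> C * exp (K * Im \<tau>)"
    using assms(1) unfolding moderate_growth_def by blast
  obtain C' K' v0' where g: "C' \<ge> 0" "\<And>\<tau> z. Im \<tau> \<ge> v0' \<Longrightarrow> Im z = y \<Longrightarrow> norm (g \<tau> z) \<le> C' * exp (K' * Im \<tau>)"
    using assms(2) unfolding moderate_growth_def by blast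
  show ?thesis
  proof (rule moderate_growthI)
    fix \<tau> z assume "Im \<tau> \<ge> max v0 v0'" "Im z = y"
    then have "norm (f \<tau> z) * norm (g \<tau> z) \<le> (C * exp (K * Im \<tau>)) * (C' * exp (K' * Im \<tau>))"
      using f g by (intro mult_mono) auto
    then show "norm (f \<tau> z * g \<tau> z) \<le> C * C' * exp ((K + K') * Im \<tau>)"
      by (simp add: norm_mult ring_distribs exp_add mult_ac)
  qed
qed

lemma moderate_growth_cong:
  assumes "\<And>\<tau> z. \<tau> \<in> uhp \<Longrightarrow> f \<tau> z = g \<tau> z"
  shows "moderate_growth y f \<longleftrightarrow> moderate_growth y g"
proof -
  have "f \<tau> z = g \<tau> z" if "v0 > 0" "Im \<tau> \<ge> v0" for v0 \<tau> z
    using assms that by (auto simp: uhp_def)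
  then show ?thesis unfolding moderate_growth_def by (metis (no_types, lifting))
qed

lemma moderate_growth_ee: "moderate_growth y (\<lambda>\<tau> z. ee (of_real a * \<tau> + of_real b * z))"
proof (rule moderate_growthI)
  fix \<tau> z assume "Im z = y"
  then show "norm (ee (of_real a * \<tau> + of_real b * z)) \<le> exp (- 2 * pi * b * y) * exp ((- 2 * pi * a) * Im \<tau>)"
    by (simp add: norm_ee exp_add[symmetric] algebra_simps)
qed

lemma moderate_growth_eta_pow: "moderate_growth y (\<lambda>\<tau> z. eta_pow h \<tau>)"
proof -
  obtain C where "\<And>\<tau>. Im \<tau> \<ge> 1 \<Longrightarrow> norm (eta_pow h \<tau>) \<le> C * exp (\<bar>of_rat h\<bar> * Im \<tau>)"
    using eta_pow_bound by metis
  then show ?thesis by (rule moderate_growthI)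
qed

theorem fourier_expansion_of_growth:
  assumes "holomorphic2 F"
    and F1: "\<And>\<tau> z. \<tau> \<in> uhp \<Longrightarrow> F (\<tau> + 1) z = ee (of_real \<alpha>) * F \<tau> z"
    and F2: "\<And>\<tau> z. \<tau> \<in> uhp \<Longrightarrow> F \<tau> (z + 1) = ee (of_real \<beta>) * F \<tau> z"
    and "moderate_growth y F"
  obtains c :: "int \<Rightarrow> int \<Rightarrow> complex" and n0 where "\<And>n r. n < n0 \<Longrightarrow> c n r = 0"
    "\<And>\<tau> z. \<tau> \<in> uhp \<Longrightarrow> ((\<lambda>(n, r). c n r * ee ((of_int n + of_real \<alpha>) * \<tau>) * ee ((of_int r + of_real \<beta>) * z)) has_sum F \<tau> z) UNIV"
proof -
  \<comment> \<open>Multiplication by \<open>E\<close> removes the multipliers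
    \<open>ee \<alpha>\<close> and \<open>ee \<beta>\<close> and leaves a function with period 1 in
    both variables; the inverse factor is put back into the terms of its expansion.\<close>
  define E where "E = (\<lambda>\<tau> z. ee (of_real (- \<alpha>) * \<tau> + of_real (- \<beta>) * z))"
  define f where "f = (\<lambda>\<tau> z. E \<tau> z * F \<tau> z)"
  have "holomorphic2 f"
    unfolding f_def E_def by (intro holomorphic2_mult holomorphic2_ee holomorphic2_linear assms)
  have "moderate_growth y f"
    unfolding f_def E_def by (intro moderate_growth_mult moderate_growth_ee assms)
  then obtain C K v0 where g: "C \<ge> 0" "v0 > 0" "\<And>\<tau> z. Im \<tau> \<ge> v0 \<Longrightarrow> Im z = y \<Longrightarrow> norm (f \<tau> z) \<le> C * exp (K * Im \<tau>)"
    unfolding moderate_growth_def by blast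
  \<comment> \<open>The largest integer for which growth at rate \<open>K\<close> is dominated by
    \<open>q^n0\<close>.\<close>
  define n0 where "n0 = \<lfloor>- K / (2 * pi)\<rfloor>"
  have n0: "K \<le> - 2 * pi * of_int n0"
  proof -
    have "2 * pi * of_int n0 \<le> 2 * pi * (- K / (2 * pi))"
      unfolding n0_def by (intro mult_left_mono of_int_floor_le) auto
    then show ?thesis by simp
  qed
  have E1: "E (\<tau> + 1) z * ee (of_real \<alpha>) = E \<tau> z" for \<tau> z
    unfolding E_def ee_add[symmetric] by (rule arg_cong[where f=ee]) (simp add: algebra_simps)
  have E2: "E \<tau> (z + 1) * ee (of_real \<beta>) = E \<tau> z" for \<tau> z
    unfolding E_def ee_add[symmetric] by (rule arg_cong[where f=ee]) (simp add: algebra_simps)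
  obtain c where c: "\<And>n r. n < n0 \<Longrightarrow> c n r = 0"
    "\<And>\<tau> z. \<tau> \<in> uhp \<Longrightarrow> ((\<lambda>(n, r). c n r * ee (of_int n * \<tau>) * ee (of_int r * z)) has_sum f \<tau> z) UNIV"
  proof (rule fourier2_expansion_exists[OF \<open>holomorphic2 f\<close> _ _ _ \<open>v0 > 0\<close>])
    show "f (\<tau> + 1) z = f \<tau> z" if "\<tau> \<in> uhp" for \<tau> z
      using F1[OF that, of z] E1[of \<tau> z] by (simp add: f_def mult.assoc[symmetric])
    show "f \<tau> (z + 1) = f \<tau> z" if "\<tau> \<in> uhp" for \<tau> z
      using F2[OF that, of z] E2[of \<tau> z] by (simp add: f_def mult.assoc[symmetric])
    fix \<tau> z assume *: "Im \<tau> \<ge> v0" "Im z = y"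
    have "K * Im \<tau> \<le> - 2 * pi * of_int n0 * Im \<tau>"
      using n0 * g(2) by (intro mult_right_mono) auto
    then have "C * exp (K * Im \<tau>) \<le> C * exp (- 2 * pi * of_int n0 * Im \<tau>)"
      using g(1) by (intro mult_left_mono) auto
    with g(3)[OF *] show "norm (f \<tau> z) \<le> C * exp (- 2 * pi * of_int n0 * Im \<tau>)" by linarith
  qed blast
  have "((\<lambda>(n, r). c n r * ee ((of_int n + of_real \<alpha>) * \<tau>) * ee ((of_int r + of_real \<beta>) * z)) has_sum F \<tau> z) UNIV"
    if "\<tau> \<in> uhp" for \<tau> z
  proof -
    define E' where "E' = ee (of_real \<alpha> * \<tau> + of_real \<beta> * z)"
    have "E' * E \<tau> z = 1"
      unfolding E'_def E_def ee_add[symmetric] by simp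
    then have "E' * f \<tau> z = F \<tau> z" by (simp add: f_def mult.assoc[symmetric])
    moreover have "E' * (case p of (n, r) \<Rightarrow> c n r * ee (of_int n * \<tau>) * ee (of_int r * z)) =
        (case p of (n, r) \<Rightarrow> c n r * ee ((of_int n + of_real \<alpha>) * \<tau>) * ee ((of_int r + of_real \<beta>) * z))" for p
      by (cases p) (simp add: E'_def ring_distribs ee_add mult_ac)
    ultimately show ?thesis
      using has_sum_cmult_right[OF c(2)[OF that, of z], of E'] by simp
  qed
  with c(1) show ?thesis by (rule that)
qed

text \<open>Comparison with the absolutely convergent series at the reference point
  \<open>\<tau> = i\<close>, \<open>z = i y\<close>: from there to larger \<open>Im \<tau>\<close>
  every term changes by at most the factor that belongs to \<open>n0\<close>.\<close>

lemma moderate_growth_of_expansion: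
  assumes c: "\<And>n r. n < n0 \<Longrightarrow> c n r = 0"
    and F: "\<And>\<tau> z. \<tau> \<in> uhp \<Longrightarrow> ((\<lambda>(n, r). c n r * ee (of_int n * \<tau>) * ee ((of_int r + of_real \<beta>) * z)) has_sum F \<tau> z) UNIV"
  shows "moderate_growth y F"
proof -
  define T where "T = (\<lambda>\<tau> z p. case p of (n, r) \<Rightarrow> c n r * ee (of_int n * \<tau>) * ee ((of_int r + of_real \<beta>) * z))"
  have T: "(T \<tau> z has_sum F \<tau> z) UNIV" if "\<tau> \<in> uhp" for \<tau> z
    using F[OF that] by (simp add: T_def)
  have "(\<lambda>p. norm (T \<i> (\<i> * of_real y) p)) summable_on UNIV"
    using has_sum_imp_summable[OF T[of \<i>]] summable_on_iff_abs_summable_on_complex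
    by (auto simp: uhp_def)
  then obtain S where S: "((\<lambda>p. norm (T \<i> (\<i> * of_real y) p)) has_sum S) UNIV"
    using has_sum_infsum by blast
  show ?thesis
  proof (rule moderate_growthI)
    fix \<tau> z assume *: "Im \<tau> \<ge> 1" "Im z = y"
    have "norm (F \<tau> z) \<le> exp (- 2 * pi * of_int n0 * (Im \<tau> - 1)) * S"
    proof (rule norm_infsum_le[OF T has_sum_cmult_right[OF S]])
      show "\<tau> \<in> uhp" using * by (simp add: uhp_def)
      fix p :: "int \<times> int"
      obtain n r where p: "p = (n, r)" by fastforce
      show "norm (T \<tau> z p) \<le> exp (- 2 * pi * of_int n0 * (Im \<tau> - 1)) * norm (T \<i> (\<i> * of_real y) p)"
      proof (cases "n < n0")
        case False
        have "norm (T \<tau> z p) = norm (c n r) * exp (- 2 * pi * of_int n * Im \<tau>) * exp (- 2 * pi * (of_int r + \<beta>) * y)"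
          using * by (simp add: T_def p norm_mult norm_ee mult.assoc)
        also have "\<dots> = exp (- 2 * pi * of_int n * (Im \<tau> - 1)) * (norm (c n r) * exp (- 2 * pi * of_int n) * exp (- 2 * pi * (of_int r + \<beta>) * y))"
        proof -
          have "exp (- 2 * pi * of_int n * Im \<tau>) = exp (- 2 * pi * of_int n * (Im \<tau> - 1)) * exp (- 2 * pi * of_int n)"
            by (simp add: exp_add[symmetric] algebra_simps)
          then show ?thesis by simp
        qed
        also have "norm (c n r) * exp (- 2 * pi * of_int n) * exp (- 2 * pi * (of_int r + \<beta>) * y) = norm (T \<i> (\<i> * of_real y) p)"
          by (simp add: T_def p norm_mult norm_ee mult.assoc)
        also have "exp (- 2 * pi * of_int n * (Im \<tau> - 1)) * norm (T \<i> (\<i> * of_real y) p) \<le>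
            exp (- 2 * pi * of_int n0 * (Im \<tau> - 1)) * norm (T \<i> (\<i> * of_real y) p)"
          using False * by (intro mult_right_mono) (auto intro!: mult_right_mono)
        finally show ?thesis .
      qed (simp add: T_def p c)
    qed
    also have "\<dots> = (exp (2 * pi * of_int n0) * S) * exp ((- 2 * pi * of_int n0) * Im \<tau>)"
      by (simp add: exp_add[symmetric] exp_diff[symmetric] exp_minus[symmetric] algebra_simps)
    finally show "norm (F \<tau> z) \<le> (exp (2 * pi * of_int n0) * S) * exp ((- 2 * pi * of_int n0) * Im \<tau>)" .
  qed
qed

text \<open>\<open>M\<close> is twice the index. The sign \<open>altsign (M * (l + \<mu>))\<close>
  is the one that theta has for \<open>M = 1\<close>, and it is trivial for even \<open>M\<close>.
  All factors are multiplicative in \<open>k\<close> and \<open>M\<close> together, so these laws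
  are closed under products for integral and half-integral index alike.\<close>

definition jacobi_like :: "int \<Rightarrow> int \<Rightarrow> (complex \<Rightarrow> complex \<Rightarrow> complex) \<Rightarrow> bool" where
  "jacobi_like k M g \<longleftrightarrow> holomorphic2 g \<and>
     (\<forall>a b c d :: int. a * d - b * c = 1 \<longrightarrow>
        (\<forall>\<tau>\<in>uhp. \<forall>z.
           g ((of_int a * \<tau> + of_int b) / (of_int c * \<tau> + of_int d)) (z / (of_int c * \<tau> + of_int d)) =
           (of_int c * \<tau> + of_int d) powi k
             * ee (of_int M * (of_int c * z\<^sup>2 / (2 * (of_int c * \<tau> + of_int d)))) * g \<tau> z)) \<and>
     (\<forall>l \<mu> :: int. \<forall>\<tau>\<in>uhp. \<forall>z.
        g \<tau> (z + of_int l * \<tau> + of_int \<mu>) =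
        altsign (M * (l + \<mu>)) * ee (of_int M * (- ((of_int l)\<^sup>2 * \<tau> + 2 * of_int l * z) / 2)) * g \<tau> z) \<and>
     moderate_growth 1 g"

lemma jacobi_likeD:
  assumes "jacobi_like k M g"
  shows "holomorphic2 g"
    and "a * d - b * c = (1::int) \<Longrightarrow> \<tau> \<in> uhp \<Longrightarrow>
      g ((of_int a * \<tau> + of_int b) / (of_int c * \<tau> + of_int d)) (z / (of_int c * \<tau> + of_int d)) =
           (of_int c * \<tau> + of_int d) powi k
             * ee (of_int M * (of_int c * z\<^sup>2 / (2 * (of_int c * \<tau> + of_int d)))) * g \<tau> z"
    and "\<tau> \<in> uhp \<Longrightarrow> g \<tau> (z + of_int l * \<tau> + of_int \<mu>) =
        altsign (M * (l + \<mu>)) * ee (of_int M * (- ((of_int l)\<^sup>2 * \<tau> + 2 * of_int l * z) / 2)) * g \<tau> z"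
    and "moderate_growth 1 g"
  using assms unfolding jacobi_like_def by auto

lemma jacobi_like_cong:
  assumes "\<And>\<tau> z. \<tau> \<in> uhp \<Longrightarrow> f \<tau> z = g \<tau> z"
  shows "jacobi_like k M f \<longleftrightarrow> jacobi_like k M g"
proof -
  have *: "jacobi_like k M g" if fg: "\<And>\<tau> z. \<tau> \<in> uhp \<Longrightarrow> f \<tau> z = g \<tau> z" and f: "jacobi_like k M f" for f g
    unfolding jacobi_like_def
  proof (intro conjI allI impI ballI)
    show "holomorphic2 g" "moderate_growth 1 g"
      using f holomorphic2_cong[of f g] moderate_growth_cong[of f g 1] fg jacobi_likeD by metis+
  qed (use jacobi_likeD(2,3)[OF f] fg moebius_uhp(2) in \<open>metis (no_types, lifting)\<close>)+
  show ?thesis using *[of f g] *[of g f] assms by metis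
qed

lemma jacobi_like_mult:
  assumes f: "jacobi_like k M f" and g: "jacobi_like k' M' g"
  shows "jacobi_like (k + k') (M + M') (\<lambda>\<tau> z. f \<tau> z * g \<tau> z)"
  unfolding jacobi_like_def
proof (intro conjI allI impI ballI)
  show "holomorphic2 (\<lambda>\<tau> z. f \<tau> z * g \<tau> z)" "moderate_growth 1 (\<lambda>\<tau> z. f \<tau> z * g \<tau> z)"
    by (intro holomorphic2_mult moderate_growth_mult jacobi_likeD[OF f] jacobi_likeD[OF g])+
  fix \<tau> z assume \<tau>: "\<tau> \<in> uhp"
  {
    fix a b c d :: int assume det: "a * d - b * c = 1"
    have "of_int c * \<tau> + of_int d \<noteq> 0" by (rule moebius_uhp(1)[OF \<tau> det])
    then show "f ((of_int a * \<tau> + of_int b) / (of_int c * \<tau> + of_int d)) (z / (of_int c * \<tau> + of_int d)) *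
        g ((of_int a * \<tau> + of_int b) / (of_int c * \<tau> + of_int d)) (z / (of_int c * \<tau> + of_int d)) =
        (of_int c * \<tau> + of_int d) powi (k + k')
             * ee (of_int (M + M') * (of_int c * z\<^sup>2 / (2 * (of_int c * \<tau> + of_int d)))) * (f \<tau> z * g \<tau> z)"
      unfolding jacobi_likeD(2)[OF f det \<tau>] jacobi_likeD(2)[OF g det \<tau>]
      by (simp only: power_int_add of_int_add ring_distribs ee_add simp_thms if_True mult_ac)
  }
  fix l \<mu> :: int
  show "f \<tau> (z + of_int l * \<tau> + of_int \<mu>) * g \<tau> (z + of_int l * \<tau> + of_int \<mu>) =
        altsign ((M + M') * (l + \<mu>)) * ee (of_int (M + M') * (- ((of_int l)\<^sup>2 * \<tau> + 2 * of_int l * z) / 2)) * (f \<tau> z * g \<tau> z)"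
    unfolding jacobi_likeD(3)[OF f \<tau>] jacobi_likeD(3)[OF g \<tau>] distrib_right[of M M'] altsign_add of_int_add ee_add
      distrib_right[of "of_int M"]
    by (simp only: mult_ac)
qed

section \<open>Multiplication and division by the normalized theta function\<close>

definition normalized_theta :: "complex \<Rightarrow> complex \<Rightarrow> complex" where
  "normalized_theta \<tau> z = eta_pow (- 3) \<tau> * jtheta \<tau> z"

lemma norm_theta_term:
  "norm (theta_term \<tau> z s) = exp (- (pi / 4) * of_int ((2 * s + 1)\<^sup>2) * Im \<tau> - pi * of_int (2 * s + 1) * Im z)"
  unfolding theta_term_def norm_mult norm_ee by (simp add: exp_add[symmetric] field_simps)

lemma theta_term_norm_summable:
  assumes "\<tau> \<in> uhp"
  shows "(\<lambda>s. norm (theta_term \<tau> z s)) summable_on UNIV"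
  using has_sum_imp_summable[OF theta_has_sum[OF assms]] summable_on_iff_abs_summable_on_complex by blast

lemma moderate_growth_jtheta: "moderate_growth 1 jtheta"
proof (rule moderate_growthI)
  fix \<tau> z assume *: "Im \<tau> \<ge> 1" "Im z = 1"
  have u: "\<tau> \<in> uhp" "\<i> \<in> uhp" using * by (auto simp: uhp_def)
  have "norm (jtheta \<tau> z) \<le> infsum (\<lambda>s. norm (theta_term \<i> \<i> s)) UNIV"
  proof (rule norm_infsum_le[OF theta_has_sum[OF u(1)] has_sum_infsum[OF theta_term_norm_summable[OF u(2)]]])
    fix s
    have "pi / 4 * of_int ((2 * s + 1)\<^sup>2) * 1 \<le> pi / 4 * of_int ((2 * s + 1)\<^sup>2) * Im \<tau>"
      using * by (intro mult_left_mono) auto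
    then show "norm (theta_term \<tau> z s) \<le> norm (theta_term \<i> \<i> s)"
      unfolding norm_theta_term using * by simp
  qed
  then show "norm (jtheta \<tau> z) \<le> infsum (\<lambda>s. norm (theta_term \<i> \<i> s)) UNIV * exp (0 * Im \<tau>)" by simp
qed

text \<open>Every term except \<open>s = 0\<close> and \<open>s = -1\<close> carries at least
  \<open>q^(9/8)\<close>, so for large \<open>Im \<tau>\<close> only these two matter. Both have
  \<open>q^(1/8)\<close>, but on the line \<open>Im z = 1\<close> their moduli differ by the factor
  \<open>exp (2 pi)\<close>, so they cannot cancel.\<close>

lemma jtheta_lower_bound:
  obtains v0 where "\<And>\<tau> z. Im \<tau> \<ge> v0 \<Longrightarrow> Im z = 1 \<Longrightarrow> 1 / 2 * exp (- (pi / 4) * Im \<tau>) \<le> norm (jtheta \<tau> z)"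
proof -
  define S where "S = infsum (\<lambda>s. norm (theta_term \<i> \<i> s)) UNIV"
  have i: "\<i> \<in> uhp" by (simp add: uhp_def)
  have "S \<ge> 0" unfolding S_def by (intro infsum_nonneg) auto
  have "((\<lambda>v. exp (pi / 4) * S * exp (- (2 * pi) * (v - 1))) \<longlongrightarrow> 0) at_top"
    by real_asymp
  then have "\<forall>\<^sub>F v in at_top. exp (pi / 4) * S * exp (- (2 * pi) * (v - 1)) < 1 / 2"
    by (rule order_tendstoD) simp
  then obtain v1 where v1: "\<And>v. v \<ge> v1 \<Longrightarrow> exp (pi / 4) * S * exp (- (2 * pi) * (v - 1)) < 1 / 2"
    by (auto simp: eventually_at_top_linorder)
  have "1 / 2 * exp (- (pi / 4) * Im \<tau>) \<le> norm (jtheta \<tau> z)" if *: "Im \<tau> \<ge> max v1 1" "Im z = 1" for \<tau> z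
  proof -
    have u: "\<tau> \<in> uhp" using * by (auto simp: uhp_def)
    define R where "R = jtheta \<tau> z - (theta_term \<tau> z 0 + theta_term \<tau> z (-1))"
    have "(theta_term \<tau> z has_sum R) (UNIV - {0, -1})"
      unfolding R_def using has_sum_finite[of "{0, -1}" "theta_term \<tau> z"]
      by (intro has_sum_Diff theta_has_sum u) auto
    then have "norm R \<le> exp (- (pi / 4) * Im \<tau>) * exp (pi / 4) * exp (- (2 * pi) * (Im \<tau> - 1)) *
        infsum (\<lambda>s. norm (theta_term \<i> \<i> s)) (UNIV - {0, -1})"
    proof (rule norm_infsum_le)
      show "((\<lambda>s. exp (- (pi / 4) * Im \<tau>) * exp (pi / 4) * exp (- (2 * pi) * (Im \<tau> - 1)) * norm (theta_term \<i> \<i> s)) has_sum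
        exp (- (pi / 4) * Im \<tau>) * exp (pi / 4) * exp (- (2 * pi) * (Im \<tau> - 1)) *
        infsum (\<lambda>s. norm (theta_term \<i> \<i> s)) (UNIV - {0, -1})) (UNIV - {0, -1})"
        by (intro has_sum_cmult_right has_sum_infsum summable_on_subset[OF theta_term_norm_summable[OF i]]) auto
      fix s :: int assume "s \<in> UNIV - {0, -1}"
      then have "3 \<le> \<bar>2 * s + 1\<bar>" by auto
      then have "3\<^sup>2 \<le> \<bar>2 * s + 1\<bar>\<^sup>2" by (intro power_mono) auto
      then have "9 \<le> (2 * s + 1)\<^sup>2" by simp
      then have "9 \<le> real_of_int ((2 * s + 1)\<^sup>2)" by linarith
      moreover define N where "N = real_of_int ((2 * s + 1)\<^sup>2)"
      \<comment> \<open>Since \<open>N \<ge> 9\<close>, a remaining term decays at least at rate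
        \<open>9 pi / 4\<close>, against \<open>pi / 4\<close> for the leading ones; the difference
        is the relative rate \<open>2 pi\<close>.\<close>
      ultimately have "0 \<le> (N - 9) * (pi / 4 * (Im \<tau> - 1))"
        using * by (intro mult_nonneg_nonneg) auto
      also have "\<dots> = (- (pi / 4) * Im \<tau> + pi / 4 + - (2 * pi) * (Im \<tau> - 1) +
         (- (pi / 4) * N * Im \<i> - pi * of_int (2 * s + 1) * Im \<i>)) -
         (- (pi / 4) * N * Im \<tau> - pi * of_int (2 * s + 1) * Im z)"
        using *(2) by (simp add: field_simps)
      finally have "- (pi / 4) * of_int ((2 * s + 1)\<^sup>2) * Im \<tau> - pi * of_int (2 * s + 1) * Im z \<le>
        - (pi / 4) * Im \<tau> + pi / 4 + - (2 * pi) * (Im \<tau> - 1) +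
         (- (pi / 4) * of_int ((2 * s + 1)\<^sup>2) * Im \<i> - pi * of_int (2 * s + 1) * Im \<i>)"
        unfolding N_def by linarith
      then show "norm (theta_term \<tau> z s) \<le>
          exp (- (pi / 4) * Im \<tau>) * exp (pi / 4) * exp (- (2 * pi) * (Im \<tau> - 1)) * norm (theta_term \<i> \<i> s)"
        unfolding norm_theta_term exp_add[symmetric] exp_le_cancel_iff .
    qed
    also have "\<dots> \<le> exp (- (pi / 4) * Im \<tau>) * exp (pi / 4) * exp (- (2 * pi) * (Im \<tau> - 1)) * S"
      unfolding S_def
      by (intro mult_left_mono infsum_mono2 theta_term_norm_summable i summable_on_subset[OF theta_term_norm_summable[OF i]]) auto
    also have "\<dots> = exp (- (pi / 4) * Im \<tau>) * (exp (pi / 4) * S * exp (- (2 * pi) * (Im \<tau> - 1)))"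
      by simp
    also have "\<dots> \<le> exp (- (pi / 4) * Im \<tau>) * (1 / 2)"
      using v1[of "Im \<tau>"] * by (intro mult_left_mono) auto
    finally have R: "norm R \<le> exp (- (pi / 4) * Im \<tau>) * (1 / 2)" .
    have "norm (theta_term \<tau> z 0) = exp (- (pi / 4) * Im \<tau>) * exp (- pi)"
      "norm (theta_term \<tau> z (-1)) = exp (- (pi / 4) * Im \<tau>) * exp pi"
      unfolding norm_theta_term using * by (simp_all add: exp_add[symmetric])
    then have "norm (theta_term \<tau> z (-1)) - norm (theta_term \<tau> z 0) = exp (- (pi / 4) * Im \<tau>) * (exp pi - exp (- pi))"
      by (simp add: algebra_simps)
    also have "\<dots> \<ge> exp (- (pi / 4) * Im \<tau>) * 1"
    proof (intro mult_left_mono)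
      have "exp pi \<ge> 1 + pi" by (rule exp_ge_add_one_self)
      moreover have "exp (- pi) \<le> 1" by simp
      ultimately show "1 \<le> exp pi - exp (- pi)" using pi_gt3 by linarith
    qed auto
    finally have "exp (- (pi / 4) * Im \<tau>) \<le> norm (theta_term \<tau> z (-1)) - norm (theta_term \<tau> z 0)" by simp
    moreover have "norm (theta_term \<tau> z (-1)) \<le> norm (jtheta \<tau> z) + norm R + norm (theta_term \<tau> z 0)"
    proof -
      have "theta_term \<tau> z (-1) = jtheta \<tau> z - R - theta_term \<tau> z 0" by (simp add: R_def)
      also have "norm \<dots> \<le> norm (jtheta \<tau> z) + norm R + norm (theta_term \<tau> z 0)"
        by (meson norm_triangle_ineq4 order_trans add_right_mono)
      finally show ?thesis .
    qed
    ultimately show ?thesis using R by linarith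
  qed
  then show ?thesis by (rule that)
qed

text \<open>Theta has a simple zero at 0, so it does not vanish on a punctured disc around 0. There
  \<open>f\<close> and \<open>g\<close> agree, and the identity theorem extends this to all
  \<open>z\<close>.\<close>

lemma jtheta_cancel:
  assumes "\<tau> \<in> uhp" "f holomorphic_on UNIV" "g holomorphic_on UNIV"
    and eq: "\<And>z. jtheta \<tau> z * f z = jtheta \<tau> z * g z"
  shows "f z = g z"
proof -
  have "\<exists>s>0. \<forall>w\<in>ball 0 s. w \<noteq> 0 \<longrightarrow> jtheta \<tau> w \<noteq> 0"
  proof -
    have "deriv (jtheta \<tau>) 0 \<noteq> 0"
      using DERIV_imp_deriv[OF jtheta_deriv_0[OF assms(1)]] eta_pow_nonzero[OF assms(1)] by simp
    then have "\<forall>\<^sub>F w in at 0. jtheta \<tau> w \<noteq> 0"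
    proof -
      have "((\<lambda>w. (jtheta \<tau> w - jtheta \<tau> 0) / (w - 0)) \<longlongrightarrow> 2 * of_real pi * \<i> * eta_pow 3 \<tau>) (at 0)"
        using jtheta_deriv_0[OF assms(1)] unfolding has_field_derivative_iff .
      moreover have "2 * of_real pi * \<i> * eta_pow 3 \<tau> \<noteq> 0"
        using eta_pow_nonzero[OF assms(1)] by simp
      ultimately have "\<forall>\<^sub>F w in at 0. (jtheta \<tau> w - jtheta \<tau> 0) / (w - 0) \<noteq> 0"
        by (rule tendsto_imp_eventually_ne)
      then show ?thesis
        by eventually_elim (auto simp: jtheta_0[OF assms(1)])
    qed
    then show ?thesis by (auto simp: eventually_at dist_commute)
  qed
  then obtain s where s: "s > 0" "\<And>w. w \<in> ball 0 s - {0} \<Longrightarrow> jtheta \<tau> w \<noteq> 0" by auto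
  show ?thesis
  proof (rule analytic_continuation_open[of "ball 0 s - {0}" UNIV f g])
    have "of_real (s / 2) \<in> ball (0::complex) s - {0}" using s(1) by simp
    then show "ball (0::complex) s - {0} \<noteq> {}" by blast
    show "f w = g w" if "w \<in> ball 0 s - {0}" for w
      using eq[of w] s(2)[OF that] by simp
  qed (use assms in \<open>auto simp: open_delete\<close>)
qed

lemma normalized_theta_nonzero_factor:
  assumes "\<tau> \<in> uhp" "f holomorphic_on UNIV" "g holomorphic_on UNIV"
    and eq: "\<And>z. normalized_theta \<tau> z * f z = normalized_theta \<tau> z * g z"
  shows "f z = g z"
  using assms eta_pow_nonzero[OF assms(1)] by (intro jtheta_cancel[OF assms(1-3)]) (auto simp: normalized_theta_def)

lemma jacobi_like_normalized_theta: "jacobi_like (- 1) 1 normalized_theta"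
  unfolding jacobi_like_def
proof (intro conjI allI impI ballI)
  show "holomorphic2 normalized_theta"
    unfolding normalized_theta_def[abs_def]
    by (intro holomorphic2_mult holomorphic2_of_fst eta_pow_holomorphic holomorphic2_jtheta)
  show "moderate_growth 1 normalized_theta"
    unfolding normalized_theta_def[abs_def]
    by (intro moderate_growth_mult moderate_growth_eta_pow moderate_growth_jtheta)
  fix \<tau> z assume \<tau>: "\<tau> \<in> uhp"
  show "normalized_theta \<tau> (z + of_int l * \<tau> + of_int \<mu>) =
      altsign (1 * (l + \<mu>)) * ee (of_int 1 * (- ((of_int l)\<^sup>2 * \<tau> + 2 * of_int l * z) / 2)) * normalized_theta \<tau> z" for l \<mu>
    unfolding normalized_theta_def jtheta_shift[OF \<tau>] by simp
  fix a b c d :: int assume det: "a * d - b * c = 1"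
  define j \<tau>' where "j = of_int c * \<tau> + of_int d" and "\<tau>' = (of_int a * \<tau> + of_int b) / (of_int c * \<tau> + of_int d)"
  have j: "j \<noteq> 0" "\<tau>' \<in> uhp" using moebius_uhp[OF \<tau> det] by (auto simp: j_def \<tau>'_def)
  have inv: "eta_pow (- 3) t = inverse (eta_pow 3 t)" if "t \<in> uhp" for t
    using eta_pow_minus[OF that, of 3] eta_pow_nonzero[OF that, of 3] by (simp add: field_simps)
  have "jtheta \<tau>' (z / j) * eta_pow 3 \<tau> * j = eta_pow 3 \<tau>' * ee (of_int c * z\<^sup>2 / (2 * j)) * jtheta \<tau> z"
    unfolding j_def \<tau>'_def by (rule jtheta_modular[OF \<tau> det])
  then have "normalized_theta \<tau>' (z / j) = inverse j * ee (of_int c * z\<^sup>2 / (2 * j)) * normalized_theta \<tau> z"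
    unfolding normalized_theta_def inv[OF \<tau>] inv[OF j(2)]
    using j(1) eta_pow_nonzero[OF \<tau>, of 3] eta_pow_nonzero[OF j(2), of 3] by (simp add: field_simps)
  then show "normalized_theta ((of_int a * \<tau> + of_int b) / (of_int c * \<tau> + of_int d)) (z / (of_int c * \<tau> + of_int d)) =
     (of_int c * \<tau> + of_int d) powi (- 1) * ee (of_int 1 * (of_int c * z\<^sup>2 / (2 * (of_int c * \<tau> + of_int d)))) * normalized_theta \<tau> z"
    by (simp add: j_def \<tau>'_def power_int_minus)
qed

lemma moderate_growth_divide_theta:
  assumes "moderate_growth 1 (\<lambda>\<tau> z. normalized_theta \<tau> z * g \<tau> z)"
  shows "moderate_growth 1 g"
proof -
  have "moderate_growth 1 (\<lambda>\<tau> z. eta_pow 3 \<tau> * (normalized_theta \<tau> z * g \<tau> z))"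
    by (intro moderate_growth_mult moderate_growth_eta_pow assms)
  then obtain C K v0 where C: "C \<ge> 0" "v0 > 0" "\<And>\<tau> z. Im \<tau> \<ge> v0 \<Longrightarrow> Im z = 1 \<Longrightarrow>
      norm (eta_pow 3 \<tau> * (normalized_theta \<tau> z * g \<tau> z)) \<le> C * exp (K * Im \<tau>)"
    unfolding moderate_growth_def by blast
  obtain v1 where v1: "\<And>\<tau> z. Im \<tau> \<ge> v1 \<Longrightarrow> Im z = 1 \<Longrightarrow> 1 / 2 * exp (- (pi / 4) * Im \<tau>) \<le> norm (jtheta \<tau> z)"
    using jtheta_lower_bound by blast
  show ?thesis
  proof (rule moderate_growthI)
    fix \<tau> z assume *: "Im \<tau> \<ge> max v0 v1" "Im z = 1"
    then have \<tau>: "\<tau> \<in> uhp" using C(2) by (auto simp: uhp_def)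
    have e: "eta_pow 3 \<tau> * eta_pow (- 3) \<tau> = 1"
      using eta_pow_minus[OF \<tau>, of 3] by (simp add: mult.commute)
    have "1 / 2 * exp (- (pi / 4) * Im \<tau>) * norm (g \<tau> z) \<le> norm (jtheta \<tau> z) * norm (g \<tau> z)"
      using v1 * by (intro mult_right_mono) auto
    also have "\<dots> = norm ((eta_pow 3 \<tau> * eta_pow (- 3) \<tau>) * (jtheta \<tau> z * g \<tau> z))"
      unfolding e by (simp add: norm_mult)
    also have "\<dots> = norm (eta_pow 3 \<tau> * (normalized_theta \<tau> z * g \<tau> z))"
      by (simp add: normalized_theta_def mult.assoc)
    also have "\<dots> \<le> C * exp (K * Im \<tau>)" using C(3) * by simp
    finally have "2 * exp (pi / 4 * Im \<tau>) * (1 / 2 * exp (- (pi / 4) * Im \<tau>) * norm (g \<tau> z)) \<le> 2 * exp (pi / 4 * Im \<tau>) * (C * exp (K * Im \<tau>))"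
      by (intro mult_left_mono) auto
    moreover have "2 * exp (pi / 4 * Im \<tau>) * (1 / 2 * exp (- (pi / 4) * Im \<tau>) * norm (g \<tau> z)) = norm (g \<tau> z)"
      by (simp add: exp_minus)
    ultimately show "norm (g \<tau> z) \<le> 2 * C * exp ((K + pi / 4) * Im \<tau>)"
      unfolding distrib_right exp_add by (simp only: mult_ac)
  qed
qed

text \<open>The laws of the product and of theta give each law for \<open>g\<close> with an extra
  factor \<open>normalized_theta\<close>. This factor may vanish at the given point, so it is
  cancelled from an identity between entire functions of \<open>z\<close>.\<close>

lemma jacobi_like_divide_theta:
  assumes g: "holomorphic2 g" and h: "jacobi_like (k - 1) (M + 1) (\<lambda>\<tau> z. normalized_theta \<tau> z * g \<tau> z)"
  shows "jacobi_like k M g"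
  unfolding jacobi_like_def
proof (intro conjI allI impI ballI)
  show "holomorphic2 g" by (rule g)
  show "moderate_growth 1 g" by (rule moderate_growth_divide_theta[OF jacobi_likeD(4)[OF h]])
  note T = jacobi_like_normalized_theta
  fix \<tau> z assume \<tau>: "\<tau> \<in> uhp"
  have g\<tau>: "g t holomorphic_on UNIV" if "t \<in> uhp" for t
    by (rule holomorphic2_snd[OF g that])
  {
    fix l \<mu> :: int
    define A where "A = (\<lambda>z. - ((of_int l)\<^sup>2 * \<tau> + 2 * of_int l * z) / 2)"
    show "g \<tau> (z + of_int l * \<tau> + of_int \<mu>) = altsign (M * (l + \<mu>)) * ee (of_int M * (- ((of_int l)\<^sup>2 * \<tau> + 2 * of_int l * z) / 2)) * g \<tau> z"
    proof (rule normalized_theta_nonzero_factor[OF \<tau>, where z=z])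
      show "(\<lambda>z. g \<tau> (z + of_int l * \<tau> + of_int \<mu>)) holomorphic_on UNIV"
        by (intro holomorphic_on_compose_gen[OF _ g\<tau>[OF \<tau>], unfolded o_def] holomorphic_intros) auto
      show "(\<lambda>z. altsign (M * (l + \<mu>)) * ee (of_int M * (- ((of_int l)\<^sup>2 * \<tau> + 2 * of_int l * z) / 2)) * g \<tau> z) holomorphic_on UNIV"
        by (intro holomorphic_intros g\<tau>[OF \<tau>]) auto
      fix z
      have "altsign (1 * (l + \<mu>)) * ee (of_int 1 * A z) * normalized_theta \<tau> z * g \<tau> (z + of_int l * \<tau> + of_int \<mu>) =
          altsign ((M + 1) * (l + \<mu>)) * ee (of_int (M + 1) * A z) * (normalized_theta \<tau> z * g \<tau> z)"
        using jacobi_likeD(3)[OF h \<tau>, of z l \<mu>] jacobi_likeD(3)[OF T \<tau>, of z l \<mu>] by (simp only: A_def)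
      also have "\<dots> = (altsign (1 * (l + \<mu>)) * ee (of_int 1 * A z)) *
          (normalized_theta \<tau> z * (altsign (M * (l + \<mu>)) * ee (of_int M * A z) * g \<tau> z))"
        unfolding distrib_right altsign_add of_int_add ee_add by (simp only: mult_ac)
      finally have "normalized_theta \<tau> z * g \<tau> (z + of_int l * \<tau> + of_int \<mu>) =
          normalized_theta \<tau> z * (altsign (M * (l + \<mu>)) * ee (of_int M * A z) * g \<tau> z)"
        by (simp add: mult.assoc)
      then show "normalized_theta \<tau> z * g \<tau> (z + of_int l * \<tau> + of_int \<mu>) =
          normalized_theta \<tau> z * (altsign (M * (l + \<mu>)) * ee (of_int M * (- ((of_int l)\<^sup>2 * \<tau> + 2 * of_int l * z) / 2)) * g \<tau> z)"
        by (simp only: A_def)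
    qed
  }
  fix a b c d :: int assume det: "a * d - b * c = 1"
  define j \<tau>' A where "j = of_int c * \<tau> + of_int d" and "\<tau>' = (of_int a * \<tau> + of_int b) / (of_int c * \<tau> + of_int d)"
    and "A = (\<lambda>z. of_int c * z\<^sup>2 / (2 * j))"
  have j: "j \<noteq> 0" "\<tau>' \<in> uhp" using moebius_uhp[OF \<tau> det] by (auto simp: j_def \<tau>'_def)
  have "g \<tau>' (z / j) = j powi k * ee (of_int M * A z) * g \<tau> z"
  proof (rule normalized_theta_nonzero_factor[OF \<tau>, where z=z])
    show "(\<lambda>z. g \<tau>' (z / j)) holomorphic_on UNIV"
      using j by (intro holomorphic_on_compose_gen[OF _ g\<tau>[OF j(2)], unfolded o_def] holomorphic_intros) auto
    show "(\<lambda>z. j powi k * ee (of_int M * A z) * g \<tau> z) holomorphic_on UNIV"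
      unfolding A_def using j by (intro holomorphic_intros g\<tau>[OF \<tau>]) auto
    fix z
    have "j powi (- 1) * ee (of_int 1 * A z) * normalized_theta \<tau> z * g \<tau>' (z / j) =
        j powi (k - 1) * ee (of_int (M + 1) * A z) * (normalized_theta \<tau> z * g \<tau> z)"
      using jacobi_likeD(2)[OF h det \<tau>, of z] jacobi_likeD(2)[OF T det \<tau>, of z] by (simp only: A_def j_def \<tau>'_def)
    also have "\<dots> = j powi (- 1) * ee (of_int 1 * A z) * (normalized_theta \<tau> z * (j powi k * ee (of_int M * A z) * g \<tau> z))"
    proof -
      have "j powi (k - 1) = j powi (- 1) * j powi k"
        using j(1) power_int_add[of j "-1" k] by simp
      then show ?thesis unfolding of_int_add distrib_right ee_add by (simp only: mult_ac)
    qed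
    finally show "normalized_theta \<tau> z * g \<tau>' (z / j) = normalized_theta \<tau> z * (j powi k * ee (of_int M * A z) * g \<tau> z)"
      using j(1) by (simp add: mult.assoc)
  qed
  then show "g ((of_int a * \<tau> + of_int b) / (of_int c * \<tau> + of_int d)) (z / (of_int c * \<tau> + of_int d)) =
     (of_int c * \<tau> + of_int d) powi k * ee (of_int M * (of_int c * z\<^sup>2 / (2 * (of_int c * \<tau> + of_int d)))) * g \<tau> z"
    by (simp only: A_def j_def \<tau>'_def)
qed

lemma jacobi_like_theta_mult_iff:
  assumes "holomorphic2 g"
  shows "jacobi_like (k - 1) (M + 1) (\<lambda>\<tau> z. normalized_theta \<tau> z * g \<tau> z) \<longleftrightarrow> jacobi_like k M g"
  using jacobi_like_divide_theta[OF assms] jacobi_like_mult[OF jacobi_like_normalized_theta, of k M g]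
  by (auto simp: add.commute)

lemma jacobi_like_periods:
  assumes "jacobi_like k M g" "\<tau> \<in> uhp"
  shows "g (\<tau> + 1) z = g \<tau> z" "g \<tau> (z + 1) = altsign M * g \<tau> z"
  using jacobi_likeD(2)[OF assms(1) _ assms(2), of 1 1 1 0 z] jacobi_likeD(3)[OF assms(1,2), of z 0 1] by simp_all

lemma jacobi_like_expansion:
  assumes "jacobi_like k M g"
  obtains c :: "int \<Rightarrow> int \<Rightarrow> complex" and n0 where "\<And>n r. n < n0 \<Longrightarrow> c n r = 0"
    "\<And>\<tau> z. \<tau> \<in> uhp \<Longrightarrow> ((\<lambda>(n, r). c n r * ee (of_int n * \<tau>) * ee ((of_int r + of_real (of_int M / 2)) * z)) has_sum g \<tau> z) UNIV"
proof (rule fourier_expansion_of_growth[where F=g and \<alpha>=0 and \<beta>="of_int M / 2" and y=1])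
  show "g (\<tau> + 1) z = ee (of_real 0) * g \<tau> z" "g \<tau> (z + 1) = ee (of_real (of_int M / 2)) * g \<tau> z" if "\<tau> \<in> uhp" for \<tau> z
    using jacobi_like_periods[OF assms that] ee_half_int[of M] by simp_all
  fix c :: "int \<Rightarrow> int \<Rightarrow> complex" and n0 :: int
  assume "\<And>n r. n < n0 \<Longrightarrow> c n r = 0"
   "\<And>\<tau> z. \<tau> \<in> uhp \<Longrightarrow> ((\<lambda>(n, r). c n r * ee ((of_int n + of_real 0) * \<tau>) * ee ((of_int r + of_real (of_int M / 2)) * z)) has_sum g \<tau> z) UNIV"
  then show thesis using that[of n0 c] by simp
qed (use jacobi_likeD[OF assms] in auto)

text \<open>Through the Fourier expansion the growth condition passes from \<open>Im z = 1\<close>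
  to every other line. The lines \<open>Im z = l\<close> and \<open>Im z = 0\<close> are needed for
  the operators \<open>U_op l\<close> and for index 0.\<close>

lemma jacobi_like_moderate_growth: "jacobi_like k M g \<Longrightarrow> moderate_growth y g"
  by (erule jacobi_like_expansion) (rule moderate_growth_of_expansion)

lemma jacobi_like_scale:
  assumes g: "jacobi_like k M g"
  shows "jacobi_like k (l\<^sup>2 * M) (\<lambda>\<tau> z. g \<tau> (of_int l * z))"
  unfolding jacobi_like_def
proof (intro conjI allI impI ballI)
  show "holomorphic2 (\<lambda>\<tau> z. g \<tau> (of_int l * z))"
    by (rule holomorphic2_scale[OF jacobi_likeD(1)[OF g]])
  show "moderate_growth 1 (\<lambda>\<tau> z. g \<tau> (of_int l * z))"
  proof -
    obtain C K v0 where "\<And>\<tau> z. Im \<tau> \<ge> v0 \<Longrightarrow> Im z = of_int l \<Longrightarrow> norm (g \<tau> z) \<le> C * exp (K * Im \<tau>)"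
      using jacobi_like_moderate_growth[OF g, of "of_int l"] unfolding moderate_growth_def by blast
    then show ?thesis by (intro moderate_growthI[where ?v0.0=v0 and C=C and K=K]) simp
  qed
  fix \<tau> z assume \<tau>: "\<tau> \<in> uhp"
  show "g \<tau> (of_int l * (z + of_int s * \<tau> + of_int \<mu>)) =
      altsign (l\<^sup>2 * M * (s + \<mu>)) * ee (of_int (l\<^sup>2 * M) * (- ((of_int s)\<^sup>2 * \<tau> + 2 * of_int s * z) / 2)) * g \<tau> (of_int l * z)" for s \<mu>
  proof -
    have "of_int l * (z + of_int s * \<tau> + of_int \<mu>) = of_int l * z + of_int (l * s) * \<tau> + of_int (l * \<mu>)"
      by (simp add: algebra_simps)
    \<comment> \<open>An integer \<open>l\<close> and its square have the same parity.\<close>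
    moreover have "altsign (M * (l * s + l * \<mu>)) = altsign (l\<^sup>2 * M * (s + \<mu>))"
      by (auto simp: altsign_def)
    moreover have "of_int M * (- ((of_int (l * s))\<^sup>2 * \<tau> + 2 * of_int (l * s) * (of_int l * z)) / 2) =
        of_int (l\<^sup>2 * M) * (- ((of_int s)\<^sup>2 * \<tau> + 2 * of_int s * z) / 2)"
      by (simp add: power2_eq_square algebra_simps)
    ultimately show ?thesis using jacobi_likeD(3)[OF g \<tau>, of "of_int l * z" "l * s" "l * \<mu>"] by (simp only:)
  qed
  fix a b c d :: int assume det: "a * d - b * c = 1"
  have "of_int M * (of_int c * (of_int l * z)\<^sup>2 / (2 * (of_int c * \<tau> + of_int d))) =
      of_int (l\<^sup>2 * M) * (of_int c * z\<^sup>2 / (2 * (of_int c * \<tau> + of_int d)))"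
    by (simp add: power2_eq_square)
  then show "g ((of_int a * \<tau> + of_int b) / (of_int c * \<tau> + of_int d)) (of_int l * (z / (of_int c * \<tau> + of_int d))) =
     (of_int c * \<tau> + of_int d) powi k * ee (of_int (l\<^sup>2 * M) * (of_int c * z\<^sup>2 / (2 * (of_int c * \<tau> + of_int d)))) * g \<tau> (of_int l * z)"
    using jacobi_likeD(2)[OF g det \<tau>, of "of_int l * z"] by (simp only: times_divide_eq_right)
qed

section \<open>Comparison with the definition of weakly holomorphic Jacobi forms\<close>

lemma wh_jacobi1_iff: "g \<in> wh_jacobi1 k m \<longleftrightarrow> jacobi_like k (2 * m) g"
proof -
  have e1: "ee (of_int m * of_int c * z\<^sup>2 / (of_int c * \<tau> + of_int d)) =
      ee (of_int (2 * m) * (of_int c * z\<^sup>2 / (2 * (of_int c * \<tau> + of_int d))))" for c d \<tau> z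
  proof -
    have "of_int m * of_int c * z\<^sup>2 / J = of_int (2 * m) * (of_int c * z\<^sup>2 / (2 * J))" for J by simp
    then show ?thesis by (simp only:)
  qed
  have e2: "ee (- of_int m * ((of_int l)\<^sup>2 * \<tau> + 2 * of_int l * z)) =
      altsign (2 * m * (l + \<mu>)) * ee (of_int (2 * m) * (- ((of_int l)\<^sup>2 * \<tau> + 2 * of_int l * z) / 2))" for l \<mu> \<tau> z
  proof -
    have "- of_int m * ((of_int l)\<^sup>2 * \<tau> + 2 * of_int l * z) = of_int (2 * m) * (- ((of_int l)\<^sup>2 * \<tau> + 2 * of_int l * z) / 2)"
      by (simp add: algebra_simps)
    then show ?thesis by (simp add: altsign_def)
  qed
  define E where "E \<longleftrightarrow> (\<exists>(n0 :: int) (c :: int \<Rightarrow> int \<Rightarrow> complex).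
        (\<forall>n<n0. \<forall>r. c n r = 0) \<and>
        (\<forall>\<tau>\<in>uhp. \<forall>z.
           ((\<lambda>(n, r). c n r * ee (of_int n * \<tau>) * ee (of_int r * z)) has_sum g \<tau> z) UNIV))"
  have wh: "g \<in> wh_jacobi1 k m \<longleftrightarrow> holomorphic2 g \<and>
     (\<forall>a b c d :: int. a * d - b * c = 1 \<longrightarrow>
        (\<forall>\<tau>\<in>uhp. \<forall>z.
           g ((of_int a * \<tau> + of_int b) / (of_int c * \<tau> + of_int d)) (z / (of_int c * \<tau> + of_int d)) =
           (of_int c * \<tau> + of_int d) powi k
             * ee (of_int (2 * m) * (of_int c * z\<^sup>2 / (2 * (of_int c * \<tau> + of_int d)))) * g \<tau> z)) \<and>
     (\<forall>l \<mu> :: int. \<forall>\<tau>\<in>uhp. \<forall>z.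
        g \<tau> (z + of_int l * \<tau> + of_int \<mu>) =
        altsign (2 * m * (l + \<mu>)) * ee (of_int (2 * m) * (- ((of_int l)\<^sup>2 * \<tau> + 2 * of_int l * z) / 2)) * g \<tau> z) \<and> E"
    unfolding wh_jacobi1_def mem_Collect_eq E_def e1 e2[symmetric] ..
  show ?thesis
  proof
    assume g: "g \<in> wh_jacobi1 k m"
    then have E unfolding wh by (elim conjE)
    then obtain n0 c where c: "\<forall>n<n0. \<forall>r. c n r = 0"
      "\<forall>\<tau>\<in>uhp. \<forall>z. ((\<lambda>(n, r). c n r * ee (of_int n * \<tau>) * ee (of_int r * z)) has_sum g \<tau> z) UNIV"
      unfolding E_def by (elim exE conjE)
    have "moderate_growth 1 g"
    proof (rule moderate_growth_of_expansion)
      show "c n r = 0" if "n < n0" for n r using c(1) that by blast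
      show "((\<lambda>(n, r). c n r * ee (of_int n * \<tau>) * ee ((of_int r + of_real 0) * z)) has_sum g \<tau> z) UNIV" if "\<tau> \<in> uhp" for \<tau> z
        using c(2) that by simp
    qed
    then show "jacobi_like k (2 * m) g"
      using g unfolding wh jacobi_like_def by blast
  next
    assume g: "jacobi_like k (2 * m) g"
    show "g \<in> wh_jacobi1 k m"
    proof (rule jacobi_like_expansion[OF g])
      fix c :: "int \<Rightarrow> int \<Rightarrow> complex" and n0
      assume c: "\<And>n r. n < n0 \<Longrightarrow> c n r = 0"
        "\<And>\<tau> z. \<tau> \<in> uhp \<Longrightarrow> ((\<lambda>(n, r). c n r * ee (of_int n * \<tau>) * ee ((of_int r + of_real (of_int (2 * m) / 2)) * z)) has_sum g \<tau> z) UNIV"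
      \<comment> \<open>For \<open>M = 2 m\<close> the offset \<open>M / 2\<close> is the integer
        \<open>m\<close> and is absorbed into the index \<open>r\<close>.\<close>
      define c' where "c' = (\<lambda>n r. c n (r - m))"
      have "((\<lambda>(n, r). c' n r * ee (of_int n * \<tau>) * ee (of_int r * z)) has_sum g \<tau> z) UNIV" if "\<tau> \<in> uhp" for \<tau> z
      proof -
        have m: "of_real (of_int (2 * m) / 2) = (of_int m :: complex)" by simp
        have "((\<lambda>(n, r). c n r * ee (of_int n * \<tau>) * ee ((of_int r + of_int m) * z)) has_sum g \<tau> z) UNIV"
          using c(2)[OF that] unfolding m .
        also have "?this \<longleftrightarrow> ?thesis"
          by (rule has_sum_reindex_bij_witness[of _ "\<lambda>(n, r). (n, r - m)" "\<lambda>(n, r). (n, r + m)"])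
             (simp_all add: c'_def case_prod_unfold)
        finally show ?thesis .
      qed
      then have E unfolding E_def using c(1) by (intro exI[of _ n0] exI[of _ c']) (auto simp: c'_def)
      then show "g \<in> wh_jacobi1 k m"
        using g unfolding wh jacobi_like_def by blast
    qed
  qed
qed

lemma jacobi_paramsE:
  assumes "jacobi_params k m h"
  obtains j M :: int where "k - h / 2 = of_int j" "2 * m = of_int M" "M \<ge> 0"
    "\<lfloor>k - h / 2\<rfloor> = j" "\<lfloor>2 * m\<rfloor> = M" "m \<in> \<int> \<longleftrightarrow> even M"
proof -
  obtain j :: int where "2 * k - h = 2 * of_int j" using assms unfolding jacobi_params_def by blast
  then have j: "k - h / 2 = of_int j" by (simp add: field_simps)
  obtain M :: int where M: "2 * m = of_int M" using assms unfolding jacobi_params_def by (auto elim: Ints_cases)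
  have "0 \<le> 2 * m" using assms unfolding jacobi_params_def by simp
  then have "M \<ge> 0" unfolding M by simp
  have "m \<in> \<int> \<longleftrightarrow> even M"
  proof
    assume "m \<in> \<int>"
    then obtain i :: int where "m = of_int i" by (auto elim: Ints_cases)
    with M have "(of_int (2 * i) :: rat) = of_int M" by simp
    then have "M = 2 * i" by (simp only: of_int_eq_iff)
    then show "even M" by simp
  next
    assume "even M"
    then obtain i where "M = 2 * i" by blast
    with M have "m = of_int i" by simp
    then show "m \<in> \<int>" by simp
  qed
  then show ?thesis using that[OF j M \<open>M \<ge> 0\<close>] j M by simp
qed

text \<open>For half-integral \<open>m\<close> the function in the definition is
  \<open>normalized_theta\<close> times \<open>eta_pow (- h) \<tau> * \<phi> \<tau> z\<close>. Its
  weight and twice its index are moved by -1 and 1, which is undone by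
  \<open>jacobi_like_theta_mult_iff\<close>.\<close>

theorem wh_jacobi_iff:
  assumes "jacobi_params k m h"
  shows "\<phi> \<in> wh_jacobi k m h \<longleftrightarrow>
    holomorphic2 \<phi> \<and> jacobi_like \<lfloor>k - h / 2\<rfloor> \<lfloor>2 * m\<rfloor> (\<lambda>\<tau> z. eta_pow (- h) \<tau> * \<phi> \<tau> z)"
proof -
  obtain j M where jM: "k - h / 2 = of_int j" "2 * m = of_int M" "M \<ge> 0"
    "\<lfloor>k - h / 2\<rfloor> = j" "\<lfloor>2 * m\<rfloor> = M" "m \<in> \<int> \<longleftrightarrow> even M"
    by (rule jacobi_paramsE[OF assms])
  show ?thesis
  proof (cases "m \<in> \<int>")
    case True
    then obtain i where i: "M = 2 * i" using jM(6) by blast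
    have "m = of_int i" using jM(2) i by simp
    then have "\<lfloor>m\<rfloor> = i" by simp
    then show ?thesis
      unfolding wh_jacobi_def mem_Collect_eq wh_jacobi1_iff jM(4,5) using True i by simp
  next
    case False
    then obtain i where i: "M = 2 * i + 1" using jM(6) by (blast elim: oddE)
    have "m + 1 / 2 = of_int (i + 1)" using jM(2) i by (simp add: field_simps)
    then have f1: "2 * \<lfloor>m + 1 / 2\<rfloor> = M + 1" using i by (simp only: floor_of_int) simp
    have "k - 1 - h / 2 = of_int (j - 1)" using jM(1) by (simp add: algebra_simps)
    then have f2: "\<lfloor>k - 1 - h / 2\<rfloor> = j - 1" by (simp only: floor_of_int)
    have eq: "eta_pow (- h - 3) \<tau> * jtheta \<tau> z * \<phi> \<tau> z = normalized_theta \<tau> z * (eta_pow (- h) \<tau> * \<phi> \<tau> z)"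
      if "\<tau> \<in> uhp" for \<tau> z
      using eta_pow_add[OF that, of "- h" "- 3"] by (simp add: normalized_theta_def mult_ac)
    have "holomorphic2 \<phi> \<Longrightarrow> holomorphic2 (\<lambda>\<tau> z. eta_pow (- h) \<tau> * \<phi> \<tau> z)"
      by (intro holomorphic2_mult holomorphic2_of_fst eta_pow_holomorphic)
    then show ?thesis
      unfolding wh_jacobi_def mem_Collect_eq wh_jacobi1_iff jM(4,5) f1 f2 using False
      by (auto simp: jacobi_like_theta_mult_iff jacobi_like_cong[OF eq])
  qed
qed

section \<open>Fourier coefficients\<close>

lemma of_rat_complex_Re [simp]: "complex_of_real (of_rat q) = of_rat q"
  by (rule of_rat_complex[symmetric])

definition coset_supported :: "rat \<Rightarrow> rat \<Rightarrow> (rat \<Rightarrow> rat \<Rightarrow> complex) \<Rightarrow> bool" where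
  "coset_supported a b c \<longleftrightarrow> (\<forall>n r. c n r \<noteq> 0 \<longrightarrow> n - a \<in> \<int> \<and> r - b \<in> \<int>)"

text \<open>Turns expansions indexed by pairs of rationals into sums over pairs of integers, where
  uniqueness of Fourier coefficients is available.\<close>

lemma coset_supported_has_sum_iff:
  assumes "coset_supported a b c"
  shows "((\<lambda>(n, r). c n r * ee (of_rat n * \<tau>) * ee (of_rat r * z)) has_sum S) UNIV \<longleftrightarrow>
    ((\<lambda>(i, j). c (a + of_int i) (b + of_int j) * ee ((of_int i + of_rat a) * \<tau>) * ee ((of_int j + of_rat b) * z)) has_sum S) UNIV"
proof -
  define A where "A = {(n, r). n - a \<in> \<int> \<and> r - b \<in> (\<int> :: rat set)}"
  have "((\<lambda>(n, r). c n r * ee (of_rat n * \<tau>) * ee (of_rat r * z)) has_sum S) UNIV \<longleftrightarrow>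
      ((\<lambda>(n, r). c n r * ee (of_rat n * \<tau>) * ee (of_rat r * z)) has_sum S) A"
    by (rule has_sum_cong_neutral) (use assms in \<open>auto simp: A_def coset_supported_def\<close>)
  also have "\<dots> \<longleftrightarrow> ((\<lambda>(i, j). c (a + of_int i) (b + of_int j) * ee ((of_int i + of_rat a) * \<tau>) * ee ((of_int j + of_rat b) * z)) has_sum S) UNIV"
  proof (rule has_sum_reindex_bij_witness[of _ "\<lambda>(i, j). (a + of_int i, b + of_int j)" "\<lambda>(n, r). (\<lfloor>n - a\<rfloor>, \<lfloor>r - b\<rfloor>)"])
    fix p assume "p \<in> A"
    then obtain i j where p: "p = (a + of_int i, b + of_int j)"
      by (auto simp: A_def elim!: Ints_cases) (metis add.commute diff_add_cancel)
    show "(case case p of (n, r) \<Rightarrow> (\<lfloor>n - a\<rfloor>, \<lfloor>r - b\<rfloor>) of (i, j) \<Rightarrow> (a + of_int i, b + of_int j)) = p"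
      "(case case p of (n, r) \<Rightarrow> (\<lfloor>n - a\<rfloor>, \<lfloor>r - b\<rfloor>) of (i, j) \<Rightarrow>
         c (a + of_int i) (b + of_int j) * ee ((of_int i + of_rat a) * \<tau>) * ee ((of_int j + of_rat b) * z)) =
       (case p of (n, r) \<Rightarrow> c n r * ee (of_rat n * \<tau>) * ee (of_rat r * z))"
      unfolding p by (simp_all add: of_rat_add add.commute)
  qed (auto simp: A_def)
  finally show ?thesis .
qed

text \<open>For \<open>Im \<tau> = 1\<close> and real \<open>z\<close>, the difference of the two
  expansions, freed from the characters \<open>a\<close> and \<open>b\<close> of the coset, is a
  double Fourier series with sum 0.\<close>

lemma coset_supported_coeff_unique:
  assumes c: "coset_supported a b c" "coset_supported a b c'"
    and s: "\<And>\<tau> z. \<tau> \<in> uhp \<Longrightarrow> ((\<lambda>(n, r). c n r * ee (of_rat n * \<tau>) * ee (of_rat r * z)) has_sum F \<tau> z) UNIV"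
    and s': "\<And>\<tau> z. \<tau> \<in> uhp \<Longrightarrow> ((\<lambda>(n, r). c' n r * ee (of_rat n * \<tau>) * ee (of_rat r * z)) has_sum F \<tau> z) UNIV"
  shows "c = c'"
proof -
  define d where "d = (\<lambda>n r. c n r - c' n r)"
  have d: "coset_supported a b d"
    using c unfolding coset_supported_def d_def by (metis diff_self)
  have "((\<lambda>(n, r). d n r * ee (of_rat n * \<tau>) * ee (of_rat r * z)) has_sum 0) UNIV" if "\<tau> \<in> uhp" for \<tau> z
    using has_sum_diff[OF s[OF that, of z] s'[OF that, of z]] by (simp add: d_def case_prod_unfold algebra_simps)
  then have s0: "((\<lambda>(i, j). d (a + of_int i) (b + of_int j) * ee ((of_int i + of_rat a) * \<tau>) * ee ((of_int j + of_rat b) * z)) has_sum 0) UNIV"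
    if "\<tau> \<in> uhp" for \<tau> z
    unfolding coset_supported_has_sum_iff[OF d] using that by blast
  have "d (a + of_int i) (b + of_int j) * ee (of_int i * \<i>) = 0" for i j
  proof (rule fourier2_coeff_eq_0[of "\<lambda>i j. d (a + of_int i) (b + of_int j) * ee (of_int i * \<i>)"])
    fix x y :: real
    define \<tau> where "\<tau> = of_real x + \<i>"
    have "\<tau> \<in> uhp" by (simp add: \<tau>_def uhp_def)
    define E where "E = ee (- (of_rat a * \<tau>)) * ee (- (of_rat b * of_real y))"
    have "E * (case p of (i, j) \<Rightarrow> d (a + of_int i) (b + of_int j) * ee ((of_int i + of_rat a) * \<tau>) * ee ((of_int j + of_rat b) * of_real y)) =
      (case p of (i, j) \<Rightarrow> d (a + of_int i) (b + of_int j) * ee (of_int i * \<i>) * ee (of_int i * of_real x) * ee (of_int j * of_real y))" for p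
    proof (cases p)
      case (Pair i j)
      have "- (of_rat a * \<tau>) + - (of_rat b * of_real y) + ((of_int i + of_rat a) * \<tau> + (of_int j + of_rat b) * of_real y) =
          of_int i * \<i> + of_int i * of_real x + of_int j * of_real y"
        by (simp add: \<tau>_def algebra_simps)
      then have "E * (ee ((of_int i + of_rat a) * \<tau>) * ee ((of_int j + of_rat b) * of_real y)) =
          ee (of_int i * \<i>) * ee (of_int i * of_real x) * ee (of_int j * of_real y)"
        by (simp only: E_def ee_add[symmetric])
      then show ?thesis by (simp add: Pair mult_ac)
    qed
    then show "((\<lambda>(i, j). d (a + of_int i) (b + of_int j) * ee (of_int i * \<i>) * ee (of_int i * of_real x) * ee (of_int j * of_real y)) has_sum 0) UNIV"
      using has_sum_cmult_right[OF s0[OF \<open>\<tau> \<in> uhp\<close>, of "of_real y"], of E] by simp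
  qed
  then have d0: "d (a + of_int i) (b + of_int j) = 0" for i j by simp
  have "d n r = 0" for n r
  proof (rule ccontr)
    assume "d n r \<noteq> 0"
    then obtain i j where "n - a = of_int i" "r - b = of_int j"
      using d unfolding coset_supported_def by (metis Ints_cases)
    then have "n = a + of_int i" "r = b + of_int j" by (simp_all add: algebra_simps)
    with d0 \<open>d n r \<noteq> 0\<close> show False by simp
  qed
  then show ?thesis by (simp add: d_def fun_eq_iff)
qed

lemma fourier_expansion_iff:
  "fourier_expansion m h \<phi> c \<longleftrightarrow> coset_supported (h / 24) m c \<and> (\<exists>n0. \<forall>n r. c n r \<noteq> 0 \<longrightarrow> n0 \<le> n) \<and>
     (\<forall>\<tau>\<in>uhp. \<forall>z. ((\<lambda>(n, r). c n r * ee (of_rat n * \<tau>) * ee (of_rat r * z)) has_sum \<phi> \<tau> z) UNIV)"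
proof -
  have "(\<exists>n0. \<forall>n r. c n r \<noteq> 0 \<longrightarrow> n - h / 24 \<in> \<int> \<and> n \<ge> n0 \<and> r - m \<in> \<int>) \<longleftrightarrow>
      coset_supported (h / 24) m c \<and> (\<exists>n0. \<forall>n r. c n r \<noteq> 0 \<longrightarrow> n0 \<le> n)"
    unfolding coset_supported_def by metis
  then show ?thesis unfolding fourier_expansion_def by (simp only: conj_assoc)
qed

lemma fourier_coeff_eqI:
  assumes "fourier_expansion m h \<phi> c"
  shows "fourier_coeff m h \<phi> = c"
  unfolding fourier_coeff_def
proof (rule the_equality[where P="fourier_expansion m h \<phi>", OF assms])
  fix c' assume "fourier_expansion m h \<phi> c'"
  then show "c' = c"
    using assms unfolding fourier_expansion_iff by (intro coset_supported_coeff_unique[of "h / 24" m c' c \<phi>]) auto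
qed

section \<open>Support and symmetry of the Fourier coefficients of a nonzero form\<close>

locale wh_jacobi_form =
  fixes k m h :: rat and \<phi> :: "complex \<Rightarrow> complex \<Rightarrow> complex"
  assumes params: "jacobi_params k m h" and wh: "\<phi> \<in> wh_jacobi k m h" and nonzero: "nonzero \<phi>"
begin

definition g :: "complex \<Rightarrow> complex \<Rightarrow> complex" where
  "g = (\<lambda>\<tau> z. eta_pow (- h) \<tau> * \<phi> \<tau> z)"

definition M :: int where "M = \<lfloor>2 * m\<rfloor>"

lemma M: "of_int M = 2 * m" "M \<ge> 0"
  using jacobi_paramsE[OF params] unfolding M_def by metis+

lemma of_rat_m: "of_rat m = (of_int M / 2 :: 'a :: field_char_0)"
proof -
  have "of_rat (2 * m) = (of_int M :: 'a)" unfolding M(1)[symmetric] by simp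
  then have "2 * of_rat m = (of_int M :: 'a)" by (simp add: of_rat_mult)
  then show ?thesis by (simp add: eq_divide_eq mult.commute)
qed

lemma m_nonneg: "m \<ge> 0"
  using params by (simp add: jacobi_params_def)

lemma holo: "holomorphic2 \<phi>" and jl: "jacobi_like \<lfloor>k - h / 2\<rfloor> M g"
  using wh unfolding wh_jacobi_iff[OF params] g_def M_def by auto

lemma \<phi>_eq: "\<tau> \<in> uhp \<Longrightarrow> \<phi> \<tau> z = eta_pow h \<tau> * g \<tau> z"
  using eta_pow_minus[of \<tau> h] by (simp add: g_def mult.assoc[symmetric] mult.commute)

lemma \<phi>_elliptic:
  assumes "\<tau> \<in> uhp"
  shows "\<phi> \<tau> (z + of_int l * \<tau> + of_int \<mu>) =
    altsign (M * (l + \<mu>)) * ee (- of_rat m * ((of_int l)\<^sup>2 * \<tau> + 2 * of_int l * z)) * \<phi> \<tau> z"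
proof -
  have "of_int M * (- ((of_int l)\<^sup>2 * \<tau> + 2 * of_int l * z) / 2) = - of_rat m * ((of_int l)\<^sup>2 * \<tau> + 2 * of_int l * z)"
  proof -
    have "of_int M * (- X / 2) = - (of_int M / 2) * X" for X :: complex by simp
    then show ?thesis unfolding of_rat_m by blast
  qed
  then show ?thesis
    using jacobi_likeD(3)[OF jl assms, of z l \<mu>] \<phi>_eq[OF assms] by simp
qed

text \<open>The cosets come from the translations by 1: \<open>eta_pow_shift\<close> contributes
  \<open>e(h/24)\<close> in \<tau>, and the elliptic law contributes the sign
  \<open>(-1)^M = e(m)\<close> in \<open>z\<close>.\<close>

lemma expansion_exists: "\<exists>c. fourier_expansion m h \<phi> c"
proof -
  have gr: "moderate_growth 1 \<phi>"
    using moderate_growth_mult[OF moderate_growth_eta_pow[of 1 h] jacobi_likeD(4)[OF jl]]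
      moderate_growth_cong[of \<phi> "\<lambda>\<tau> z. eta_pow h \<tau> * g \<tau> z" 1] \<phi>_eq by blast
  have sh: "\<phi> (\<tau> + 1) z = ee (of_real (of_rat (h / 24))) * \<phi> \<tau> z" if "\<tau> \<in> uhp" for \<tau> z
  proof -
    have "\<tau> + 1 \<in> uhp" using that by (simp add: uhp_def)
    then show ?thesis
      using \<phi>_eq that jacobi_like_periods(1)[OF jl that] eta_pow_shift[OF that, of h]
      by (simp add: of_rat_divide)
  qed
  have sh': "\<phi> \<tau> (z + 1) = ee (of_real (of_rat m)) * \<phi> \<tau> z" if "\<tau> \<in> uhp" for \<tau> z
    using \<phi>_elliptic[OF that, of z 0 1] by (simp add: of_rat_m ee_half_int)
  show ?thesis
  proof (rule fourier_expansion_of_growth[OF holo sh sh' gr])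
    fix c :: "int \<Rightarrow> int \<Rightarrow> complex" and n0
    assume c: "\<And>n r. n < n0 \<Longrightarrow> c n r = 0"
      "\<And>\<tau> z. \<tau> \<in> uhp \<Longrightarrow> ((\<lambda>(i, j). c i j * ee ((of_int i + of_real (of_rat (h / 24))) * \<tau>) * ee ((of_int j + of_real (of_rat m)) * z)) has_sum \<phi> \<tau> z) UNIV"
    define c' where "c' = (\<lambda>n r. if n - h / 24 \<in> \<int> \<and> r - m \<in> \<int> then c \<lfloor>n - h / 24\<rfloor> \<lfloor>r - m\<rfloor> else 0)"
    have s: "coset_supported (h / 24) m c'"
      by (simp add: coset_supported_def c'_def)
    have "h / 24 + of_int n0 \<le> n" if "c' n r \<noteq> 0" for n r
    proof -
      have "n - h / 24 \<in> \<int>" "c \<lfloor>n - h / 24\<rfloor> \<lfloor>r - m\<rfloor> \<noteq> 0" using that by (auto simp: c'_def split: if_splits)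
      then have "n0 \<le> \<lfloor>n - h / 24\<rfloor>" using c(1) not_le by blast
      then show ?thesis by (simp add: le_floor_iff algebra_simps)
    qed
    moreover have "((\<lambda>(n, r). c' n r * ee (of_rat n * \<tau>) * ee (of_rat r * z)) has_sum \<phi> \<tau> z) UNIV" if "\<tau> \<in> uhp" for \<tau> z
      unfolding coset_supported_has_sum_iff[OF s] using c(2)[OF that, of z] by (simp add: c'_def)
    ultimately show ?thesis
      using s unfolding fourier_expansion_iff by blast
  qed
qed

abbreviation c :: "rat \<Rightarrow> rat \<Rightarrow> complex" where "c \<equiv> fourier_coeff m h \<phi>"

lemma expansion: "fourier_expansion m h \<phi> c"
  using expansion_exists fourier_coeff_eqI by metis

lemma c_support: "coset_supported (h / 24) m c"
  using expansion unfolding fourier_expansion_iff by blast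

lemma c_has_sum:
  "\<tau> \<in> uhp \<Longrightarrow> ((\<lambda>(n, r). c n r * ee (of_rat n * \<tau>) * ee (of_rat r * z)) has_sum \<phi> \<tau> z) UNIV"
  using expansion unfolding fourier_expansion_iff by blast

lemma c_bounded_below:
  obtains n0 where "\<And>n r. c n r \<noteq> 0 \<Longrightarrow> n0 \<le> n"
  using expansion unfolding fourier_expansion_iff by metis

lemma two_r_int: "c n r \<noteq> 0 \<Longrightarrow> 2 * r \<in> \<int>"
proof -
  assume "c n r \<noteq> 0"
  then obtain i where "r - m = of_int i"
    using c_support unfolding coset_supported_def by (metis Ints_cases)
  then have "2 * r = of_int (2 * i + M)" by (simp add: M algebra_simps)
  then show ?thesis by (metis Ints_of_int)
qed

text \<open>Only shifts by even multiples of \<open>\<tau>\<close> are used: they preserve the coset of \<open>n\<close> for half-integral index.\<close>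

lemma c_shift: "c (n + 2 * of_int l * r + 4 * m * (of_int l)\<^sup>2) (r + 4 * m * of_int l) = c n r"
proof -
  \<comment> \<open>\<open>A\<close> and \<open>B\<close> are both the coefficients of
    \<open>\<phi> \<tau> (z + 2 l \<tau>)\<close>, found by substitution into the expansion and by
    the elliptic law respectively. The uniqueness of coefficients identifies them.\<close>
  define A where "A = (\<lambda>n r. c (n - 2 * of_int l * r) r)"
  define B where "B = (\<lambda>n r. c (n + 4 * m * (of_int l)\<^sup>2) (r + 4 * m * of_int l))"
  have m4: "4 * m * q \<in> \<int>" if "q \<in> \<int>" for q
  proof -
    have "4 * m = of_int (2 * M)" by (simp add: M)
    then show ?thesis using that by (simp only: Ints_mult Ints_of_int)
  qed
  have sA: "coset_supported (h / 24) m A"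
    unfolding coset_supported_def
  proof (intro allI impI)
    fix n r assume "A n r \<noteq> 0"
    then have *: "n - 2 * of_int l * r - h / 24 \<in> \<int>" "r - m \<in> \<int>" "2 * r \<in> \<int>"
      using c_support two_r_int unfolding coset_supported_def A_def by blast+
    have "n - h / 24 = (n - 2 * of_int l * r - h / 24) + of_int l * (2 * r)" by simp
    then show "n - h / 24 \<in> \<int> \<and> r - m \<in> \<int>" using * by (metis Ints_add Ints_mult Ints_of_int)
  qed
  have sB: "coset_supported (h / 24) m B"
    unfolding coset_supported_def
  proof (intro allI impI)
    fix n r assume "B n r \<noteq> 0"
    then have *: "n + 4 * m * (of_int l)\<^sup>2 - h / 24 \<in> \<int>" "r + 4 * m * of_int l - m \<in> \<int>"
      using c_support unfolding coset_supported_def B_def by blast+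
    have "n - h / 24 = (n + 4 * m * (of_int l)\<^sup>2 - h / 24) - 4 * m * (of_int l)\<^sup>2"
      "r - m = (r + 4 * m * of_int l - m) - 4 * m * of_int l" by auto
    then show "n - h / 24 \<in> \<int> \<and> r - m \<in> \<int>" using * m4[of "of_int l"] m4[of "(of_int l)\<^sup>2"]
      by (metis Ints_diff Ints_of_int Ints_power)
  qed
  have "A = B"
  proof (rule coset_supported_coeff_unique[OF sA sB])
    fix \<tau> z assume \<tau>: "\<tau> \<in> uhp"
    define z' where "z' = z + of_int (2 * l) * \<tau> + of_int 0"
    have "((\<lambda>(n, r). c n r * ee (of_rat n * \<tau>) * ee (of_rat r * z')) has_sum \<phi> \<tau> z') UNIV"
      by (rule c_has_sum[OF \<tau>])
    also have "?this \<longleftrightarrow> ((\<lambda>(n, r). A n r * ee (of_rat n * \<tau>) * ee (of_rat r * z)) has_sum \<phi> \<tau> z') UNIV"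
    proof (rule has_sum_reindex_bij_witness[of _ "\<lambda>(n, r). (n - 2 * of_int l * r, r)" "\<lambda>(n, r). (n + 2 * of_int l * r, r)"])
      fix p :: "rat \<times> rat"
      obtain n r where p: "p = (n, r)" by fastforce
      have "of_rat (n + 2 * of_int l * r) * \<tau> + of_rat r * z = of_rat n * \<tau> + of_rat r * z'"
        by (simp add: z'_def of_rat_add of_rat_mult algebra_simps)
      then have "ee (of_rat (n + 2 * of_int l * r) * \<tau>) * ee (of_rat r * z) = ee (of_rat n * \<tau>) * ee (of_rat r * z')"
        by (simp only: ee_add[symmetric])
      then show "(case case p of (n, r) \<Rightarrow> (n + 2 * of_int l * r, r) of (n, r) \<Rightarrow> A n r * ee (of_rat n * \<tau>) * ee (of_rat r * z)) =
          (case p of (n, r) \<Rightarrow> c n r * ee (of_rat n * \<tau>) * ee (of_rat r * z'))"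
        by (simp add: p A_def mult.assoc)
    qed auto
    finally show "((\<lambda>(n, r). A n r * ee (of_rat n * \<tau>) * ee (of_rat r * z)) has_sum \<phi> \<tau> z') UNIV" .
    define E where "E = ee (- of_rat m * ((of_int (2 * l))\<^sup>2 * \<tau> + 2 * of_int (2 * l) * z))"
    have \<phi>z': "E * \<phi> \<tau> z = \<phi> \<tau> z'"
      using \<phi>_elliptic[OF \<tau>, of z "2 * l" 0] by (simp add: z'_def E_def altsign_even)
    have "((\<lambda>p. E * (case p of (n, r) \<Rightarrow> c n r * ee (of_rat n * \<tau>) * ee (of_rat r * z))) has_sum E * \<phi> \<tau> z) UNIV"
      by (intro has_sum_cmult_right c_has_sum \<tau>)
    also have "?this \<longleftrightarrow> ((\<lambda>(n, r). B n r * ee (of_rat n * \<tau>) * ee (of_rat r * z)) has_sum \<phi> \<tau> z') UNIV"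
    proof (rule has_sum_reindex_bij_witness[of _ "\<lambda>(n, r). (n + 4 * m * (of_int l)\<^sup>2, r + 4 * m * of_int l)"
          "\<lambda>(n, r). (n - 4 * m * (of_int l)\<^sup>2, r - 4 * m * of_int l)"])
      fix p :: "rat \<times> rat"
      obtain n r where p: "p = (n, r)" by fastforce
      have "of_rat (n - 4 * m * (of_int l)\<^sup>2) * \<tau> + of_rat (r - 4 * m * of_int l) * z =
          - of_rat m * ((of_int (2 * l))\<^sup>2 * \<tau> + 2 * of_int (2 * l) * z) + of_rat n * \<tau> + of_rat r * z"
        by (simp add: of_rat_diff of_rat_mult of_rat_power power2_eq_square algebra_simps)
      then have "ee (of_rat (n - 4 * m * (of_int l)\<^sup>2) * \<tau>) * ee (of_rat (r - 4 * m * of_int l) * z) = E * ee (of_rat n * \<tau>) * ee (of_rat r * z)"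
        by (simp only: ee_add[symmetric] E_def)
      then show "(case case p of (n, r) \<Rightarrow> (n - 4 * m * (of_int l)\<^sup>2, r - 4 * m * of_int l) of (n, r) \<Rightarrow> B n r * ee (of_rat n * \<tau>) * ee (of_rat r * z)) =
          E * (case p of (n, r) \<Rightarrow> c n r * ee (of_rat n * \<tau>) * ee (of_rat r * z))"
        by (simp add: p B_def mult.assoc mult.left_commute)
    qed (auto simp: \<phi>z')
    finally show "((\<lambda>(n, r). B n r * ee (of_rat n * \<tau>) * ee (of_rat r * z)) has_sum \<phi> \<tau> z') UNIV" .
  qed
  then have "A (n + 2 * of_int l * r) r = B (n + 2 * of_int l * r) r" by simp
  then show ?thesis by (simp add: A_def B_def)
qed

text \<open>In index 0 the shift moves \<open>n\<close> by arbitrary even multiples of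
  \<open>r\<close> without changing the coefficient. For \<open>r\<close> different from 0 this
  would push \<open>n\<close> below its lower bound.\<close>

lemma c_index_0:
  assumes "m = 0" "c n r \<noteq> 0"
  shows "r = 0"
proof (rule ccontr)
  assume "r \<noteq> 0"
  obtain n0 where n0: "\<And>n r. c n r \<noteq> 0 \<Longrightarrow> n0 \<le> n" by (rule c_bounded_below) blast
  have "n0 \<le> n + 2 * of_int l * r" for l
    using n0[of "n + 2 * of_int l * r" r] c_shift[of n l r] assms by simp
  \<comment> \<open>According to the sign of \<open>r\<close>, one of the two choices of
    \<open>l\<close> gives \<open>l * r \<le> - (n - n0 + 1)\<close>, which moves \<open>n\<close>
    below \<open>n0\<close>.\<close>
  note * = this[of "- \<lceil>(n - n0 + 1) / r\<rceil>"] this[of "- \<lfloor>(n - n0 + 1) / r\<rfloor>"]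
  have n: "n0 \<le> n" using n0 assms by blast
  show False
  proof (cases "r > 0")
    case True
    have "(n - n0 + 1) / r * r \<le> of_int \<lceil>(n - n0 + 1) / r\<rceil> * r"
      using True by (intro mult_right_mono) auto
    then show False using *(1) True n by simp
  next
    case False
    then have "r < 0" using \<open>r \<noteq> 0\<close> by simp
    then have "(n - n0 + 1) / r * r \<le> of_int \<lfloor>(n - n0 + 1) / r\<rfloor> * r"
      by (intro mult_right_mono_neg) auto
    then show False using *(2) \<open>r < 0\<close> n by simp
  qed
qed

text \<open>The shift preserves \<open>4 m n - r^2\<close> and moves \<open>r\<close> by multiples
  of \<open>4 m\<close>. So \<open>r\<close> can be brought between 0 and \<open>4 m\<close>, where
  \<open>n \<ge> n0\<close> bounds the discriminant below by \<open>4 m n0 - 16 m^2\<close>.\<close>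

lemma c_discriminant_bound:
  assumes "m > 0"
  obtains K where "\<And>n r. c n r \<noteq> 0 \<Longrightarrow> - K \<le> 4 * m * n - r\<^sup>2"
proof -
  obtain n0 where n0: "\<And>n r. c n r \<noteq> 0 \<Longrightarrow> n0 \<le> n" by (rule c_bounded_below) blast
  have "- (16 * m\<^sup>2 - 4 * m * n0) \<le> 4 * m * n - r\<^sup>2" if "c n r \<noteq> 0" for n r
  proof -
    define l r' n' where "l = - \<lfloor>r / (4 * m)\<rfloor>" and "r' = r + 4 * m * of_int l"
      and "n' = n + 2 * of_int l * r + 4 * m * (of_int l)\<^sup>2"
    have "c n' r' \<noteq> 0" using c_shift[of n l r] that by (simp add: n'_def r'_def)
    then have "4 * m * n0 \<le> 4 * m * n'" using n0 assms by (intro mult_left_mono) auto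
    moreover have "4 * m * n' - r'\<^sup>2 = 4 * m * n - r\<^sup>2"
      by (simp add: n'_def r'_def power2_eq_square algebra_simps)
    moreover have "r'\<^sup>2 \<le> (4 * m)\<^sup>2"
    proof (rule power_mono)
      have "r' = r - 4 * m * of_int \<lfloor>r / (4 * m)\<rfloor>" by (simp add: r'_def l_def)
      moreover have "of_int \<lfloor>r / (4 * m)\<rfloor> * (4 * m) \<le> r"
        using assms by (subst pos_le_divide_eq[symmetric]) auto
      moreover have "r < (of_int \<lfloor>r / (4 * m)\<rfloor> + 1) * (4 * m)"
        using assms floor_correct[of "r / (4 * m)"] by (simp add: pos_divide_less_eq)
      ultimately show "r' \<le> 4 * m" "0 \<le> r'" by (simp_all add: algebra_simps)
    qed
    ultimately show ?thesis by (simp add: power2_eq_square)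
  qed
  then show ?thesis by (rule that)
qed

lemma c_nonzero: obtains n r where "c n r \<noteq> 0"
proof -
  obtain \<tau> z where \<tau>: "\<tau> \<in> uhp" "\<phi> \<tau> z \<noteq> 0" using nonzero unfolding nonzero_def by blast
  have "\<exists>n r. c n r \<noteq> 0"
  proof (rule ccontr)
    assume "\<not> (\<exists>n r. c n r \<noteq> 0)"
    then have "((\<lambda>_. 0) has_sum \<phi> \<tau> z) (UNIV :: (rat \<times> rat) set)"
      using c_has_sum[OF \<tau>(1), of z] by (simp add: case_prod_unfold)
    then show False using \<tau>(2) has_sum_0_simp has_sum_unique by blast
  qed
  then show ?thesis using that by blast
qed

end

section \<open>The order function\<close>

lemma finite_rat_cosets_bounded:
  fixes L U R :: real
  shows "finite {p. fst p - a \<in> \<int> \<and> snd p - b \<in> \<int> \<and> L \<le> of_rat (fst p) \<and> of_rat (fst p) \<le> U \<and> \<bar>of_rat (snd p)\<bar> \<le> R}"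
    (is "finite ?S")
proof (rule finite_subset)
  let ?I = "{\<lfloor>L - of_rat a\<rfloor>..\<lceil>U - of_rat a\<rceil>} \<times> {\<lfloor>- R - of_rat b\<rfloor>..\<lceil>R - of_rat b\<rceil>}"
  show "?S \<subseteq> (\<lambda>(i, j). (a + of_int i, b + of_int j)) ` ?I"
  proof
    fix p assume p: "p \<in> ?S"
    then obtain i j where "fst p - a = of_int i" "snd p - b = of_int j" by (auto elim!: Ints_cases)
    then have ij: "fst p = a + of_int i" "snd p = b + of_int j" by (simp_all add: algebra_simps)
    then have "of_rat (fst p) = of_rat a + real_of_int i" "of_rat (snd p) = of_rat b + real_of_int j"
      by (simp_all add: of_rat_add)
    moreover from p have "L \<le> of_rat (fst p)" "of_rat (fst p) \<le> U" "\<bar>of_rat (snd p)\<bar> \<le> R"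
      unfolding mem_Collect_eq by blast+
    ultimately have "L - of_rat a \<le> of_int i" "of_int i \<le> U - of_rat a" "- R - of_rat b \<le> of_int j" "of_int j \<le> R - of_rat b"
      by linarith+
    then have "\<lfloor>L - of_rat a\<rfloor> \<le> i" "i \<le> \<lceil>U - of_rat a\<rceil>" "\<lfloor>- R - of_rat b\<rfloor> \<le> j" "j \<le> \<lceil>R - of_rat b\<rceil>"
      by linarith+
    then show "p \<in> (\<lambda>(i, j). (a + of_int i, b + of_int j)) ` ?I"
      using ij by (intro image_eqI[of _ _ "(i, j)"]) (auto simp: prod_eq_iff)
  qed
qed auto

lemma le_of_square_le_linear:
  fixes t a b :: real
  assumes "t\<^sup>2 \<le> a + b * t" "t \<ge> 0" "b \<ge> 0"
  shows "t \<le> \<bar>a\<bar> + b + 1"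
proof (rule ccontr)
  assume "\<not> ?thesis"
  then have t: "\<bar>a\<bar> + b + 1 < t" by simp
  then have "(\<bar>a\<bar> + b + 1) * t \<le> t * t" using assms by (intro mult_right_mono) auto
  moreover have "\<bar>a\<bar> * 1 \<le> \<bar>a\<bar> * t" using t assms by (intro mult_left_mono) auto
  ultimately have "a + b * t + t \<le> t * t" by (simp add: algebra_simps)
  then show False using assms(1) t assms(3) by (simp add: power2_eq_square)
qed

lemma continuous_on_Min_finite:
  fixes f :: "'a \<Rightarrow> 'b :: topological_space \<Rightarrow> real"
  assumes "finite P" "P \<noteq> {}" "\<And>p. p \<in> P \<Longrightarrow> continuous_on S (f p)"
  shows "continuous_on S (\<lambda>x. Min ((\<lambda>p. f p x) ` P))"
  using assms by (induction P rule: finite_ne_induct) (auto intro!: continuous_intros)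

text \<open>A nonempty open set of reals is uncountable and therefore contains an irrational
  number.\<close>

lemma continuous_eq_of_eq_irrational:
  fixes f g :: "real \<Rightarrow> real"
  assumes "continuous_on UNIV f" "continuous_on UNIV g" "\<And>x. x \<notin> \<rat> \<Longrightarrow> f x = g x"
  shows "f x = g x"
proof (rule ccontr)
  assume "f x \<noteq> g x"
  then have "{x. f x \<noteq> g x} \<noteq> {}" by auto
  moreover have "open {x. f x \<noteq> g x}" using assms(1,2) by (rule open_Collect_neq)
  ultimately obtain y where "y \<in> {x. f x \<noteq> g x}" "y \<notin> \<rat>"
    using open_minus_countable[OF countable_rat] by metis
  then show False using assms(3) by simp
qed

context wh_jacobi_form
begin

text \<open>The exponent of the term \<open>p\<close> along \<open>z = x \<tau> + y\<close>. The
  quadratic part is the same for all terms, so any two of these functions differ by an affine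
  one.\<close>

definition lv :: "real \<Rightarrow> rat \<times> rat \<Rightarrow> real" where
  "lv x p = of_rat (fst p) + of_rat (snd p) * x + of_rat m * x\<^sup>2"

definition supp :: "(rat \<times> rat) set" where
  "supp = {p. c (fst p) (snd p) \<noteq> 0}"

abbreviation J :: "real \<Rightarrow> real" where "J \<equiv> jord m h \<phi>"

lemma ord_values_eq: "ord_values m h \<phi> x = lv x ` supp"
  unfolding ord_values_def lv_def supp_def by (auto intro!: image_eqI[of _ _ "(n, r)" for n r])

lemma of_rat_m_nonneg: "(of_rat m :: real) \<ge> 0"
  using m_nonneg by simp

text \<open>Finiteness holds uniformly for \<open>x\<close> in a bounded interval. For
  \<open>m > 0\<close> the discriminant bound gives \<open>r^2 \<le> 4 m n + K\<close>, while
  \<open>lv x p \<le> T\<close> bounds \<open>n\<close> by a linear function of the absolute value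
  of \<open>r\<close>; both together bound \<open>r\<close>, and then \<open>n\<close>.\<close>

lemma finite_supp_bounded: "finite {p \<in> supp. \<exists>x. \<bar>x\<bar> \<le> X \<and> lv x p \<le> T}"
proof -
  obtain n0 where n0: "\<And>n r. c n r \<noteq> 0 \<Longrightarrow> n0 \<le> n" by (rule c_bounded_below) blast
  have "\<exists>R. \<forall>p\<in>supp. \<forall>x. \<bar>x\<bar> \<le> X \<longrightarrow> lv x p \<le> T \<longrightarrow> \<bar>of_rat (snd p)\<bar> \<le> (R :: real)"
  proof (cases "m = 0")
    case True
    have "snd p = 0" if "p \<in> supp" for p
      using c_index_0[OF True] that unfolding supp_def mem_Collect_eq .
    then show ?thesis by (intro exI[of _ 0]) simp
  next
    case False
    then have m: "m > 0" using m_nonneg by simp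
    then have m': "(of_rat m :: real) > 0" by simp
    obtain K where K: "\<And>n r. c n r \<noteq> 0 \<Longrightarrow> - K \<le> 4 * m * n - r\<^sup>2"
      using c_discriminant_bound[OF m] by blast
    define a b :: real where "a = 4 * of_rat m * T + of_rat K" and "b = 4 * of_rat m * \<bar>X\<bar>"
    have "\<bar>of_rat (snd p)\<bar> \<le> \<bar>a\<bar> + b + 1" if p: "p \<in> supp" and x: "\<bar>x\<bar> \<le> X" and T: "lv x p \<le> T" for p x
    proof (rule le_of_square_le_linear)
      have "- K \<le> 4 * m * fst p - (snd p)\<^sup>2" using K p by (simp add: supp_def)
      then have "of_rat (- K) \<le> (of_rat (4 * m * fst p - (snd p)\<^sup>2) :: real)" by (simp only: of_rat_less_eq)
      then have "(of_rat (snd p))\<^sup>2 \<le> 4 * of_rat m * of_rat (fst p) + (of_rat K :: real)"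
        by (simp add: of_rat_minus of_rat_diff of_rat_mult of_rat_power)
      also have "of_rat (fst p) \<le> T + \<bar>of_rat (snd p)\<bar> * \<bar>X\<bar>"
      proof -
        have "- (of_rat (snd p) * x) \<le> \<bar>of_rat (snd p) * x\<bar>" by simp
        also have "\<dots> \<le> \<bar>of_rat (snd p)\<bar> * \<bar>X\<bar>" unfolding abs_mult using x by (intro mult_left_mono) auto
        finally show ?thesis using T m' unfolding lv_def by (smt (verit) mult_nonneg_nonneg zero_le_power2)
      qed
      finally have "(of_rat (snd p))\<^sup>2 \<le> a + b * \<bar>of_rat (snd p)\<bar>"
        using m' by (simp add: a_def b_def algebra_simps)
      then show "\<bar>of_rat (snd p)\<bar>\<^sup>2 \<le> a + b * \<bar>of_rat (snd p)\<bar>"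
        by (simp only: power2_abs)
    qed (use m' in \<open>auto simp: b_def\<close>)
    then show ?thesis by blast
  qed
  then obtain R where R: "\<And>p x. p \<in> supp \<Longrightarrow> \<bar>x\<bar> \<le> X \<Longrightarrow> lv x p \<le> T \<Longrightarrow> \<bar>of_rat (snd p)\<bar> \<le> (R :: real)" by blast
  show ?thesis
  proof (rule finite_subset[OF _ finite_rat_cosets_bounded[of "h / 24" m "of_rat n0" "T + R * X" R]], safe)
    fix n r x assume *: "(n, r) \<in> supp" "\<bar>x\<bar> \<le> X" "lv x (n, r) \<le> T"
    show "fst (n, r) - h / 24 \<in> \<int>" "snd (n, r) - m \<in> \<int>" "of_rat n0 \<le> (of_rat (fst (n, r)) :: real)"
      using * c_support n0 unfolding coset_supported_def supp_def by (auto simp: of_rat_less_eq)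
    have Rr: "\<bar>of_rat r\<bar> \<le> R" using R[OF *] by simp
    then show "\<bar>of_rat (snd (n, r))\<bar> \<le> R" by simp
    have "- (of_rat r * x) \<le> \<bar>of_rat r * x\<bar>" by simp
    also have "\<dots> \<le> R * X" unfolding abs_mult
      using Rr * order_trans[OF abs_ge_zero Rr] by (intro mult_mono) auto
    finally show "of_rat (fst (n, r)) \<le> T + R * X"
      using *(3) of_rat_m_nonneg unfolding lv_def by (smt (verit) fst_conv snd_conv mult_nonneg_nonneg zero_le_power2)
  qed
qed

lemma minimiser_exists: "\<exists>p\<in>supp. \<forall>q\<in>supp. lv x p \<le> lv x q"
proof -
  obtain p0 where p0: "p0 \<in> supp" using c_nonzero by (force simp: supp_def)
  define S where "S = {p \<in> supp. lv x p \<le> lv x p0}"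
  have "finite S"
    by (rule finite_subset[OF _ finite_supp_bounded[of "\<bar>x\<bar>" "lv x p0"]]) (auto simp: S_def)
  moreover have "p0 \<in> S" using p0 by (simp add: S_def)
  ultimately have "Min (lv x ` S) \<in> lv x ` S" "\<And>q. q \<in> S \<Longrightarrow> Min (lv x ` S) \<le> lv x q"
    by (auto intro!: Min_in)
  then obtain p where p: "p \<in> S" "\<And>q. q \<in> S \<Longrightarrow> lv x p \<le> lv x q" by auto
  have "lv x p \<le> lv x q" if "q \<in> supp" for q
  proof (cases "q \<in> S")
    case False
    then have "lv x p0 < lv x q" using that by (simp add: S_def)
    then show ?thesis using p(2)[OF \<open>p0 \<in> S\<close>] by simp
  qed (rule p(2))
  then show ?thesis using p(1) by (intro bexI[of _ p] ballI) (simp_all add: S_def)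
qed

lemma J_attained: "\<exists>p\<in>supp. lv x p = J x" and J_le: "p \<in> supp \<Longrightarrow> J x \<le> lv x p"
proof -
  obtain p where p: "p \<in> supp" "\<And>q. q \<in> supp \<Longrightarrow> lv x p \<le> lv x q" using minimiser_exists by blast
  have "J x = lv x p"
    unfolding jord_def ord_values_eq by (rule Least_equality) (use p in auto)
  then show "\<exists>p\<in>supp. lv x p = J x" "q \<in> supp \<Longrightarrow> J x \<le> lv x q" for q using p by auto
qed

text \<open>The minimum never exceeds the value at a fixed term \<open>p0\<close>, which is bounded
  by one constant \<open>T\<close> on the whole interval. So a single finite set contains the
  minimisers of all \<open>x\<close> there.\<close>

lemma finite_minimisers:
  obtains P where "finite P" "P \<subseteq> supp" "\<And>x p. \<bar>x\<bar> \<le> X \<Longrightarrow> p \<in> supp \<Longrightarrow> lv x p = J x \<Longrightarrow> p \<in> P"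
proof -
  obtain p0 where p0: "p0 \<in> supp" using c_nonzero by (force simp: supp_def)
  define T where "T = of_rat (fst p0) + \<bar>of_rat (snd p0)\<bar> * \<bar>X\<bar> + of_rat m * \<bar>X\<bar>\<^sup>2"
  have "lv x p0 \<le> T" if "\<bar>x\<bar> \<le> X" for x
  proof -
    have "of_rat (snd p0) * x \<le> \<bar>of_rat (snd p0) * x\<bar>" by simp
    also have "\<dots> \<le> \<bar>of_rat (snd p0)\<bar> * \<bar>X\<bar>" unfolding abs_mult using that by (intro mult_left_mono) auto
    finally have 1: "of_rat (snd p0) * x \<le> \<bar>of_rat (snd p0)\<bar> * \<bar>X\<bar>" .
    have "\<bar>x\<bar>\<^sup>2 \<le> \<bar>X\<bar>\<^sup>2" using that by (intro power_mono) auto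
    then have "of_rat m * x\<^sup>2 \<le> of_rat m * \<bar>X\<bar>\<^sup>2" using of_rat_m_nonneg by (intro mult_left_mono) auto
    with 1 show ?thesis by (simp add: lv_def T_def)
  qed
  then have "lv x p \<le> T" if "\<bar>x\<bar> \<le> X" "lv x p = J x" for x p
    using J_le[OF p0, of x] that by fastforce
  then show ?thesis
    by (intro that[OF finite_supp_bounded[of X T]]) auto
qed

lemma lv_continuous: "continuous_on S (\<lambda>x. lv x p)"
  unfolding lv_def by (intro continuous_intros)

text \<open>On each bounded interval the order is a minimum of finitely many quadratic
  polynomials.\<close>

theorem J_continuous: "continuous_on UNIV J"
proof (rule continuous_at_imp_continuous_on, rule ballI)
  fix x :: real
  define X where "X = \<bar>x\<bar> + 1"
  obtain P where P: "finite P" "P \<subseteq> supp" "\<And>x p. \<bar>x\<bar> \<le> X \<Longrightarrow> p \<in> supp \<Longrightarrow> lv x p = J x \<Longrightarrow> p \<in> P"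
    using finite_minimisers by metis
  have "P \<noteq> {}" using J_attained[of x] P(3)[of x] by (auto simp: X_def)
  have eq: "Min ((\<lambda>p. lv y p) ` P) = J y" if "y \<in> {-X<..<X}" for y
  proof (rule Min_eqI)
    show "J y \<in> (\<lambda>p. lv y p) ` P"
      using J_attained[of y] P(3)[of y] that by (auto simp: image_iff) (metis abs_le_iff less_imp_le minus_le_iff prod.collapse)
  qed (use P J_le in auto)
  have "continuous_on {-X<..<X} (\<lambda>y. Min ((\<lambda>p. lv y p) ` P))"
    using P \<open>P \<noteq> {}\<close> by (intro continuous_on_Min_finite lv_continuous)
  then have "continuous_on {-X<..<X} J"
    by (rule continuous_on_cong[THEN iffD1, rotated -1]) (auto simp: eq)
  moreover have "x \<in> {-X<..<X}" by (auto simp: X_def)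
  ultimately show "isCont J x"
    using continuous_on_eq_continuous_at[OF open_greaterThanLessThan] by blast
qed

lemma finite_coincidence: "p \<noteq> q \<Longrightarrow> finite {x. lv x p = lv x q}"
proof (cases "snd p = snd q")
  case True
  assume "p \<noteq> q"
  then have "fst p \<noteq> fst q" using True by (auto simp: prod_eq_iff)
  then have "{x. lv x p = lv x q} = {}" using True by (auto simp: lv_def)
  then show ?thesis by simp
next
  case False
  then have nz: "of_rat (snd p) - of_rat (snd q) \<noteq> (0 :: real)" by simp
  have "{x. lv x p = lv x q} \<subseteq> {(of_rat (fst q) - of_rat (fst p)) / (of_rat (snd p) - of_rat (snd q))}"
    using nz by (auto simp: lv_def field_simps)
  then show ?thesis by (rule finite_subset) simp
qed

text \<open>Break points are the \<open>x\<close> with two different minimisers. On an interval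
  without them, the closed sets where a given term is minimal and where another one is minimal are
  disjoint and cover the interval, so by connectedness one term is minimal throughout.\<close>

theorem J_piecewise_quadratic: "piecewise_quadratic J"
proof -
  define B where "B = {x. \<exists>p\<in>supp. \<exists>q\<in>supp. p \<noteq> q \<and> lv x p = J x \<and> lv x q = J x}"
  have fin: "finite (B \<inter> {s..t})" for s t
  proof -
    define X where "X = max \<bar>s\<bar> \<bar>t\<bar>"
    obtain P where P: "finite P" "P \<subseteq> supp" "\<And>x p. \<bar>x\<bar> \<le> X \<Longrightarrow> p \<in> supp \<Longrightarrow> lv x p = J x \<Longrightarrow> p \<in> P"
      using finite_minimisers by metis
    have "B \<inter> {s..t} \<subseteq> (\<Union>(p, q)\<in>{(p, q)\<in>P \<times> P. p \<noteq> q}. {x. lv x p = lv x q})"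
    proof
      fix x assume "x \<in> B \<inter> {s..t}"
      then obtain p q where "p \<in> supp" "q \<in> supp" "p \<noteq> q" "lv x p = J x" "lv x q = J x" and x: "s \<le> x" "x \<le> t"
        by (auto simp: B_def)
      moreover have "\<bar>x\<bar> \<le> X" using x by (auto simp: X_def)
      ultimately have "(p, q) \<in> {(p, q)\<in>P \<times> P. p \<noteq> q}" "lv x p = lv x q"
        using P(3) by auto
      then show "x \<in> (\<Union>(p, q)\<in>{(p, q)\<in>P \<times> P. p \<noteq> q}. {x. lv x p = lv x q})"
        by blast
    qed
    moreover have "finite {(p, q)\<in>P \<times> P. p \<noteq> q}"
      by (rule finite_subset[of _ "P \<times> P"]) (use P in auto)
    then have "finite (\<Union>(p, q)\<in>{(p, q)\<in>P \<times> P. p \<noteq> q}. {x. lv x p = lv x q})"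
      by (rule finite_UN_I) (auto intro: finite_coincidence)
    ultimately show ?thesis by (rule finite_subset)
  qed
  have quad: "\<exists>a b c. \<forall>x\<in>{s<..<t}. J x = a * x\<^sup>2 + b * x + c" if st: "s < t" "B \<inter> {s<..<t} = {}" for s t
  proof -
    define X where "X = max \<bar>s\<bar> \<bar>t\<bar>"
    obtain P where P: "finite P" "P \<subseteq> supp" "\<And>x p. \<bar>x\<bar> \<le> X \<Longrightarrow> p \<in> supp \<Longrightarrow> lv x p = J x \<Longrightarrow> p \<in> P"
      using finite_minimisers by metis
    define x0 where "x0 = (s + t) / 2"
    have x0: "x0 \<in> {s<..<t}" using st by (auto simp: x0_def)
    obtain p0 where p0: "p0 \<in> supp" "lv x0 p0 = J x0" using J_attained by blast
    define A A' where "A = {x. lv x p0 = J x}" and "A' = (\<Union>p\<in>P - {p0}. {x. lv x p = J x})"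
    have cl: "closed {x. lv x p = J x}" for p
      by (rule closed_Collect_eq[OF lv_continuous J_continuous])
    have "closed A" "closed A'"
      unfolding A_def A'_def using P by (auto intro!: closed_UN cl)
    moreover have "{s<..<t} \<subseteq> A \<union> A'"
    proof
      fix x assume x: "x \<in> {s<..<t}"
      obtain p where p: "p \<in> supp" "lv x p = J x" using J_attained by blast
      moreover have "\<bar>x\<bar> \<le> X" using x by (auto simp: X_def)
      ultimately have "p \<in> P" using P(3) by blast
      then show "x \<in> A \<union> A'" using p by (cases "p = p0") (auto simp: A_def A'_def)
    qed
    moreover have "A \<inter> A' \<inter> {s<..<t} = {}"
      using st(2) p0(1) P(2) unfolding A_def A'_def B_def by blast
    moreover have "A \<inter> {s<..<t} \<noteq> {}" using x0 p0 by (auto simp: A_def)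
    ultimately have "A' \<inter> {s<..<t} = {}"
      using connected_Ioo[of s t] unfolding connected_closed by blast
    then have "x \<in> A" if "x \<in> {s<..<t}" for x
      using \<open>{s<..<t} \<subseteq> A \<union> A'\<close> that by blast
    then have "J x = lv x p0" if "x \<in> {s<..<t}" for x
      using that unfolding A_def mem_Collect_eq by metis
    then show ?thesis
      by (intro exI[of _ "of_rat m"] exI[of _ "of_rat (snd p0)"] exI[of _ "of_rat (fst p0)"] ballI) (simp only: lv_def add_ac)
  qed
  show ?thesis
    unfolding piecewise_quadratic_def using fin quad by (intro exI[of _ B]) auto
qed

lemma irrational_minimiser_unique:
  assumes "x \<notin> \<rat>" "lv x p = lv x q"
  shows "p = q"
proof -
  have eq: "(of_rat (snd p) - of_rat (snd q)) * x = of_rat (fst q) - of_rat (fst p)"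
    using assms(2) by (simp add: lv_def algebra_simps)
  have "snd p = snd q"
  proof (rule ccontr)
    assume "snd p \<noteq> snd q"
    then have "x = of_rat ((fst q - fst p) / (snd p - snd q))"
      using eq by (simp add: of_rat_divide of_rat_diff field_simps)
    then show False using assms(1) by simp
  qed
  then show ?thesis using eq by (simp add: prod_eq_iff)
qed

section \<open>Asymptotics along vertical half-lines\<close>

definition minset :: "real \<Rightarrow> (rat \<times> rat) set" where
  "minset x = {p \<in> supp. lv x p = J x}"

lemma finite_minset: "finite (minset x)"
  by (rule finite_subset[OF _ finite_supp_bounded[of "\<bar>x\<bar>" "J x"]]) (auto simp: minset_def)

text \<open>On \<open>minset x\<close> all exponents equal \<open>J x\<close>. At
  \<open>\<tau> = u + i v\<close> these terms share the factor \<open>exp (- 2 pi J x v)\<close>,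
  and their coefficients times the remaining phases are added up here.\<close>

definition leading :: "real \<Rightarrow> real \<Rightarrow> real \<Rightarrow> complex" where
  "leading u x y = (\<Sum>p\<in>minset x. c (fst p) (snd p) * ee (of_real (of_rat (snd p) * y + J x * u)))"

lemma leading_nonzero:
  assumes "x \<notin> \<rat>"
  shows "leading u x y \<noteq> 0"
proof -
  obtain p where p: "p \<in> supp" "lv x p = J x" using J_attained by blast
  have "minset x = {p}"
  proof (intro equalityI subsetI)
    fix q assume "q \<in> minset x"
    then have "lv x q = lv x p" using p by (simp add: minset_def)
    then show "q \<in> {p}" using irrational_minimiser_unique[OF assms] by blast
  qed (use p in \<open>auto simp: minset_def\<close>)
  then show ?thesis using p by (simp add: leading_def supp_def)
qed

definition restricted :: "real \<Rightarrow> real \<Rightarrow> real \<Rightarrow> real \<Rightarrow> complex" where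
  "restricted u x y v = \<phi> (Complex u v) (of_real x * Complex u v + of_real y) * ee (of_rat m * (of_real x)\<^sup>2 * Complex u v)"

lemma minimum_gap:
  obtains \<delta> where "\<delta> > 0" "\<And>p. p \<in> supp - minset x \<Longrightarrow> J x + \<delta> \<le> lv x p"
proof -
  define S where "S = {p \<in> supp - minset x. lv x p \<le> J x + 1}"
  have "finite S"
    by (rule finite_subset[OF _ finite_supp_bounded[of "\<bar>x\<bar>" "J x + 1"]]) (auto simp: S_def)
  \<comment> \<open>The inserted 1 keeps the minimum defined when \<open>S\<close> is empty, and it
    is a valid gap for the terms above \<open>J x + 1\<close>.\<close>
  define \<delta> where "\<delta> = Min (insert 1 ((\<lambda>p. lv x p - J x) ` S))"
  have pos: "lv x p - J x > 0" if "p \<in> S" for p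
    using that J_le[of p x] by (force simp: S_def minset_def)
  have "\<delta> > 0" unfolding \<delta>_def using \<open>finite S\<close> pos by auto
  moreover have "J x + \<delta> \<le> lv x p" if "p \<in> supp - minset x" for p
  proof (cases "p \<in> S")
    case True
    then have "\<delta> \<le> lv x p - J x" unfolding \<delta>_def using \<open>finite S\<close> by (intro Min_le) auto
    then show ?thesis by simp
  next
    case False
    have "\<delta> \<le> 1" unfolding \<delta>_def using \<open>finite S\<close> by (intro Min_le) auto
    then show ?thesis using False that by (auto simp: S_def)
  qed
  ultimately show ?thesis by (rule that)
qed

text \<open>Comparison with \<open>v = 1\<close>: each term outside \<open>minset x\<close> shrinks
  at least by \<open>exp (- 2 pi \<delta> (v - 1))\<close>, where \<delta> is the gap above the
  minimum. The absolute convergence at \<open>v = 1\<close> supplies the constant.\<close>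

theorem leading_asymptotics:
  "((\<lambda>v. restricted u x y v * of_real (exp (2 * pi * J x * v))) \<longlongrightarrow> leading u x y) at_top"
proof -
  define t where "t = (\<lambda>v p. c (fst p) (snd p) * ee (of_real (of_rat (snd p) * y + lv x p * u)) * of_real (exp (- 2 * pi * (lv x p - J x) * v)))"
  have sum: "(t v has_sum (restricted u x y v * of_real (exp (2 * pi * J x * v)))) supp" if "v > 0" for v
  proof -
    define \<tau> where "\<tau> = Complex u v"
    have \<tau>: "\<tau> \<in> uhp" using that by (simp add: \<tau>_def uhp_def)
    define E where "E = ee (of_rat m * (of_real x)\<^sup>2 * \<tau>) * of_real (exp (2 * pi * J x * v))"
    have "((\<lambda>p. E * (case p of (n, r) \<Rightarrow> c n r * ee (of_rat n * \<tau>) * ee (of_rat r * (of_real x * \<tau> + of_real y)))) has_sum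
        E * \<phi> \<tau> (of_real x * \<tau> + of_real y)) UNIV"
      by (intro has_sum_cmult_right c_has_sum \<tau>)
    moreover have "E * (case p of (n, r) \<Rightarrow> c n r * ee (of_rat n * \<tau>) * ee (of_rat r * (of_real x * \<tau> + of_real y))) = t v p" for p
    proof (cases p)
      case (Pair n r)
      have e: "of_real (exp s) = ee (- (\<i> * of_real s) / (2 * of_real pi))" for s
        by (simp add: ee_def exp_of_real)
      have "of_rat m * (of_real x)\<^sup>2 * \<tau> + - (\<i> * of_real (2 * pi * J x * v)) / (2 * of_real pi) + of_rat n * \<tau> + of_rat r * (of_real x * \<tau> + of_real y) =
          of_real (of_rat r * y + lv x p * u) + - (\<i> * of_real (- 2 * pi * (lv x p - J x) * v)) / (2 * of_real pi)"
        by (simp add: Pair lv_def \<tau>_def Complex_eq field_simps)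
      then have "E * (ee (of_rat n * \<tau>) * ee (of_rat r * (of_real x * \<tau> + of_real y))) =
          ee (of_real (of_rat r * y + lv x p * u)) * of_real (exp (- 2 * pi * (lv x p - J x) * v))"
        unfolding E_def e ee_add[symmetric] by (simp only: add.assoc)
      then show ?thesis by (simp add: Pair t_def mult_ac)
    qed
    ultimately have "(t v has_sum (E * \<phi> \<tau> (of_real x * \<tau> + of_real y))) UNIV" by simp
    then have "(t v has_sum (E * \<phi> \<tau> (of_real x * \<tau> + of_real y))) supp"
      by (rule has_sum_cong_neutral[THEN iffD1, rotated -1]) (auto simp: t_def supp_def)
    then show ?thesis by (simp add: restricted_def E_def \<tau>_def mult_ac)
  qed
  have lead: "(\<Sum>p\<in>minset x. t v p) = leading u x y" for v
    unfolding leading_def by (intro sum.cong refl) (auto simp: t_def minset_def)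
  have rest: "(t v has_sum (restricted u x y v * of_real (exp (2 * pi * J x * v)) - leading u x y)) (supp - minset x)" if "v > 0" for v
    using has_sum_Diff[OF sum[OF that] has_sum_finite[OF finite_minset[of x], of "t v"]] unfolding lead by (auto simp: minset_def)
  obtain \<delta> where \<delta>: "\<delta> > 0" "\<And>p. p \<in> supp - minset x \<Longrightarrow> J x + \<delta> \<le> lv x p" by (rule minimum_gap) blast
  have "(\<lambda>p. norm (t 1 p)) summable_on (supp - minset x)"
    using has_sum_imp_summable[OF rest[of 1]] summable_on_iff_abs_summable_on_complex by auto
  then obtain S where S: "((\<lambda>p. norm (t 1 p)) has_sum S) (supp - minset x)" using has_sum_infsum by blast
  have bound: "norm (restricted u x y v * of_real (exp (2 * pi * J x * v)) - leading u x y) \<le> S * exp (- 2 * pi * \<delta> * (v - 1))" if "v \<ge> 1" for v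
  proof (rule norm_infsum_le[OF rest has_sum_cmult_left[OF S]])
    fix p assume p: "p \<in> supp - minset x"
    have "norm (t v p) = norm (t 1 p) * exp (- 2 * pi * (lv x p - J x) * (v - 1))"
      by (simp add: t_def norm_mult exp_add[symmetric] mult.assoc algebra_simps)
    also have "\<dots> \<le> norm (t 1 p) * exp (- 2 * pi * \<delta> * (v - 1))"
    proof -
      have "\<delta> * (2 * pi * (v - 1)) \<le> (lv x p - J x) * (2 * pi * (v - 1))"
        using \<delta>(2)[OF p] that by (intro mult_right_mono) auto
      moreover have "- 2 * pi * A * (v - 1) = - (A * (2 * pi * (v - 1)))" for A by simp
      ultimately show ?thesis by (intro mult_left_mono) (simp_all only: exp_le_cancel_iff neg_le_iff_le norm_ge_zero)
    qed
    finally show "norm (t v p) \<le> norm (t 1 p) * exp (- 2 * pi * \<delta> * (v - 1))" .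
  qed (use that in auto)
  have "((\<lambda>v. S * exp (- 2 * pi * \<delta> * (v - 1))) \<longlongrightarrow> 0) at_top"
    using \<delta>(1) by real_asymp
  then have "((\<lambda>v. restricted u x y v * of_real (exp (2 * pi * J x * v)) - leading u x y) \<longlongrightarrow> 0) at_top"
    by (rule Lim_null_comparison[rotated]) (use bound in \<open>auto simp: eventually_at_top_linorder\<close>)
  then show ?thesis by (rule LIM_zero_cancel)
qed

text \<open>Division by the known asymptotics leaves \<open>exp (2 pi (t - J x) v)\<close>, which
  has a finite nonzero limit only for \<open>t = J x\<close>.\<close>

lemma J_eqI:
  assumes x: "x \<notin> \<rat>" and L: "L \<noteq> 0"
    and lim: "((\<lambda>v. restricted u x y v * of_real (exp (2 * pi * t * v))) \<longlongrightarrow> L) at_top"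
  shows "J x = t"
proof -
  have C: "leading u x y \<noteq> 0" by (rule leading_nonzero[OF x])
  have pos: "norm L / norm (leading u x y) > 0" using L C by simp
  have "((\<lambda>v. norm (restricted u x y v * of_real (exp (2 * pi * t * v))) / norm (restricted u x y v * of_real (exp (2 * pi * J x * v)))) \<longlongrightarrow>
      norm L / norm (leading u x y)) at_top"
    using C by (intro tendsto_divide tendsto_norm lim leading_asymptotics) auto
  moreover have "\<forall>\<^sub>F v in at_top. restricted u x y v * of_real (exp (2 * pi * J x * v)) \<noteq> 0"
    using leading_asymptotics C by (rule tendsto_imp_eventually_ne)
  then have "\<forall>\<^sub>F v in at_top. norm (restricted u x y v * of_real (exp (2 * pi * t * v))) / norm (restricted u x y v * of_real (exp (2 * pi * J x * v)))
      = exp (2 * pi * (t - J x) * v)"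
    by eventually_elim (auto simp: norm_mult exp_diff[symmetric] algebra_simps)
  ultimately have e: "((\<lambda>v. exp (2 * pi * (t - J x) * v)) \<longlongrightarrow> norm L / norm (leading u x y)) at_top"
    using tendsto_cong by fast
  show ?thesis
  proof (rule linorder_cases[of t "J x"])
    assume "t < J x"
    moreover define d where "d = 2 * pi * (t - J x)"
    ultimately have "d < 0" by (simp add: mult_pos_neg)
    then have "((\<lambda>v. exp (d * v)) \<longlongrightarrow> 0) at_top" by real_asymp
    then have "((\<lambda>v. exp (2 * pi * (t - J x) * v)) \<longlongrightarrow> 0) at_top"
      by (simp only: d_def)
    then have "norm L / norm (leading u x y) = 0" using tendsto_unique[OF _ e] by simp
    then have False using pos by linarith
    then show ?thesis ..
  next
    assume "J x < t"
    moreover define d where "d = 2 * pi * (t - J x)"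
    ultimately have "d > 0" by simp
    then have "filterlim (\<lambda>v. exp (d * v)) at_top at_top" by real_asymp
    then have "filterlim (\<lambda>v. exp (2 * pi * (t - J x) * v)) at_top at_top"
      by (simp only: d_def)
    then show ?thesis
      using not_tendsto_and_filterlim_at_infinity[OF _ e] filterlim_at_top_imp_at_infinity by fastforce
  qed simp
qed

end

section \<open>Periodicity of the order and of the leading constant\<close>

context wh_jacobi_form
begin

text \<open>The factor \<open>e(m x^2 \<tau>)\<close> in \<open>restricted\<close> is made for this:
  it absorbs the part of the elliptic factor that depends on \<tau>, so a shift of \<open>x\<close>
  costs only a constant of modulus 1.\<close>

lemma restricted_shift:
  assumes "v > 0"
  shows "restricted u (x + of_int l) y v =
    altsign (M * l) * ee (- 2 * of_rat m * of_int l * of_real y) * restricted u x y v"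
proof -
  define \<tau> z where "\<tau> = Complex u v" and "z = of_real x * \<tau> + of_real y"
  have \<tau>: "\<tau> \<in> uhp" using assms by (simp add: \<tau>_def uhp_def)
  have "of_real (x + of_int l) * \<tau> + of_real y = z + of_int l * \<tau> + of_int 0"
    by (simp add: z_def algebra_simps)
  then have "restricted u (x + of_int l) y v = altsign (M * l) * (ee (- of_rat m * ((of_int l)\<^sup>2 * \<tau> + 2 * of_int l * z)) *
      ee (of_rat m * (of_real (x + of_int l))\<^sup>2 * \<tau>)) * \<phi> \<tau> z"
    unfolding restricted_def \<tau>_def[symmetric] using \<phi>_elliptic[OF \<tau>, of z l 0] by simp
  also have "ee (- of_rat m * ((of_int l)\<^sup>2 * \<tau> + 2 * of_int l * z)) * ee (of_rat m * (of_real (x + of_int l))\<^sup>2 * \<tau>) =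
      ee (- 2 * of_rat m * of_int l * of_real y) * ee (of_rat m * (of_real x)\<^sup>2 * \<tau>)"
    unfolding ee_add[symmetric] by (rule arg_cong[where f=ee]) (simp add: z_def power2_eq_square algebra_simps)
  finally show ?thesis by (simp add: restricted_def \<tau>_def z_def)
qed

theorem J_periodic: "J (x + 1) = J x"
proof (rule continuous_eq_of_eq_irrational[of "\<lambda>x. J (x + 1)" J])
  show "continuous_on UNIV (\<lambda>x. J (x + 1))"
    by (intro continuous_on_compose2[OF J_continuous] continuous_intros) auto
  show "J (x + 1) = J x" if x: "x \<notin> \<rat>" for x
  proof (rule J_eqI)
    show "x + 1 \<notin> \<rat>" using x Rats_diff[of "x + 1" 1] by auto
    have "\<forall>\<^sub>F v in at_top. altsign M * (restricted 0 x 0 v * of_real (exp (2 * pi * J x * v))) =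
        restricted 0 (x + 1) 0 v * of_real (exp (2 * pi * J x * v))"
      using eventually_gt_at_top[of 0] by eventually_elim (use restricted_shift[of _ 0 x 1 0] in simp)
    then show "((\<lambda>v. restricted 0 (x + 1) 0 v * of_real (exp (2 * pi * J x * v))) \<longlongrightarrow> altsign M * leading 0 x 0) at_top"
      by (rule Lim_transform_eventually[OF tendsto_mult_left[OF leading_asymptotics]])
    show "altsign M * leading 0 x 0 \<noteq> 0" using leading_nonzero[OF x] by simp
  qed
qed (rule J_continuous)

lemma ee_of_real_add_of_int: "ee (of_real (P + Q + of_int w)) = ee (of_real P) * ee (of_real Q)"
  by (simp add: ee_add)

lemma J_periodic_int: "J (x + of_int n) = J x"
proof (induction n rule: int_induct[where k=0])
  case (step1 i)
  then show ?case using J_periodic[of "x + of_int i"] by (simp add: add.assoc)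
next
  case (step2 i)
  then show ?case using J_periodic[of "x + of_int (i - 1)"] by (simp add: add.assoc)
qed simp

text \<open>Even shifts of \<open>x\<close> permute the minimal terms by \<open>c_shift\<close>, and
  even shifts of \<open>y\<close> change the phases by integers because \<open>2 r\<close> is an
  integer. A shift of \<open>u\<close> multiplies every minimal term by the same
  \<open>e(2 a J x)\<close>, which in general is not 1.\<close>

theorem leading_quasi_periodic:
  "leading (u + of_int (2 * a)) (x + of_int (2 * b)) (y + of_int (2 * d)) =
     ee (of_real (of_int (2 * a) * J x - 2 * of_rat m * of_int (2 * b) * y)) * leading u x y"
proof -
  \<comment> \<open>The map of \<open>c_shift\<close> with \<open>l = - b\<close>, so that
    \<open>f p\<close> has at \<open>x + 2 b\<close> the exponent that \<open>p\<close> has at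
    \<open>x\<close>; \<open>f'\<close> is its inverse.\<close>
  define f where "f = (\<lambda>p :: rat \<times> rat. (fst p + 2 * of_int (- b) * snd p + 4 * m * (of_int (- b))\<^sup>2, snd p + 4 * m * of_int (- b)))"
  define f' where "f' = (\<lambda>p :: rat \<times> rat. (fst p + 2 * of_int b * snd p + 4 * m * (of_int b)\<^sup>2, snd p + 4 * m * of_int b))"
  have cf: "c (fst (f p)) (snd (f p)) = c (fst p) (snd p)" for p
    unfolding f_def fst_conv snd_conv by (rule c_shift)
  have cf': "c (fst (f' p)) (snd (f' p)) = c (fst p) (snd p)" for p
    unfolding f'_def fst_conv snd_conv by (rule c_shift)
  have inv: "f (f' p) = p" "f' (f p) = p" for p
    by (simp_all add: f_def f'_def prod_eq_iff power2_eq_square algebra_simps)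
  have lvf: "lv (x + of_int (2 * b)) (f p) = lv x p" for p
    by (simp add: lv_def f_def of_rat_add of_rat_diff of_rat_minus of_rat_mult of_rat_power power2_eq_square algebra_simps)
  have J: "J (x + of_int (2 * b)) = J x" by (rule J_periodic_int)
  have "leading (u + of_int (2 * a)) (x + of_int (2 * b)) (y + of_int (2 * d)) =
      (\<Sum>p\<in>minset x. ee (of_real (of_int (2 * a) * J x - 2 * of_rat m * of_int (2 * b) * y)) *
        (c (fst p) (snd p) * ee (of_real (of_rat (snd p) * y + J x * u))))"
    unfolding leading_def J
  proof (rule sum.reindex_bij_witness[of _ f f'])
    show "f (f' p) = p" "f' (f p) = p" for p by (rule inv)+
    show "f' p \<in> minset x" if "p \<in> minset (x + of_int (2 * b))" for p
      using that lvf[of "f' p"] cf'[of p] J by (simp add: minset_def supp_def inv)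
    show "f p \<in> minset (x + of_int (2 * b))" if "p \<in> minset x" for p
      using that lvf[of p] cf[of p] J by (simp add: minset_def supp_def)
    fix q assume q: "q \<in> minset (x + of_int (2 * b))"
    define p where "p = f' q"
    have qp: "q = f p" by (simp add: p_def inv)
    have "c (fst p) (snd p) \<noteq> 0" using q cf'[of q] by (simp add: p_def minset_def supp_def)
    then obtain i where i: "2 * snd p = of_int i" using two_r_int by (metis Ints_cases)
    have i': "2 * of_rat (snd p) = real_of_int i"
      using arg_cong[OF i, of of_rat] by (simp add: of_rat_mult)
    have m4: "4 * of_rat m = real_of_int (2 * M)" by (simp add: of_rat_m)
    have "of_rat (snd q) * (y + of_int (2 * d)) + J x * (u + of_int (2 * a)) =
        (of_int (2 * a) * J x - 2 * of_rat m * of_int (2 * b) * y) + (of_rat (snd p) * y + J x * u)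
        + (2 * of_rat (snd p) * of_int d - 4 * of_rat m * of_int (2 * b * d))"
      by (simp add: qp f_def of_rat_diff of_rat_mult algebra_simps)
    also have "2 * of_rat (snd p) * of_int d - 4 * of_rat m * of_int (2 * b * d) = real_of_int (i * d - 2 * M * (2 * b * d))"
      unfolding i' m4 by simp
    finally have "ee (of_real (of_rat (snd q) * (y + of_int (2 * d)) + J x * (u + of_int (2 * a)))) =
        ee (of_real (of_int (2 * a) * J x - 2 * of_rat m * of_int (2 * b) * y)) * ee (of_real (of_rat (snd p) * y + J x * u))"
      by (simp only: ee_of_real_add_of_int)
    then show "ee (of_real (of_int (2 * a) * J x - 2 * of_rat m * of_int (2 * b) * y)) *
        (c (fst (f' q)) (snd (f' q)) * ee (of_real (of_rat (snd (f' q)) * y + J x * u))) =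
        c (fst q) (snd q) * ee (of_real (of_rat (snd q) * (y + of_int (2 * d)) + J x * (u + of_int (2 * a))))"
      using cf'[of q] unfolding p_def[symmetric] by (simp only: mult_ac)
  qed
  then show ?thesis by (simp add: leading_def sum_distrib_left)
qed

text \<open>The factor in \<open>leading_quasi_periodic\<close> is 1 once \<open>N * J x\<close> and
  \<open>m * N * y\<close> are integers. For positive \<open>m\<close> no \<open>N\<close> achieves
  this at all real \<open>x\<close>, so a fixed \<open>D\<close> has to clear the denominators; in
  index 0 the value of \<open>J\<close> is rational and constant.\<close>

theorem leading_periodic:
  assumes "D \<ge> (1 :: int)"
  obtains N :: int where "N \<ge> 1"
    "\<And>u x y a b d. m = 0 \<or> (of_int D * x \<in> \<int> \<and> of_int D * y \<in> \<int>) \<Longrightarrow>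
      leading (u + of_int (N * a)) (x + of_int (N * b)) (y + of_int (N * d)) = leading u x y"
proof -
  define s t where "s = fst (quotient_of h)" and "t = snd (quotient_of h)"
  have t: "t > 0" unfolding t_def by (rule quotient_of_denom_pos')
  have h: "h * of_int t = of_int s"
  proof -
    have "h = of_int s / of_int t" by (rule quotient_of_div) (simp add: s_def t_def)
    then show ?thesis using t by (metis nonzero_eq_divide_eq of_int_eq_0_iff less_irrefl)
  qed
  \<comment> \<open>\<open>24 t\<close> clears the denominator of \<open>h / 24\<close>,
    \<open>D^2\<close> that of \<open>x^2\<close>, and the factor 2 replaces \<open>r\<close> and
    \<open>m\<close> by the integers \<open>2 r\<close> and \<open>2 m\<close>; it also makes the
    shifts even.\<close>
  define N where "N = 2 * (24 * t * D\<^sup>2)"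
  have N: "N \<ge> 1"
  proof -
    have "24 * t * D\<^sup>2 > 0" using t assms by simp
    then show ?thesis unfolding N_def by linarith
  qed
  have per: "leading (u + of_int (N * a)) (x + of_int (N * b)) (y + of_int (N * d)) = leading u x y"
    if xy: "m = 0 \<or> (of_int D * x \<in> \<int> \<and> of_int D * y \<in> \<int>)" for u x y and a b d :: int
  proof -
    obtain p where p: "p \<in> supp" "lv x p = J x" using J_attained by blast
    then have cp: "c (fst p) (snd p) \<noteq> 0" by (simp add: supp_def)
    obtain i where i: "fst p - h / 24 = of_int i"
      using c_support cp unfolding coset_supported_def by (metis Ints_cases)
    have "of_int N * fst p = of_int (2 * D\<^sup>2 * s + N * i)"
    proof -
      have "fst p = h / 24 + of_int i" using i by (simp add: algebra_simps)
      then have "of_int N * fst p = 2 * (of_int D)\<^sup>2 * (h * of_int t) + of_int N * of_int i"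
        by (simp add: N_def algebra_simps)
      then show ?thesis by (simp add: h)
    qed
    then have "of_int N * of_rat (fst p) = real_of_int (2 * D\<^sup>2 * s + N * i)"
      by (metis of_rat_mult of_rat_of_int_eq)
    then have Nn: "of_int N * of_rat (fst p) \<in> (\<int> :: real set)" by (metis Ints_of_int)
    have "of_int N * (of_rat (snd p) * x + of_rat m * x\<^sup>2) \<in> \<int> \<and> of_rat m * of_int N * y \<in> \<int>"
    proof (cases "m = 0")
      case True
      then show ?thesis using c_index_0[OF True cp] by simp
    next
      case False
      then have D: "of_int D * x \<in> \<int>" "of_int D * y \<in> \<int>" using xy by auto
      obtain j where j: "2 * snd p = of_int j" using two_r_int[OF cp] by (metis Ints_cases)
      have j': "2 * of_rat (snd p) = real_of_int j"
        using arg_cong[OF j, of of_rat] by (simp add: of_rat_mult)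
      have m2: "2 * of_rat m = real_of_int M" by (simp add: of_rat_m)
      obtain i1 i2 where D': "of_int D * x = of_int i1" "of_int D * y = of_int i2"
        using D by (elim Ints_cases)
      have "of_int N * (of_rat (snd p) * x + of_rat m * x\<^sup>2) =
          of_int (24 * t * D) * (2 * of_rat (snd p)) * (of_int D * x) + of_int (24 * t) * (2 * of_rat m) * (of_int D * x)\<^sup>2"
        by (simp add: N_def power2_eq_square algebra_simps)
      also have "\<dots> \<in> \<int>"
        unfolding j' m2 D' by (intro Ints_add Ints_mult Ints_power Ints_of_int)
      finally have 1: "of_int N * (of_rat (snd p) * x + of_rat m * x\<^sup>2) \<in> \<int>" .
      have "of_rat m * of_int N * y = of_int (24 * t * D) * (2 * of_rat m) * (of_int D * y)"
        by (simp add: N_def power2_eq_square algebra_simps)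
      also have "\<dots> \<in> \<int>"
        unfolding m2 D' by (intro Ints_mult Ints_of_int)
      finally show ?thesis using 1 by simp
    qed
    note * = this
    have "of_int (N * a) * J x - 2 * of_rat m * of_int (N * b) * y =
        of_int a * (of_int N * of_rat (fst p) + of_int N * (of_rat (snd p) * x + of_rat m * x\<^sup>2)) - of_int (2 * b) * (of_rat m * of_int N * y)"
      unfolding p(2)[symmetric] lv_def by (simp add: algebra_simps)
    also have "\<dots> \<in> \<int>"
      by (rule Ints_diff[OF Ints_mult[OF Ints_of_int Ints_add[OF Nn conjunct1[OF *]]] Ints_mult[OF Ints_of_int conjunct2[OF *]]])
    finally obtain w where w: "of_int (N * a) * J x - 2 * of_rat m * of_int (N * b) * y = of_int w"
      by (elim Ints_cases)
    have N2: "N * e = 2 * (24 * t * D\<^sup>2 * e)" for e by (simp add: N_def)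
    have "leading (u + of_int (N * a)) (x + of_int (N * b)) (y + of_int (N * d)) =
        ee (of_real (of_int (N * a) * J x - 2 * of_rat m * of_int (N * b) * y)) * leading u x y"
      unfolding N2 by (rule leading_quasi_periodic)
    then show ?thesis unfolding w by simp
  qed
  show ?thesis by (rule that[OF N per])
qed

text \<open>The constant can vanish only for rational \<open>x\<close>, that is, on a countable
  union of hyperplanes.\<close>

lemma AE_leading_nonzero: "AE (u, x, y) in lborel. leading u x y \<noteq> 0"
proof (rule AE_I')
  define H where "H = (\<lambda>q::real. {p :: real \<times> real \<times> real. fst (snd p) = q})"
  have "H q \<in> null_sets lborel" for q
  proof -
    have "H q = {p. (0, 1, 0) \<bullet> p = q}" by (auto simp: H_def inner_prod_def)
    moreover have "negligible {p :: real \<times> real \<times> real. (0, 1, 0) \<bullet> p = q}"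
      by (rule negligible_hyperplane) (simp add: zero_prod_def)
    ultimately have "negligible (H q)" by simp
    moreover have "closed (H q)" unfolding H_def by (intro closed_Collect_eq continuous_intros)
    ultimately show ?thesis
      by (simp add: negligible_iff_null_sets null_sets_completion_iff borel_closed)
  qed
  then show "(\<Union>q\<in>\<rat>. H q) \<in> null_sets lborel"
    by (intro null_sets_UN' countable_rat) auto
  show "{p \<in> space lborel. \<not> (case p of (u, x, y) \<Rightarrow> leading u x y \<noteq> 0)} \<subseteq> (\<Union>q\<in>\<rat>. H q)"
    using leading_nonzero by (auto simp: H_def)
qed

section \<open>Holomorphic and cuspidal forms of positive index\<close>

lemma lv_complete_square:
  assumes "m > 0"
  shows "lv x p = of_rat m * (x + of_rat (snd p) / (2 * of_rat m))\<^sup>2 + of_rat (4 * fst p * m - (snd p)\<^sup>2) / (4 * of_rat m)"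
  using assms by (simp add: lv_def of_rat_diff of_rat_mult of_rat_power field_simps power2_eq_square)

lemma lv_at_vertex:
  assumes "m > 0"
  shows "lv (- of_rat (snd p) / (2 * of_rat m)) p = of_rat (4 * fst p * m - (snd p)\<^sup>2) / (4 * of_rat m)"
  unfolding lv_complete_square[OF assms] by simp

text \<open>As a function of \<open>x\<close>, the exponent of a term is smallest at its vertex
  \<open>- r / (2 m)\<close>, where it equals the discriminant over \<open>4 m\<close>. So
  \<open>J\<close> at the vertex tests that term. Conversely \<open>J x\<close> is the exponent of
  some term, which also keeps the inequality strict in the cuspidal case.\<close>

theorem jacobi_forms_iff:
  assumes "m > 0"
  shows "\<phi> \<in> jacobi_forms k m h \<longleftrightarrow> (\<forall>x. J x \<ge> 0)"
    and "\<phi> \<in> jacobi_cusp_forms k m h \<longleftrightarrow> (\<forall>x. J x > 0)"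
proof -
  have m: "(of_rat m :: real) > 0" using assms by simp
  have f: "\<phi> \<in> jacobi_forms k m h \<longleftrightarrow> (\<forall>p\<in>supp. 4 * fst p * m - (snd p)\<^sup>2 \<ge> 0)"
    unfolding jacobi_forms_def supp_def using wh by fastforce
  have g: "\<phi> \<in> jacobi_cusp_forms k m h \<longleftrightarrow> (\<forall>p\<in>supp. 4 * fst p * m - (snd p)\<^sup>2 > 0)"
    unfolding jacobi_cusp_forms_def supp_def using wh by fastforce
  show "\<phi> \<in> jacobi_forms k m h \<longleftrightarrow> (\<forall>x. J x \<ge> 0)"
    unfolding f
  proof safe
    fix x assume *: "\<forall>p\<in>supp. 4 * fst p * m - (snd p)\<^sup>2 \<ge> 0"
    obtain p where p: "p \<in> supp" "lv x p = J x" using J_attained by blast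
    then have "(of_rat (4 * fst p * m - (snd p)\<^sup>2) :: real) \<ge> 0" using * by (simp only: zero_le_of_rat_iff)
    then show "J x \<ge> 0"
      unfolding p(2)[symmetric] lv_complete_square[OF assms] using m by (intro add_nonneg_nonneg divide_nonneg_pos mult_nonneg_nonneg) auto
  next
    fix n r assume "\<forall>x. J x \<ge> 0" "(n, r) \<in> supp"
    then have "0 \<le> lv (- of_rat r / (2 * of_rat m)) (n, r)" using J_le order_trans by blast
    then have "0 \<le> (of_rat (4 * n * m - r\<^sup>2) :: real)"
      using lv_at_vertex[OF assms, of "(n, r)"] m unfolding fst_conv snd_conv by (simp only: zero_le_divide_iff) auto
    then show "4 * fst (n, r) * m - (snd (n, r))\<^sup>2 \<ge> 0" by (simp only: zero_le_of_rat_iff fst_conv snd_conv)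
  qed
  show "\<phi> \<in> jacobi_cusp_forms k m h \<longleftrightarrow> (\<forall>x. J x > 0)"
    unfolding g
  proof safe
    fix x assume *: "\<forall>p\<in>supp. 4 * fst p * m - (snd p)\<^sup>2 > 0"
    obtain p where p: "p \<in> supp" "lv x p = J x" using J_attained by blast
    then have "(of_rat (4 * fst p * m - (snd p)\<^sup>2) :: real) > 0" using * by (simp only: zero_less_of_rat_iff)
    then show "J x > 0"
      unfolding p(2)[symmetric] lv_complete_square[OF assms] using m by (intro add_nonneg_pos divide_pos_pos mult_nonneg_nonneg) auto
  next
    fix n r assume "\<forall>x. J x > 0" "(n, r) \<in> supp"
    then have "0 < lv (- of_rat r / (2 * of_rat m)) (n, r)" using J_le less_le_trans by blast
    then have "0 < (of_rat (4 * n * m - r\<^sup>2) :: real)"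
      using lv_at_vertex[OF assms, of "(n, r)"] m unfolding fst_conv snd_conv by (simp only: zero_less_divide_iff) auto
    then show "4 * fst (n, r) * m - (snd (n, r))\<^sup>2 > 0" by (simp only: zero_less_of_rat_iff fst_conv snd_conv)
  qed
qed

end

section \<open>Index 0 and elliptic modular forms\<close>

lemma q_expansion_has_sum_iff:
  "((\<lambda>(n, r). (if r = 0 then a n else 0) * ee (of_rat n * \<tau>) * ee (of_rat r * z)) has_sum S) (UNIV :: (rat \<times> rat) set) \<longleftrightarrow>
   ((\<lambda>n. a n * ee (of_rat n * \<tau>)) has_sum S) UNIV"
proof -
  have "((\<lambda>(n, r). (if r = 0 then a n else 0) * ee (of_rat n * \<tau>) * ee (of_rat r * z)) has_sum S) (UNIV :: (rat \<times> rat) set) \<longleftrightarrow>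
      ((\<lambda>(n, r). (if r = 0 then a n else 0) * ee (of_rat n * \<tau>) * ee (of_rat r * z)) has_sum S) {p. snd p = 0}"
    by (rule has_sum_cong_neutral) auto
  also have "\<dots> \<longleftrightarrow> ((\<lambda>n. a n * ee (of_rat n * \<tau>)) has_sum S) UNIV"
    by (rule has_sum_reindex_bij_witness[of _ "\<lambda>n. (n, 0)" fst]) auto
  finally show ?thesis .
qed

text \<open>A q-expansion is a double expansion supported on \<open>r = 0\<close>, so its uniqueness
  is inherited from two variables.\<close>

lemma q_coeff_eqI:
  assumes "q_expansion h f a"
  shows "q_coeff h f = a"
  unfolding q_coeff_def
proof (rule the_equality[where P="q_expansion h f", OF assms])
  fix a' assume a': "q_expansion h f a'"
  have "(\<lambda>n r. if r = 0 then a' n else 0) = (\<lambda>n r :: rat. if r = 0 then a n else 0)"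
  proof (rule coset_supported_coeff_unique[of "h / 24" 0 _ _ "\<lambda>\<tau> z. f \<tau>"])
    show "coset_supported (h / 24) 0 (\<lambda>n r. if r = 0 then a' n else 0)"
      "coset_supported (h / 24) 0 (\<lambda>n r. if r = 0 then a n else 0)"
      using assms a' unfolding q_expansion_def coset_supported_def by (auto split: if_splits)
  qed (use assms a' in \<open>unfold q_expansion_has_sum_iff, auto simp: q_expansion_def\<close>)
  note eq = this
  have "a' n = a n" for n using fun_cong[OF fun_cong[OF eq, of n], of 0] by simp
  then show "a' = a" by (rule ext)
qed

context wh_jacobi_form
begin

lemma q_expansion_index_0:
  assumes "m = 0"
  shows "q_expansion h (\<lambda>\<tau>. \<phi> \<tau> 0) (\<lambda>n. c n 0)"
  unfolding q_expansion_def
proof (intro conjI ballI)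
  show "\<exists>n0. \<forall>n. c n 0 \<noteq> 0 \<longrightarrow> n - h / 24 \<in> \<int> \<and> n0 \<le> n"
    using expansion unfolding fourier_expansion_iff coset_supported_def by blast
  fix \<tau> assume "\<tau> \<in> uhp"
  have eq: "(if r = 0 then c n 0 else 0) = c n r" for n r
    using c_index_0[OF assms, of n r] by auto
  show "((\<lambda>n. c n 0 * ee (of_rat n * \<tau>)) has_sum \<phi> \<tau> 0) UNIV"
    unfolding q_expansion_has_sum_iff[of "\<lambda>n. c n 0" \<tau> 0, symmetric] eq by (rule c_has_sum[OF \<open>\<tau> \<in> uhp\<close>])
qed

lemma index_0_independent:
  assumes "m = 0" "\<tau> \<in> uhp"
  shows "\<phi> \<tau> z = \<phi> \<tau> 0"
proof -
  have "c n r * ee (of_rat n * \<tau>) * ee (of_rat r * z) = c n r * ee (of_rat n * \<tau>) * ee (of_rat r * 0)" for n r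
    using c_index_0[OF assms(1), of n r] by (cases "c n r = 0") auto
  then show ?thesis
    using c_has_sum[OF assms(2), of z] c_has_sum[OF assms(2), of 0] has_sum_unique by (simp only:) blast
qed

lemma index_0_modular:
  assumes "m = 0"
  shows "(\<lambda>\<tau>. \<phi> \<tau> 0) \<in> wh_modular k h"
proof -
  have "M = 0" using assms M(1) by simp
  then have jl0: "jacobi_like \<lfloor>k - h / 2\<rfloor> 0 g" using jl by simp
  have hol: "(\<lambda>\<tau>. g \<tau> 0) holomorphic_on uhp" by (rule holomorphic2_fst[OF jacobi_likeD(1)[OF jl]])
  have mod: "g ((of_int a * \<tau> + of_int b) / (of_int c * \<tau> + of_int d)) 0 = (of_int c * \<tau> + of_int d) powi \<lfloor>k - h / 2\<rfloor> * g \<tau> 0"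
    if "a * d - b * c = 1" "\<tau> \<in> uhp" for a b c d :: int and \<tau>
    using jacobi_likeD(2)[OF jl0 that, of 0] by simp
  \<comment> \<open>The bound is needed at \<open>z = 0\<close>, hence on the real line and not on
    the line \<open>Im z = 1\<close> of \<open>jacobi_like\<close>.\<close>
  obtain C K v0 where C: "C \<ge> 0" "v0 > 0" "\<And>\<tau> z. Im \<tau> \<ge> v0 \<Longrightarrow> Im z = 0 \<Longrightarrow> norm (g \<tau> z) \<le> C * exp (K * Im \<tau>)"
    using jacobi_like_moderate_growth[OF jl, of 0] unfolding moderate_growth_def by blast
  define n0 where "n0 = \<lfloor>- K / (2 * pi)\<rfloor>"
  have n0: "K \<le> - 2 * pi * of_int n0"
  proof -
    have "2 * pi * of_int n0 \<le> 2 * pi * (- K / (2 * pi))"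
      unfolding n0_def by (intro mult_left_mono of_int_floor_le) auto
    then show ?thesis by simp
  qed
  have "\<exists>a. q_expansion 0 (\<lambda>\<tau>. g \<tau> 0) a"
  proof (rule q_expansion_exists[OF hol _ _ C(2)])
    show "g (\<tau> + 1) 0 = g \<tau> 0" if "\<tau> \<in> uhp" for \<tau>
      by (rule jacobi_like_periods(1)[OF jl that])
    fix \<tau> assume "Im \<tau> \<ge> v0"
    have "K * Im \<tau> \<le> - 2 * pi * of_int n0 * Im \<tau>"
      using n0 C(2) \<open>Im \<tau> \<ge> v0\<close> by (intro mult_right_mono) auto
    then have "C * exp (K * Im \<tau>) \<le> C * exp (- 2 * pi * of_int n0 * Im \<tau>)"
      using C(1) by (intro mult_left_mono) auto
    then show "norm (g \<tau> 0) \<le> C * exp (- 2 * pi * of_int n0 * Im \<tau>)"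
      using C(3)[OF \<open>Im \<tau> \<ge> v0\<close>, of 0] by simp
  next
    fix \<alpha> :: "int \<Rightarrow> complex"
    assume \<alpha>: "\<And>n. n < n0 \<Longrightarrow> \<alpha> n = 0" "\<And>\<tau>. \<tau> \<in> uhp \<Longrightarrow> ((\<lambda>n. \<alpha> n * ee (of_int n * \<tau>)) has_sum g \<tau> 0) UNIV"
    define a :: "rat \<Rightarrow> complex" where "a = (\<lambda>n. if n \<in> \<int> then \<alpha> \<lfloor>n\<rfloor> else 0)"
    have "of_int n0 \<le> n" if "a n \<noteq> 0" for n
      using that \<alpha>(1)[of "\<lfloor>n\<rfloor>"] by (auto simp: a_def le_floor_iff[symmetric] split: if_splits intro: leI)
    moreover have "((\<lambda>n. a n * ee (of_rat n * \<tau>)) has_sum g \<tau> 0) UNIV" if "\<tau> \<in> uhp" for \<tau>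
    proof -
      have "((\<lambda>n. \<alpha> n * ee (of_int n * \<tau>)) has_sum g \<tau> 0) UNIV \<longleftrightarrow> ((\<lambda>n. a n * ee (of_rat n * \<tau>)) has_sum g \<tau> 0) \<int>"
        by (rule has_sum_reindex_bij_witness[of _ floor of_int]) (auto simp: a_def elim: Ints_cases)
      also have "\<dots> \<longleftrightarrow> ((\<lambda>n. a n * ee (of_rat n * \<tau>)) has_sum g \<tau> 0) UNIV"
        by (rule has_sum_cong_neutral) (auto simp: a_def)
      finally show ?thesis using \<alpha>(2)[OF that] by simp
    qed
    ultimately have "q_expansion 0 (\<lambda>\<tau>. g \<tau> 0) a"
      unfolding q_expansion_def by (intro conjI exI[of _ "of_int n0"]) (auto simp: a_def split: if_splits)
    then show ?thesis by blast
  qed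
  then have "(\<lambda>\<tau>. g \<tau> 0) \<in> wh_modular1 \<lfloor>k - h / 2\<rfloor>"
    using hol mod unfolding wh_modular1_def by blast
  then show ?thesis by (simp add: wh_modular_def g_def)
qed

lemma index_0_J:
  assumes "m = 0"
  shows "\<exists>n. c n 0 \<noteq> 0 \<and> J x = of_rat n \<and> (\<forall>n'. c n' 0 \<noteq> 0 \<longrightarrow> n \<le> n')"
proof -
  obtain p where p: "p \<in> supp" "lv x p = J x" using J_attained by blast
  then have r: "snd p = 0" using c_index_0[OF assms] by (simp add: supp_def)
  have "lv x p = of_rat (fst p)" unfolding lv_def r by (simp add: assms)
  then have Jp: "J x = of_rat (fst p)" using p(2) by simp
  have "fst p \<le> n'" if "c n' 0 \<noteq> 0" for n'
  proof -
    have "J x \<le> lv x (n', 0)" using that by (intro J_le) (simp add: supp_def)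
    also have "lv x (n', 0) = of_rat n'" unfolding lv_def by (simp add: assms)
    finally show ?thesis unfolding Jp by (simp add: of_rat_less_eq)
  qed
  then show ?thesis using p(1) r Jp by (intro exI[of _ "fst p"]) (auto simp: supp_def)
qed

lemma index_0_cusp_order:
  assumes "m = 0"
  shows "J x = of_rat (cusp_order h (\<lambda>\<tau>. \<phi> \<tau> 0))"
proof -
  obtain n where n: "c n 0 \<noteq> 0" "J x = of_rat n" "\<And>n'. c n' 0 \<noteq> 0 \<Longrightarrow> n \<le> n'"
    using index_0_J[OF assms] by blast
  have "cusp_order h (\<lambda>\<tau>. \<phi> \<tau> 0) = n"
    unfolding cusp_order_def q_coeff_eqI[OF q_expansion_index_0[OF assms]]
    by (rule Least_equality) (use n in auto)
  then show ?thesis using n(2) by simp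
qed

text \<open>In index 0 the discriminant \<open>4 n m - r^2\<close> is 0 on the whole support and
  does not see \<open>n\<close>; the sign of the order corresponds to the vanishing of low
  coefficients in the q-expansion instead.\<close>

theorem modular_forms_iff:
  assumes "m = 0"
  shows "(\<lambda>\<tau>. \<phi> \<tau> 0) \<in> modular_forms k h \<longleftrightarrow> (\<forall>x. J x \<ge> 0)"
    and "(\<lambda>\<tau>. \<phi> \<tau> 0) \<in> cusp_forms k h \<longleftrightarrow> (\<forall>x. J x > 0)"
proof -
  obtain n where n: "c n 0 \<noteq> 0" "J 0 = of_rat n" "\<And>n'. c n' 0 \<noteq> 0 \<Longrightarrow> n \<le> n'"
    using index_0_J[OF assms] by blast
  have J: "J x = of_rat n" for x using index_0_cusp_order[OF assms] n(2) by metis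
  note q = q_coeff_eqI[OF q_expansion_index_0[OF assms]]
  have "(\<forall>n'<0. c n' 0 = 0) \<longleftrightarrow> 0 \<le> n" "(\<forall>n'\<le>0. c n' 0 = 0) \<longleftrightarrow> 0 < n"
    using n(1,3) by (meson leD leI le_less_trans order_trans)+
  then show "(\<lambda>\<tau>. \<phi> \<tau> 0) \<in> modular_forms k h \<longleftrightarrow> (\<forall>x. J x \<ge> 0)"
    "(\<lambda>\<tau>. \<phi> \<tau> 0) \<in> cusp_forms k h \<longleftrightarrow> (\<forall>x. J x > 0)"
    unfolding modular_forms_def cusp_forms_def mem_Collect_eq q J using index_0_modular[OF assms] by simp_all
qed

end

section \<open>Products and the operators \<open>U_op l\<close>\<close>

lemma jacobi_params_add:
  "jacobi_params k m h \<Longrightarrow> jacobi_params k' m' h' \<Longrightarrow> jacobi_params (k + k') (m + m') (h + h')"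
  unfolding jacobi_params_def
proof (elim conjE exE, intro conjI)
  fix i j :: int
  assume "2 * k - h = 2 * of_int i" "2 * k' - h' = 2 * of_int j"
  then have "2 * (k + k') - (h + h') = 2 * of_int (i + j)" by (simp add: algebra_simps)
  then show "\<exists>j::int. 2 * (k + k') - (h + h') = 2 * of_int j" by blast
qed (auto simp: distrib_left)

lemma jacobi_params_scale:
  "jacobi_params k m h \<Longrightarrow> jacobi_params k (of_int (l\<^sup>2) * m) h"
  unfolding jacobi_params_def
proof (elim conjE, intro conjI)
  assume "2 * m \<in> \<int>"
  then have "of_int (l\<^sup>2) * (2 * m) \<in> \<int>" by (rule Ints_mult[OF Ints_of_int])
  then show "2 * (of_int (l\<^sup>2) * m) \<in> \<int>" by (simp only: mult.left_commute)
qed auto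

lemma irrational_exists: obtains x :: real where "x \<notin> \<rat>"
  using open_minus_countable[OF countable_rat, of UNIV] by auto

locale wh_jacobi_form_pair = A: wh_jacobi_form k m h \<phi> + B: wh_jacobi_form k' m' h' \<psi>
  for k m h \<phi> k' m' h' \<psi>
begin

lemma product_wh: "(\<lambda>\<tau> z. \<phi> \<tau> z * \<psi> \<tau> z) \<in> wh_jacobi (k + k') (m + m') (h + h')"
proof -
  obtain j M where 1: "k - h / 2 = of_int j" "2 * m = of_int M" "M \<ge> 0"
    "\<lfloor>k - h / 2\<rfloor> = j" "\<lfloor>2 * m\<rfloor> = M" "m \<in> \<int> \<longleftrightarrow> even M"
    by (rule jacobi_paramsE[OF A.params])
  obtain j' M' where 2: "k' - h' / 2 = of_int j'" "2 * m' = of_int M'" "M' \<ge> 0"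
    "\<lfloor>k' - h' / 2\<rfloor> = j'" "\<lfloor>2 * m'\<rfloor> = M'" "m' \<in> \<int> \<longleftrightarrow> even M'"
    by (rule jacobi_paramsE[OF B.params])
  have "k + k' - (h + h') / 2 = of_int (j + j')" using 1 2 by (simp add: field_simps)
  then have f1: "\<lfloor>k + k' - (h + h') / 2\<rfloor> = \<lfloor>k - h / 2\<rfloor> + \<lfloor>k' - h' / 2\<rfloor>" using 1 2 by (simp only: floor_of_int)
  have "2 * (m + m') = of_int (M + M')" using 1 2 by (simp add: field_simps)
  then have f2: "\<lfloor>2 * (m + m')\<rfloor> = A.M + B.M" using 1 2 by (simp only: floor_of_int A.M_def B.M_def)
  have "jacobi_like (\<lfloor>k - h / 2\<rfloor> + \<lfloor>k' - h' / 2\<rfloor>) (A.M + B.M) (\<lambda>\<tau> z. A.g \<tau> z * B.g \<tau> z)"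
    by (intro jacobi_like_mult A.jl B.jl)
  also have "?this \<longleftrightarrow> jacobi_like (\<lfloor>k - h / 2\<rfloor> + \<lfloor>k' - h' / 2\<rfloor>) (A.M + B.M) (\<lambda>\<tau> z. eta_pow (- (h + h')) \<tau> * (\<phi> \<tau> z * \<psi> \<tau> z))"
    by (rule jacobi_like_cong) (use eta_pow_add[of _ "- h" "- h'"] in \<open>simp add: A.g_def B.g_def\<close>)
  finally show ?thesis
    unfolding wh_jacobi_iff[OF jacobi_params_add[OF A.params B.params]] f1 f2
    by (intro conjI holomorphic2_mult A.holo B.holo)
qed

lemma restricted_product:
  "A.restricted u x y v * B.restricted u x y v =
     \<phi> (Complex u v) (of_real x * Complex u v + of_real y) * \<psi> (Complex u v) (of_real x * Complex u v + of_real y) *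
     ee (of_rat (m + m') * (of_real x)\<^sup>2 * Complex u v)"
  unfolding A.restricted_def B.restricted_def of_rat_add distrib_right ee_add by (simp only: mult_ac)

lemma product_limit:
  "((\<lambda>v. (A.restricted u x y v * B.restricted u x y v) * of_real (exp (2 * pi * (A.J x + B.J x) * v)))
     \<longlongrightarrow> A.leading u x y * B.leading u x y) at_top"
proof -
  have "((\<lambda>v. (A.restricted u x y v * of_real (exp (2 * pi * A.J x * v))) * (B.restricted u x y v * of_real (exp (2 * pi * B.J x * v))))
     \<longlongrightarrow> A.leading u x y * B.leading u x y) at_top"
    by (intro tendsto_mult A.leading_asymptotics B.leading_asymptotics)
  then show ?thesis by (simp add: distrib_left distrib_right exp_add mult_ac)
qed

text \<open>At an irrational \<open>x\<close> both leading constants are nonzero, so the product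
  does not vanish far up on the corresponding half-line.\<close>

lemma product_nonzero: "nonzero (\<lambda>\<tau> z. \<phi> \<tau> z * \<psi> \<tau> z)"
proof -
  obtain x :: real where x: "x \<notin> \<rat>" by (rule irrational_exists)
  have "A.leading 0 x 0 * B.leading 0 x 0 \<noteq> 0"
    using A.leading_nonzero[OF x] B.leading_nonzero[OF x] by simp
  from tendsto_imp_eventually_ne[OF product_limit this]
  have "\<forall>\<^sub>F v in at_top. v > 0 \<and> (A.restricted 0 x 0 v * B.restricted 0 x 0 v) * of_real (exp (2 * pi * (A.J x + B.J x) * v)) \<noteq> 0"
    using eventually_gt_at_top[of 0] by eventually_elim auto
  then obtain v where v: "v > 0" "A.restricted 0 x 0 v * B.restricted 0 x 0 v \<noteq> 0"
    using eventually_happens'[OF trivial_limit_at_top_linorder] by force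
  have "Complex 0 v \<in> uhp" using v(1) by (simp add: uhp_def)
  then show ?thesis
    using v(2) unfolding restricted_product nonzero_def by force
qed

sublocale AB: wh_jacobi_form "k + k'" "m + m'" "h + h'" "\<lambda>\<tau> z. \<phi> \<tau> z * \<psi> \<tau> z"
  by unfold_locales (rule jacobi_params_add[OF A.params B.params] product_wh product_nonzero)+

lemma J_product: "AB.J x = A.J x + B.J x"
proof (rule continuous_eq_of_eq_irrational[of AB.J "\<lambda>x. A.J x + B.J x"])
  show "AB.J x = A.J x + B.J x" if x: "x \<notin> \<rat>" for x
  proof (rule AB.J_eqI[OF x])
    show "A.leading 0 x 0 * B.leading 0 x 0 \<noteq> 0"
      using A.leading_nonzero[OF x] B.leading_nonzero[OF x] by simp
    show "((\<lambda>v. AB.restricted 0 x 0 v * of_real (exp (2 * pi * (A.J x + B.J x) * v))) \<longlongrightarrow> A.leading 0 x 0 * B.leading 0 x 0) at_top"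
      using product_limit[of 0 x 0] unfolding restricted_product AB.restricted_def .
  qed
qed (intro continuous_intros A.J_continuous B.J_continuous AB.J_continuous)+

end

text \<open>For \<open>l = 0\<close> the function \<open>\<phi> \<tau> 0\<close> may vanish
  identically, as it does for theta by \<open>jtheta_0\<close>, and then has no order.\<close>

locale wh_jacobi_form_scaled = A: wh_jacobi_form k m h \<phi> for k m h \<phi> +
  fixes l :: int
  assumes l: "l \<noteq> 0"
begin

lemma U_op_wh: "U_op l \<phi> \<in> wh_jacobi k (of_int (l\<^sup>2) * m) h"
proof -
  have "2 * (of_int (l\<^sup>2) * m) = of_int (l\<^sup>2 * A.M)" using A.M(1) by simp
  then have f: "\<lfloor>2 * (of_int (l\<^sup>2) * m)\<rfloor> = l\<^sup>2 * A.M" by (simp only: floor_of_int)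
  have u: "U_op l \<phi> = (\<lambda>\<tau> z. \<phi> \<tau> (of_int l * z))" by (simp add: U_op_def fun_eq_iff)
  show ?thesis
    unfolding wh_jacobi_iff[OF jacobi_params_scale[OF A.params]] f u
    using holomorphic2_scale[OF A.holo] jacobi_like_scale[OF A.jl] by (simp add: A.g_def)
qed

lemma U_op_nonzero: "nonzero (U_op l \<phi>)"
proof -
  obtain \<tau> z where "\<tau> \<in> uhp" "\<phi> \<tau> z \<noteq> 0" using A.nonzero unfolding nonzero_def by blast
  then show ?thesis unfolding nonzero_def U_op_def using l by (intro bexI[of _ \<tau>] exI[of _ "z / of_int l"]) auto
qed

sublocale U: wh_jacobi_form k "of_int (l\<^sup>2) * m" h "U_op l \<phi>"
  by unfold_locales (rule jacobi_params_scale[OF A.params] U_op_wh U_op_nonzero)+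

lemma J_U_op: "U.J x = A.J (of_int l * x)"
proof (rule continuous_eq_of_eq_irrational[of U.J "\<lambda>x. A.J (of_int l * x)"])
  show "continuous_on UNIV (\<lambda>x. A.J (of_int l * x))"
    by (intro continuous_on_compose2[OF A.J_continuous] continuous_intros) auto
  show "U.J x = A.J (of_int l * x)" if x: "x \<notin> \<rat>" for x
  proof (rule U.J_eqI[OF x])
    have lx: "of_int l * x \<notin> \<rat>"
    proof
      assume "of_int l * x \<in> \<rat>"
      then have "of_int l * x / of_int l \<in> \<rat>" by (intro Rats_divide) auto
      then show False using x l by simp
    qed
    show "A.leading 0 (of_int l * x) 0 \<noteq> 0" by (rule A.leading_nonzero[OF lx])
    \<comment> \<open>The index \<open>l^2 m\<close> is exactly what turns \<open>m (l x)^2\<close>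
      into the Gaussian exponent at \<open>x\<close>.\<close>
    have "U.restricted 0 x 0 v = A.restricted 0 (of_int l * x) 0 v" for v
      unfolding U.restricted_def A.restricted_def U_op_def
      by (simp add: of_rat_mult of_rat_power power_mult_distrib mult_ac)
    then show "((\<lambda>v. U.restricted 0 x 0 v * of_real (exp (2 * pi * A.J (of_int l * x) * v))) \<longlongrightarrow> A.leading 0 (of_int l * x) 0) at_top"
      using A.leading_asymptotics[of 0 "of_int l * x" 0] by simp
  qed
qed (rule U.J_continuous)

end

theorem theorem2p1:
  fixes k m h :: rat and \<phi> :: "complex \<Rightarrow> complex \<Rightarrow> complex"
  assumes "jacobi_params k m h" and "\<phi> \<in> wh_jacobi k m h" and "nonzero \<phi>"
  shows
    "(\<comment> \<open>the Fourier expansion and the minimum that defines \<open>ord\<close> exist\<close>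
      fourier_expansion m h \<phi> (fourier_coeff m h \<phi>) \<and>
      (\<forall>x. jord m h \<phi> x \<in> ord_values m h \<phi> x \<and>
           (\<forall>t\<in>ord_values m h \<phi> x. jord m h \<phi> x \<le> t))) \<and>
     (\<comment> \<open>(1)\<close>
      continuous_on UNIV (jord m h \<phi>) \<and>
      piecewise_quadratic (jord m h \<phi>) \<and>
      (\<forall>x. jord m h \<phi> (x + 1) = jord m h \<phi> x)) \<and>
     (\<comment> \<open>(2)\<close>
      m = 0 \<longrightarrow>
        (\<forall>\<tau>\<in>uhp. \<forall>z. \<phi> \<tau> z = \<phi> \<tau> 0) \<and>
        (\<lambda>\<tau>. \<phi> \<tau> 0) \<in> wh_modular k h \<and>
        (\<forall>x. jord m h \<phi> x = of_rat (cusp_order h (\<lambda>\<tau>. \<phi> \<tau> 0)))) \<and>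
     (\<comment> \<open>(3)\<close>
      \<exists>C :: real \<Rightarrow> real \<Rightarrow> real \<Rightarrow> complex.
        (\<forall>u x y. \<exists>\<epsilon> :: real \<Rightarrow> complex. (\<epsilon> \<longlongrightarrow> 0) at_top \<and>
           (\<forall>v>0. \<phi> (Complex u v) (of_real x * Complex u v + of_real y)
                      * ee (of_rat m * (of_real x)\<^sup>2 * Complex u v) =
                    (C u x y + \<epsilon> v) * of_real (exp (- 2 * pi * jord m h \<phi> x * v)))) \<and>
        (\<exists>N::int. N \<ge> 1 \<and> (\<forall>u x y. \<forall>a b c :: int.
           C (u + of_int (N * a)) (x + of_int (N * b)) (y + of_int (N * c)) =
           ee (of_real (of_int (N * a) * jord m h \<phi> x - 2 * of_rat m * of_int (N * b) * y))
             * C u x y)) \<and>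
        (\<forall>D::int. D \<ge> 1 \<longrightarrow>
           (\<exists>N::int. N \<ge> 1 \<and>
              (\<forall>u x y. m = 0 \<or> (of_int D * x \<in> \<int> \<and> of_int D * y \<in> \<int>) \<longrightarrow>
                 (\<forall>a b c :: int.
                    C (u + of_int (N * a)) (x + of_int (N * b)) (y + of_int (N * c))
                    = C u x y)))) \<and>
        (AE (u, x, y) in lborel. C u x y \<noteq> 0)) \<and>
     (\<comment> \<open>(4)\<close>
      \<forall>k' m' h' \<psi>. jacobi_params k' m' h' \<and> \<psi> \<in> wh_jacobi k' m' h' \<and> nonzero \<psi> \<longrightarrow>
        (\<lambda>\<tau> z. \<phi> \<tau> z * \<psi> \<tau> z) \<in> wh_jacobi (k + k') (m + m') (h + h') \<and>
        nonzero (\<lambda>\<tau> z. \<phi> \<tau> z * \<psi> \<tau> z) \<and>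
        (\<forall>x. jord (m + m') (h + h') (\<lambda>\<tau> z. \<phi> \<tau> z * \<psi> \<tau> z) x =
             jord m h \<phi> x + jord m' h' \<psi> x)) \<and>
     (\<comment> \<open>(5)\<close>
      (m > 0 \<longrightarrow>
         (\<phi> \<in> jacobi_forms k m h \<longleftrightarrow> (\<forall>x. jord m h \<phi> x \<ge> 0)) \<and>
         (\<phi> \<in> jacobi_cusp_forms k m h \<longleftrightarrow> (\<forall>x. jord m h \<phi> x > 0))) \<and>
      (m = 0 \<longrightarrow>
         ((\<lambda>\<tau>. \<phi> \<tau> 0) \<in> modular_forms k h \<longleftrightarrow> (\<forall>x. jord m h \<phi> x \<ge> 0)) \<and>
         ((\<lambda>\<tau>. \<phi> \<tau> 0) \<in> cusp_forms k h \<longleftrightarrow> (\<forall>x. jord m h \<phi> x > 0)))) \<and>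
     (\<comment> \<open>(6)\<close>
      \<forall>l::int. l \<noteq> 0 \<longrightarrow>
        U_op l \<phi> \<in> wh_jacobi k (of_int (l\<^sup>2) * m) h \<and>
        nonzero (U_op l \<phi>) \<and>
        (\<forall>x. jord (of_int (l\<^sup>2) * m) h (U_op l \<phi>) x = jord m h \<phi> (of_int l * x)))"
proof -
  interpret A: wh_jacobi_form k m h \<phi>
    by unfold_locales (rule assms)+
  have asymptotics: "\<exists>\<epsilon> :: real \<Rightarrow> complex. (\<epsilon> \<longlongrightarrow> 0) at_top \<and>
      (\<forall>v>0. \<phi> (Complex u v) (of_real x * Complex u v + of_real y) * ee (of_rat m * (of_real x)\<^sup>2 * Complex u v) =
        (A.leading u x y + \<epsilon> v) * of_real (exp (- 2 * pi * jord m h \<phi> x * v)))" for u x y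
  proof (intro exI conjI allI impI)
    \<comment> \<open>The error term is solved from the required formula, so the formula holds
      identically in \<open>v\<close> and all content is in this limit.\<close>
    show "((\<lambda>v. A.restricted u x y v * of_real (exp (2 * pi * jord m h \<phi> x * v)) - A.leading u x y) \<longlongrightarrow> 0) at_top"
      by (rule LIM_zero[OF A.leading_asymptotics])
    fix v :: real
    have cancel: "R = (L + (R * E - L)) * F" if "E * F = 1" for R L E F :: complex
      using that by (simp add: mult.assoc)
    have "of_real (exp (2 * pi * jord m h \<phi> x * v)) * of_real (exp (- 2 * pi * jord m h \<phi> x * v)) = (1 :: complex)"
      unfolding of_real_mult[symmetric] exp_add[symmetric] by simp
    then show "\<phi> (Complex u v) (of_real x * Complex u v + of_real y) * ee (of_rat m * (of_real x)\<^sup>2 * Complex u v) =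
        (A.leading u x y + (A.restricted u x y v * of_real (exp (2 * pi * jord m h \<phi> x * v)) - A.leading u x y)) *
        of_real (exp (- 2 * pi * jord m h \<phi> x * v))"
      unfolding A.restricted_def[symmetric] by (rule cancel)
  qed
  have product: "(\<lambda>\<tau> z. \<phi> \<tau> z * \<psi> \<tau> z) \<in> wh_jacobi (k + k') (m + m') (h + h') \<and>
      nonzero (\<lambda>\<tau> z. \<phi> \<tau> z * \<psi> \<tau> z) \<and>
      (\<forall>x. jord (m + m') (h + h') (\<lambda>\<tau> z. \<phi> \<tau> z * \<psi> \<tau> z) x = jord m h \<phi> x + jord m' h' \<psi> x)"
    if "jacobi_params k' m' h' \<and> \<psi> \<in> wh_jacobi k' m' h' \<and> nonzero \<psi>" for k' m' h' \<psi>
  proof -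
    interpret P: wh_jacobi_form_pair k m h \<phi> k' m' h' \<psi>
      by unfold_locales (use that in auto)
    show ?thesis
      using P.product_wh P.product_nonzero P.J_product by blast
  qed
  have scaling: "U_op l \<phi> \<in> wh_jacobi k (of_int (l\<^sup>2) * m) h \<and> nonzero (U_op l \<phi>) \<and>
      (\<forall>x. jord (of_int (l\<^sup>2) * m) h (U_op l \<phi>) x = jord m h \<phi> (of_int l * x))"
    if "l \<noteq> 0" for l :: int
  proof -
    interpret S: wh_jacobi_form_scaled k m h \<phi> l
      by unfold_locales (rule that)
    show ?thesis
      using S.U_op_wh S.U_op_nonzero S.J_U_op by blast
  qed
  have leading: "\<exists>C :: real \<Rightarrow> real \<Rightarrow> real \<Rightarrow> complex.
        (\<forall>u x y. \<exists>\<epsilon> :: real \<Rightarrow> complex. (\<epsilon> \<longlongrightarrow> 0) at_top \<and>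
           (\<forall>v>0. \<phi> (Complex u v) (of_real x * Complex u v + of_real y)
                      * ee (of_rat m * (of_real x)\<^sup>2 * Complex u v) =
                    (C u x y + \<epsilon> v) * of_real (exp (- 2 * pi * jord m h \<phi> x * v)))) \<and>
        (\<exists>N::int. N \<ge> 1 \<and> (\<forall>u x y. \<forall>a b c :: int.
           C (u + of_int (N * a)) (x + of_int (N * b)) (y + of_int (N * c)) =
           ee (of_real (of_int (N * a) * jord m h \<phi> x - 2 * of_rat m * of_int (N * b) * y))
             * C u x y)) \<and>
        (\<forall>D::int. D \<ge> 1 \<longrightarrow>
           (\<exists>N::int. N \<ge> 1 \<and>
              (\<forall>u x y. m = 0 \<or> (of_int D * x \<in> \<int> \<and> of_int D * y \<in> \<int>) \<longrightarrow>
                 (\<forall>a b c :: int.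
                    C (u + of_int (N * a)) (x + of_int (N * b)) (y + of_int (N * c))
                    = C u x y)))) \<and>
        (AE (u, x, y) in lborel. C u x y \<noteq> 0)"
  proof (rule exI[of _ A.leading], intro conjI)
    show "\<exists>N::int. N \<ge> 1 \<and> (\<forall>u x y. \<forall>a b c :: int.
           A.leading (u + of_int (N * a)) (x + of_int (N * b)) (y + of_int (N * c)) =
           ee (of_real (of_int (N * a) * jord m h \<phi> x - 2 * of_rat m * of_int (N * b) * y)) * A.leading u x y)"
      by (intro exI[of _ 2] conjI allI A.leading_quasi_periodic) simp
    show "\<forall>D::int. D \<ge> 1 \<longrightarrow> (\<exists>N::int. N \<ge> 1 \<and>
        (\<forall>u x y. m = 0 \<or> (of_int D * x \<in> \<int> \<and> of_int D * y \<in> \<int>) \<longrightarrow>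
          (\<forall>a b c :: int. A.leading (u + of_int (N * a)) (x + of_int (N * b)) (y + of_int (N * c)) = A.leading u x y)))"
    proof (intro allI impI)
      fix D :: int assume "D \<ge> 1"
      then obtain N :: int where "N \<ge> 1"
        "\<And>u x y a b d. m = 0 \<or> (of_int D * x \<in> \<int> \<and> of_int D * y \<in> \<int>) \<Longrightarrow>
          A.leading (u + of_int (N * a)) (x + of_int (N * b)) (y + of_int (N * d)) = A.leading u x y"
        by (rule A.leading_periodic) blast
      then show "\<exists>N::int. N \<ge> 1 \<and>
        (\<forall>u x y. m = 0 \<or> (of_int D * x \<in> \<int> \<and> of_int D * y \<in> \<int>) \<longrightarrow>
          (\<forall>a b c :: int. A.leading (u + of_int (N * a)) (x + of_int (N * b)) (y + of_int (N * c)) = A.leading u x y))"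
        by (intro exI[of _ N] conjI allI impI)
    qed
  qed (intro allI asymptotics, rule A.AE_leading_nonzero)
  have minimum: "\<forall>x. jord m h \<phi> x \<in> ord_values m h \<phi> x \<and> (\<forall>t\<in>ord_values m h \<phi> x. jord m h \<phi> x \<le> t)"
  proof
    fix x
    obtain p where "p \<in> A.supp" "A.lv x p = jord m h \<phi> x" using A.J_attained by blast
    then have "jord m h \<phi> x \<in> A.lv x ` A.supp" by (metis imageI)
    then show "jord m h \<phi> x \<in> ord_values m h \<phi> x \<and> (\<forall>t\<in>ord_values m h \<phi> x. jord m h \<phi> x \<le> t)"
      unfolding A.ord_values_eq by (intro conjI ballI) (auto intro: A.J_le)
  qed
  have index_0: "m = 0 \<longrightarrow> (\<forall>\<tau>\<in>uhp. \<forall>z. \<phi> \<tau> z = \<phi> \<tau> 0) \<and> (\<lambda>\<tau>. \<phi> \<tau> 0) \<in> wh_modular k h \<and>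
      (\<forall>x. jord m h \<phi> x = of_rat (cusp_order h (\<lambda>\<tau>. \<phi> \<tau> 0)))"
    by (intro impI conjI ballI allI A.index_0_independent A.index_0_modular A.index_0_cusp_order)
  have forms: "m > 0 \<longrightarrow> (\<phi> \<in> jacobi_forms k m h \<longleftrightarrow> (\<forall>x. jord m h \<phi> x \<ge> 0)) \<and>
      (\<phi> \<in> jacobi_cusp_forms k m h \<longleftrightarrow> (\<forall>x. jord m h \<phi> x > 0))"
    by (intro impI conjI A.jacobi_forms_iff)
  have forms_0: "m = 0 \<longrightarrow> ((\<lambda>\<tau>. \<phi> \<tau> 0) \<in> modular_forms k h \<longleftrightarrow> (\<forall>x. jord m h \<phi> x \<ge> 0)) \<and>
      ((\<lambda>\<tau>. \<phi> \<tau> 0) \<in> cusp_forms k h \<longleftrightarrow> (\<forall>x. jord m h \<phi> x > 0))"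
    by (intro impI conjI A.modular_forms_iff)
  have periodic: "\<forall>x. jord m h \<phi> (x + 1) = jord m h \<phi> x"
    by (intro allI A.J_periodic)
  show ?thesis
    by (intro conjI A.expansion minimum A.J_continuous A.J_piecewise_quadratic periodic index_0 leading forms forms_0)
      ((intro allI impI, rule product, assumption), (intro allI impI, rule scaling, assumption))
qed

end
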